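(* Let $X$ be a real Banach space, let $A:\mathbb{R}_+\to L(X)$ and $B:\mathbb{R}\to L(X)$, and let $\{U(t,s)\}_{t\ge s}$, $t,s\in\mathbb{R}_+$, be the evolution family generated by $A(\cdot)$. Suppose that $U(t,s)$ admits a nonuniform exponential dichotomy on $\mathbb{R}_+$ with exponent $\alpha>0$ and bound $Ke^{\epsilon|s|}$ ($K>0$), let $\beta>0$ be such that $0\le\epsilon<\alpha-\beta$, and let $Z$ be a closed subspace of $X$. Put $b(t)=\|B(t)\|e^{\epsilon|t|}$ and suppose that $$\theta:=\sup_{t\in\mathbb{R}}\int_{-\infty}^{+\infty}e^{-(\alpha-\beta)|t-\tau|}\,b(\tau)\,d\tau<\frac1K .$$ Then the perturbed equation $x'(t)=A(t)x(t)+B(t)x(t)$ admits a nonuniform exponential dichotomy on $\mathbb{R}_+$.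
   Context: $L(X)$ is the Banach algebra of bounded linear operators on $X$; $\mathrm{Id}$ is the identity. Evolution family on an interval $J$ ($J=\mathbb{R},\mathbb{R}_+,\mathbb{R}_-$): operators $U(t,s)\in L(X)$, $t\ge s$ in $J$, with $U(t,t)=\mathrm{Id}$, $U(t,s)=U(t,r)U(r,s)$ for $t\ge r\ge s$, and $(t,s)\mapsto U(t,s)x$ continuous for every $x\in X$. It is generated by $A(\cdot)$ if it is the solution operator of $x'=A(t)x$, i.e. $\partial_tU(t,s)=A(t)U(t,s)$ in $L(X)$. Nonuniform exponential dichotomy: an evolution family $U(t,s)$ on $J$ admits a nonuniform exponential dichotomy on $J$ if there is a strongly continuous $P:J\to L(X)$ with $P(t)^2=P(t)$ for all $t$ such that, with $Q(t)=\mathrm{Id}-P(t)$ and $N(P(t))$ the null space of $P(t)$: (i) $U(t,s)P(s)=P(t)U(t,s)$ for $t\ge s$; (ii) $U(t,s)|_{N(P(s))}:N(P(s))\to N(P(t))$ is invertible for $t\ge s$; (iii) there are constants $\alpha,K>0$ and $\epsilon\ge0$ with $$\|U(t,s)P(s)\|\le Ke^{-\alpha(t-s)+\epsilon|s|}\ (t\ge s),\qquad \|U(t,s)Q(s)\|\le Ke^{-\alpha(s-t)+\epsilon|s|}\ (s\ge t),$$ where for $s\ge t$, $U(t,s):=(U(s,t)|_{N(P(t))})^{-1}:N(P(s))\to N(P(t))$. Then $\alpha$ is called the exponent and $Ke^{\epsilon|s|}$ the bound of the dichotomy. The map $B$ is such that $t\mapsto B(t)x$ is strongly measurable for each $x\in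 X$ and $t\mapsto\|B(t)\|$ is measurable. (If $B$ is only given on $\mathbb{R}_+$, it is extended by zero.) The perturbed equation $x'=A(t)x+B(t)x$ on $J$ admits a nonuniform exponential dichotomy on $J$ if its evolution family $\{U_B(t,s)\}_{t\ge s}$ on $J$ does (with some projections, exponent and bound), where $U_B$ is the evolution family satisfying $$U_B(t,s)x=U(t,s)x+\int_s^tU(t,\tau)B(\tau)U_B(\tau,s)x\,d\tau,\qquad t\ge s,\ x\in X.$$ *)

theory Defs
  imports "HOL-Analysis.Analysis"
begin

text \<open>
  Time intervals are sets \<open>J :: real set\<close>, and \<open>U t s\<close> is only meaningful for
  \<open>s, t \<in> J\<close> with \<open>s \<le> t\<close>.
\<close>

definition evolution_family ::
    "real set \<Rightarrow> (real \<Rightarrow> real \<Rightarrow> 'a::real_normed_vector \<Rightarrow>\<^sub>L 'a) \<Rightarrow> bool" where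
  "evolution_family J U \<longleftrightarrow>
     (\<forall>t\<in>J. U t t = id_blinfun) \<and>
     (\<forall>t\<in>J. \<forall>r\<in>J. \<forall>s\<in>J. s \<le> r \<and> r \<le> t \<longrightarrow> U t s = U t r o\<^sub>L U r s) \<and>
     (\<forall>x. continuous_on {(t, s). t \<in> J \<and> s \<in> J \<and> s \<le> t} (\<lambda>(t, s). U t s x))"

text \<open>
  The derivative is taken in operator norm; as \<open>U t s\<close> exists only for \<open>t \<ge> s\<close>, it is
  one-sided at \<open>t = s\<close>.
\<close>

definition generated_by ::
    "real set \<Rightarrow> (real \<Rightarrow> real \<Rightarrow> 'a::real_normed_vector \<Rightarrow>\<^sub>L 'a) \<Rightarrow> (real \<Rightarrow> 'a \<Rightarrow>\<^sub>L 'a) \<Rightarrow> bool" where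
  "generated_by J U A \<longleftrightarrow>
     (\<forall>s\<in>J. \<forall>t\<in>J. s \<le> t \<longrightarrow>
        ((\<lambda>r. U r s) has_vector_derivative (A t o\<^sub>L U t s)) (at t within {r\<in>J. s \<le> r}))"

definition null_space :: "('a::real_normed_vector \<Rightarrow>\<^sub>L 'a) \<Rightarrow> 'a set" where
  "null_space P = {x. blinfun_apply P x = 0}"

text \<open>
  In the last clause the backward operator \<open>U(t,s) = (U(s,t) restricted to N(P(t)))\<inverse>\<close>,
  \<open>s \<ge> t\<close>, is \<open>inv_into (null_space (P t)) (U s t)\<close>; the estimate of the operator norm of
  \<open>U(t,s) Q(s)\<close> is written out pointwise, with \<open>Q(s) x = x - P(s) x\<close>.
\<close>

definition nonuniform_dichotomy ::
    "real set \<Rightarrow> (real \<Rightarrow> real \<Rightarrow> 'a::real_normed_vector \<Rightarrow>\<^sub>L 'a) \<Rightarrow> real \<Rightarrow> real \<Rightarrow> real \<Rightarrow> bool" where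
  "nonuniform_dichotomy J U \<alpha> K \<epsilon> \<longleftrightarrow>
     0 < \<alpha> \<and> 0 < K \<and> 0 \<le> \<epsilon> \<and>
     (\<exists>P :: real \<Rightarrow> 'a \<Rightarrow>\<^sub>L 'a.
        (\<forall>x. continuous_on J (\<lambda>t. blinfun_apply (P t) x)) \<and>
        (\<forall>t\<in>J. P t o\<^sub>L P t = P t) \<and>
        (\<forall>t\<in>J. \<forall>s\<in>J. s \<le> t \<longrightarrow> U t s o\<^sub>L P s = P t o\<^sub>L U t s) \<and>
        (\<forall>t\<in>J. \<forall>s\<in>J. s \<le> t \<longrightarrow>
           bij_betw (blinfun_apply (U t s)) (null_space (P s)) (null_space (P t))) \<and>
        (\<forall>t\<in>J. \<forall>s\<in>J. s \<le> t \<longrightarrow>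
           norm (U t s o\<^sub>L P s) \<le> K * exp (- \<alpha> * (t - s) + \<epsilon> * \<bar>s\<bar>)) \<and>
        (\<forall>t\<in>J. \<forall>s\<in>J. t \<le> s \<longrightarrow>
           (\<forall>x. norm (inv_into (null_space (P t)) (blinfun_apply (U s t)) (x - blinfun_apply (P s) x))
                  \<le> K * exp (- \<alpha> * (s - t) + \<epsilon> * \<bar>s\<bar>) * norm x)))"

text \<open>
  The space need not be separable, so strong measurability (almost everywhere limit of simple
  functions) is not the same as \<open>borel_measurable\<close>.
\<close>

definition strongly_measurable :: "(real \<Rightarrow> 'a::real_normed_vector) \<Rightarrow> bool" where
  "strongly_measurable f \<longleftrightarrow>
     (\<exists>s :: nat \<Rightarrow> real \<Rightarrow> 'a.
        (\<forall>n. simple_function lebesgue (s n)) \<and>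
        (AE t in lebesgue. (\<lambda>n. s n t) \<longlonglongrightarrow> f t))"

text \<open>
  The library's Bochner integral requires a second countable space, so the integral is
  \<open>has_integral\<close>, which is available in every Banach space. The integrand is strongly
  measurable whenever \<open>U\<close> and \<open>V\<close> are evolution families and \<open>\<tau> \<mapsto> B \<tau> x\<close> is strongly
  measurable for each \<open>x\<close>; if moreover \<open>norm \<circ> B\<close> is locally integrable, then it is Bochner
  integrable and the two integrals agree.
\<close>

definition perturbed_evolution_family ::
    "real set \<Rightarrow> (real \<Rightarrow> real \<Rightarrow> 'a::real_normed_vector \<Rightarrow>\<^sub>L 'a) \<Rightarrow> (real \<Rightarrow> 'a \<Rightarrow>\<^sub>L 'a) \<Rightarrow>
      (real \<Rightarrow> real \<Rightarrow> 'a \<Rightarrow>\<^sub>L 'a) \<Rightarrow> bool" where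
  "perturbed_evolution_family J U B V \<longleftrightarrow>
     evolution_family J V \<and>
     (\<forall>s\<in>J. \<forall>t\<in>J. s \<le> t \<longrightarrow>
        (\<forall>x. ((\<lambda>\<tau>. U t \<tau> (B \<tau> (V \<tau> s x))) has_integral (V t s x - U t s x)) {s..t}))"

text \<open>
  ``The'' evolution family of the perturbed equation is read as a definite description: it
  exists, is unique on \<open>{(t, s). s \<le> t}\<close>, and has a dichotomy.
\<close>

definition perturbed_equation_admits_dichotomy ::
    "real set \<Rightarrow> (real \<Rightarrow> real \<Rightarrow> 'a::real_normed_vector \<Rightarrow>\<^sub>L 'a) \<Rightarrow> (real \<Rightarrow> 'a \<Rightarrow>\<^sub>L 'a) \<Rightarrow> bool" where
  "perturbed_equation_admits_dichotomy J U B \<longleftrightarrow>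
     (\<exists>V. perturbed_evolution_family J U B V \<and>
          (\<forall>W. perturbed_evolution_family J U B W \<longrightarrow>
             (\<forall>t\<in>J. \<forall>s\<in>J. s \<le> t \<longrightarrow> W t s = V t s)) \<and>
          (\<exists>\<alpha> K \<epsilon>. nonuniform_dichotomy J V \<alpha> K \<epsilon>))"

end

theory Submission
  imports Defs
begin

text \<open>
  Write \<open>q = K * \<theta> < 1\<close>, \<open>Q = Id - P\<close>, and let \<open>G(t,\<tau>)\<close> be the Green kernel of the given dichotomy:
  \<open>U(t,\<tau>) P(\<tau>)\<close> for \<open>\<tau> \<le> t\<close> and \<open>- U(t,\<tau>) Q(\<tau>)\<close> for \<open>\<tau> > t\<close>, so that
  \<open>norm (G(t,\<tau>)) \<le> K * exp (- \<alpha> * \<bar>t - \<tau>\<bar> + \<epsilon> * \<tau>)\<close>.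

  For fixed \<open>s\<close> and \<open>x\<close> consider the integral equation
  \<open>u(t) = G(t,s) x + (integral over \<tau> \<ge> 0 of G(t,\<tau>) B(\<tau>) u(\<tau>))\<close>. Spending the part \<open>\<beta>\<close> of the decay rate
  on the weight \<open>exp (- \<beta> * \<bar>t - s\<bar>)\<close> leaves the rate \<open>\<alpha> - \<beta>\<close> for the integral, so in the corresponding
  weighted supremum norm the integral operator has norm at most \<open>q\<close>. Hence there is exactly one solution
  of that growth, linear in \<open>x\<close>; call it \<open>G_B(t,s) x\<close>. It satisfies
  \<open>norm (G_B(t,s)) \<le> K / (1 - q) * exp (- \<beta> * \<bar>t - s\<bar> + \<epsilon> * s)\<close>, which are already the two dichotomy estimates
  for the perturbed equation, with projections \<open>P_B(s) = G_B(s,s)\<close>, provided that \<open>G_B\<close> really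
  is the Green kernel of the perturbed family \<open>V\<close>.

  To see this, no further estimate is needed, only uniqueness. Off the diagonal \<open>G_B(\<cdot>,s) x\<close> is an orbit of \<open>V\<close>,
  with a jump by \<open>x\<close> at \<open>s\<close> (lemmas \<open>G_B_forward\<close>, \<open>G_B_backward\<close>). Conversely, one variation of constants
  identity for the kernel \<open>G\<close> along orbits of \<open>V\<close> (\<open>V_variation_of_constants\<close>) exhibits explicit
  solutions of the integral equation: cutting the orbit through \<open>x\<close> out of \<open>G_B(\<cdot>,s) x\<close> solves it for \<open>(t, V(t,s) x)\<close>
  (\<open>green_cut\<close>), and an orbit starting in \<open>N(P(0))\<close>, stopped at \<open>s\<close>, solves it as well
  (\<open>green_unstable\<close>). By uniqueness \<open>P_B\<close> commutes with \<open>V\<close>, is idempotent, has the null spaces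
  \<open>V(s,0) N(P(0))\<close>, on which \<open>V\<close> is invertible, and is strongly continuous.

  The family \<open>V\<close> itself comes from the same weighted fixed point principle, applied to the Volterra kernel on
  compact intervals with a weight growing like the exponential of the integral of \<open>norm B\<close>.

  Since \<open>X\<close> may be non-separable, the integrals are gauge integrals; the functions to be integrated are shown
  to be limits, in the sense of \<open>L\<^sup>1\<close>, of simple functions, a class in which the dominated convergence theorem holds.
\<close>

section \<open>Gauge integrability by approximation in mean\<close>

lemma norm_diff_less_thirds:
  fixes x :: "'a::real_normed_vector"
  assumes "norm (x - x') < e/3" "norm (x' - y') < e/3" "norm (y - y') < e/3"
  shows "norm (x - y) < e"
proof -
  have "norm (x - y) \<le> norm (x - x') + norm (x' - y') + norm (y - y')"
    using norm_triangle_ineq[of "(x - x') + (x' - y')" "y' - y"] norm_triangle_ineq[of "x - x'" "x' - y'"]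
    by (simp add: norm_minus_commute)
  then show ?thesis using assms by simp
qed

text \<open>
  The approximation error enters a Riemann sum of \<open>f\<close> only through a Riemann sum of the majorant \<open>g\<close>, which for
  fine divisions is close to the integral of \<open>g\<close>; so \<open>f\<close> inherits the Cauchy criterion from \<open>h\<close>.
\<close>

lemma integrable_cbox_if_L1_approx:
  fixes f :: "'n::euclidean_space \<Rightarrow> 'b::banach"
  assumes approx: "\<And>e. e > 0 \<Longrightarrow> \<exists>h g. h integrable_on cbox a b \<and> g integrable_on cbox a b \<and>
      integral (cbox a b) g < e \<and> (\<forall>x\<in>cbox a b. norm (f x - h x) \<le> g x)"
  shows "f integrable_on cbox a b"
  unfolding integrable_Cauchy
proof (intro allI impI)
  fix e :: real assume "e > 0"
  then have "e / 6 > 0" by simp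
  from approx[OF this] obtain h g where h: "h integrable_on cbox a b" and g: "g integrable_on cbox a b"
    and gsmall: "integral (cbox a b) g < e / 6" and hg: "\<And>x. x \<in> cbox a b \<Longrightarrow> norm (f x - h x) \<le> g x"
    by blast
  let ?S = "\<lambda>k (D :: ('n \<times> 'n set) set). (\<Sum>(x,K)\<in>D. measure lborel K *\<^sub>R k x)"
  have e3: "e / 3 > 0" using \<open>e > 0\<close> by simp
  obtain \<gamma>1 where \<gamma>1: "gauge \<gamma>1 \<and> (\<forall>D1 D2. D1 tagged_division_of (cbox a b) \<and> \<gamma>1 fine D1 \<and>
       D2 tagged_division_of (cbox a b) \<and> \<gamma>1 fine D2 \<longrightarrow> norm (?S h D1 - ?S h D2) < e / 3)"
    by (rule exE[OF h[unfolded integrable_Cauchy, rule_format, OF e3]])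
  obtain \<gamma>2 where \<gamma>2: "gauge \<gamma>2 \<and> (\<forall>D. D tagged_division_of (cbox a b) \<and> \<gamma>2 fine D \<longrightarrow>
       norm (?S g D - integral (cbox a b) g) < e / 6)"
    by (rule exE[OF integrable_integral[OF g, unfolded has_integral, rule_format, OF \<open>e / 6 > 0\<close>]])
  have near: "norm (?S f D - ?S h D) < e / 3"
    if D: "D tagged_division_of (cbox a b)" "\<gamma>2 fine D" for D
  proof -
    have "norm (?S f D - ?S h D) = norm (\<Sum>(x,K)\<in>D. measure lborel K *\<^sub>R (f x - h x))"
      by (simp add: sum_subtractf[symmetric] scaleR_diff_right case_prod_unfold)
    also have "\<dots> \<le> (\<Sum>(x,K)\<in>D. measure lborel K *\<^sub>R g x)"
    proof (rule sum_norm_le, clarify)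
      fix x K assume "(x, K) \<in> D"
      then have "x \<in> cbox a b" using D(1) by blast
      then show "norm (measure lborel K *\<^sub>R (f x - h x)) \<le> measure lborel K *\<^sub>R g x"
        using hg by (simp add: mult_left_mono)
    qed
    also have "\<dots> < e / 3"
      using \<gamma>2[THEN conjunct2, rule_format, OF conjI[OF D]] gsmall
      unfolding real_norm_def by linarith
    finally show ?thesis .
  qed
  have main: "norm (?S f D1 - ?S f D2) < e"
    if D1: "D1 tagged_division_of (cbox a b)" "(\<lambda>x. \<gamma>1 x \<inter> \<gamma>2 x) fine D1"
      and D2: "D2 tagged_division_of (cbox a b)" "(\<lambda>x. \<gamma>1 x \<inter> \<gamma>2 x) fine D2" for D1 D2
  proof -
    have fine: "\<gamma>1 fine D1" "\<gamma>2 fine D1" "\<gamma>1 fine D2" "\<gamma>2 fine D2"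
      using D1 D2 by (auto simp: fine_Int)
    have "norm (?S h D1 - ?S h D2) < e / 3"
      by (rule \<gamma>1[THEN conjunct2, rule_format]) (intro conjI D1(1) D2(1) fine)
    from norm_diff_less_thirds[OF near[OF D1(1) fine(2)] this near[OF D2(1) fine(4)]] show ?thesis .
  qed
  show "\<exists>\<gamma>. gauge \<gamma> \<and> (\<forall>D1 D2. D1 tagged_division_of (cbox a b) \<and> \<gamma> fine D1 \<and>
            D2 tagged_division_of (cbox a b) \<and> \<gamma> fine D2 \<longrightarrow> norm (?S f D1 - ?S f D2) < e)"
  proof (intro exI[of _ "\<lambda>x. \<gamma>1 x \<inter> \<gamma>2 x"] conjI allI impI gauge_Int \<gamma>1[THEN conjunct1] \<gamma>2[THEN conjunct1])
  qed (elim conjE, rule main)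
qed

text \<open>
  On an unbounded domain the integrals over large boxes must also be compared, and these differ from those of \<open>h\<close>
  by at most the integral of \<open>g\<close>.
\<close>

lemma integrable_if_L1_approx:
  fixes f :: "'n::euclidean_space \<Rightarrow> 'b::banach"
  assumes approx: "\<And>e. e > 0 \<Longrightarrow> \<exists>h g. h integrable_on S \<and> g integrable_on S \<and>
      integral S g < e \<and> (\<forall>x\<in>S. norm (f x - h x) \<le> g x)"
  shows "f integrable_on S"
proof -
  let ?r = "\<lambda>f x. if x \<in> S then f x else 0"
  have ap: "\<exists>h g. h integrable_on UNIV \<and> g integrable_on UNIV \<and>
      integral UNIV g < e \<and> (\<forall>x. norm (?r f x - h x) \<le> g x)" if e: "e > 0" for e
  proof -
    obtain h g where "h integrable_on S" "g integrable_on S"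
      "integral S g < e" "\<forall>x\<in>S. norm (f x - h x) \<le> g x" using approx[OF e] by blast
    then show ?thesis
      by (intro exI[of _ "?r h"] exI[of _ "?r g"]) (auto simp: integrable_restrict_UNIV integral_restrict_UNIV)
  qed
  have sub: "k integrable_on cbox a b" if "k integrable_on UNIV" for k :: "'n \<Rightarrow> 'c::banach" and a b
    using integrable_on_subcbox[OF that] by simp
  have gle: "integral (cbox a b) g \<le> integral UNIV g" if "g integrable_on UNIV" "\<And>x. 0 \<le> g x"
    for g :: "'n \<Rightarrow> real" and a b
    by (rule integral_subset_le) (use that sub in auto)
  have cb: "?r f integrable_on cbox a b" for a b
  proof (rule integrable_cbox_if_L1_approx)
    fix e :: real assume e: "e > 0"
    obtain h g where hg: "h integrable_on UNIV" "g integrable_on UNIV"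
      "integral UNIV g < e" "\<And>x. norm (?r f x - h x) \<le> g x" using ap[OF e] by blast
    have "0 \<le> g x" for x using order_trans[OF norm_ge_zero hg(4)] .
    then have "integral (cbox a b) g < e" using gle[OF hg(2), of a b] hg(3) by simp
    then show "\<exists>h g. h integrable_on cbox a b \<and> g integrable_on cbox a b \<and>
      integral (cbox a b) g < e \<and> (\<forall>x\<in>cbox a b. norm (?r f x - h x) \<le> g x)"
      using hg(4) sub[OF hg(1)] sub[OF hg(2)] by (intro exI[of _ h] exI[of _ g]) auto
  qed
  have big: "\<exists>B>0. \<forall>a b c d. ball 0 B \<subseteq> cbox a b \<and> ball 0 B \<subseteq> cbox c d \<longrightarrow>
    norm (integral (cbox a b) (?r f) - integral (cbox c d) (?r f)) < e" if "e > 0" for e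
  proof -
    have "e / 3 > 0" using that by simp
    from ap[OF this] obtain h g where hg: "h integrable_on UNIV" "g integrable_on UNIV"
      "integral UNIV g < e / 3" "\<And>x. norm (?r f x - h x) \<le> g x" by blast
    have g0: "0 \<le> g x" for x using order_trans[OF norm_ge_zero hg(4)] .
    obtain B where B: "B > 0" "\<And>a b c d. ball 0 B \<subseteq> cbox a b \<Longrightarrow> ball 0 B \<subseteq> cbox c d \<Longrightarrow>
        norm (integral (cbox a b) h - integral (cbox c d) h) < e / 3"
      using hg(1)[unfolded integrable_alt[of h UNIV], THEN conjunct2, rule_format, OF \<open>e / 3 > 0\<close>] by auto
    have near: "norm (integral (cbox a b) (?r f) - integral (cbox a b) h) < e / 3" for a b
    proof -
      have "integral (cbox a b) (?r f) - integral (cbox a b) h = integral (cbox a b) (\<lambda>x. ?r f x - h x)"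
        by (rule integral_diff[symmetric]) (use cb sub hg in auto)
      also have "norm \<dots> \<le> integral (cbox a b) g"
        by (rule integral_norm_bound_integral) (use cb sub hg in \<open>auto intro!: integrable_diff\<close>)
      finally show ?thesis using gle[OF hg(2) g0, of a b] hg(3) by simp
    qed
    have main: "norm (integral (cbox a b) (?r f) - integral (cbox c d) (?r f)) < e"
      if "ball 0 B \<subseteq> cbox a b" "ball 0 B \<subseteq> cbox c d" for a b c d
      by (rule norm_diff_less_thirds[OF near[of a b] B(2)[OF that] near[of c d]])
    show ?thesis
    proof (intro exI[of _ B] conjI allI impI)
      fix a b c d :: 'n assume *: "ball 0 B \<subseteq> cbox a b \<and> ball 0 B \<subseteq> cbox c d"
      show "norm (integral (cbox a b) (?r f) - integral (cbox c d) (?r f)) < e"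
        by (rule main[OF conjunct1[OF *] conjunct2[OF *]])
    qed (rule B(1))
  qed
  show ?thesis
    unfolding integrable_alt[of f S]
  proof (intro conjI allI impI)
    show "?r f integrable_on cbox a b" for a b by (rule cb)
  qed (rule big)
qed

section \<open>Bochner integrable functions\<close>

text \<open>
  \<open>f\<close> is approximated on \<open>S\<close> in mean, up to \<open>e\<close>, by a simple function \<open>h\<close> of bounded support. The error is
  measured by an integrable majorant \<open>g\<close> instead of the norm of \<open>f - h\<close>, so that no measurability of \<open>f\<close> has to be
  known beforehand.
\<close>

definition simple_approx ::
    "real set \<Rightarrow> (real \<Rightarrow> 'a::real_normed_vector) \<Rightarrow> real \<Rightarrow> (real \<Rightarrow> 'a) \<Rightarrow> real \<Rightarrow> (real \<Rightarrow> real) \<Rightarrow> bool" where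
  "simple_approx S f e h r g \<longleftrightarrow>
     simple_function lebesgue h \<and> (\<forall>\<tau>. r < \<bar>\<tau>\<bar> \<longrightarrow> h \<tau> = 0) \<and>
     g integrable_on S \<and> integral S g < e \<and> (\<forall>\<tau>\<in>S. norm (f \<tau> - h \<tau>) \<le> g \<tau>)"

text \<open>
  Bochner integrability on \<open>S\<close> for functions into a possibly non-separable space.
\<close>

definition bochner_on :: "real set \<Rightarrow> (real \<Rightarrow> 'a::real_normed_vector) \<Rightarrow> bool" where
  "bochner_on S f \<longleftrightarrow> (\<forall>e>0. \<exists>h r g. simple_approx S f e h r g)"

lemma simple_approxD:
  assumes "simple_approx S f e h r g"
  shows "simple_function lebesgue h" "\<And>\<tau>. r < \<bar>\<tau>\<bar> \<Longrightarrow> h \<tau> = 0"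
    "g integrable_on S" "integral S g < e" "\<And>\<tau>. \<tau> \<in> S \<Longrightarrow> norm (f \<tau> - h \<tau>) \<le> g \<tau>"
  using assms by (auto simp: simple_approx_def)

lemma simple_function_integrable_UNIV:
  fixes h :: "real \<Rightarrow> 'a::real_normed_vector"
  assumes h: "simple_function lebesgue h" and supp: "\<And>\<tau>. r < \<bar>\<tau>\<bar> \<Longrightarrow> h \<tau> = 0"
  shows "h integrable_on UNIV"
proof -
  have fin: "finite (range h)" using h by (simp add: simple_function_def)
  have eq: "h x = (\<Sum>y\<in>range h - {0}. indicator (h -` {y}) x *\<^sub>R y)" for x
  proof (cases "h x = 0")
    case True
    then show ?thesis by (auto simp: indicator_def intro!: sum.neutral[symmetric])
  next
    case False
    have "(\<Sum>y\<in>range h - {0}. indicator (h -` {y}) x *\<^sub>R y) = (\<Sum>y\<in>{h x}. indicator (h -` {y}) x *\<^sub>R y)"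
      by (rule sum.mono_neutral_right) (use fin False in auto)
    then show ?thesis by simp
  qed
  have "(\<lambda>x. indicator (h -` {y}) x *\<^sub>R y) integrable_on UNIV" if "y \<in> range h - {0}" for y
  proof -
    have "h -` {y} \<in> sets lebesgue" using h that by (auto simp: simple_function_def)
    moreover have "bounded (h -` {y})"
    proof (rule bounded_subset[of "{-r..r}"])
      show "h -` {y} \<subseteq> {-r..r}" using supp that
        by (auto simp: abs_le_iff not_less[symmetric])
    qed simp
    ultimately have "h -` {y} \<in> lmeasurable" by (simp add: bounded_set_imp_lmeasurable)
    then have "indicat_real (h -` {y}) integrable_on UNIV"
      using lmeasurable_iff_has_integral has_integral_integrable by blast
    from integrable_linear[OF this bounded_linear_scaleR_left[of y]] show ?thesis
      by (simp add: o_def)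
  qed
  then have "(\<lambda>x. \<Sum>y\<in>range h - {0}. indicator (h -` {y}) x *\<^sub>R y) integrable_on UNIV"
    using fin by (intro integrable_sum) auto
  then show ?thesis by (rule integrable_eq) (simp only: eq[symmetric])
qed

lemma simple_function_integrable_on:
  fixes h :: "real \<Rightarrow> 'a::banach"
  assumes "simple_function lebesgue h" "\<And>\<tau>. r < \<bar>\<tau>\<bar> \<Longrightarrow> h \<tau> = 0" "S \<in> sets lebesgue"
  shows "h integrable_on S"
proof -
  have "(\<lambda>x. if x \<in> S then h x else 0) integrable_on UNIV"
    by (rule simple_function_integrable_UNIV[of _ r]) (use assms in \<open>auto intro: simple_function_If_set\<close>)
  then show ?thesis by (simp add: integrable_restrict_UNIV)
qed

lemma bochner_onD:
  assumes "bochner_on S f" "e > 0"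
  shows "\<exists>h r g. simple_approx S f e h r g"
  using assms unfolding bochner_on_def by blast

lemma bochner_on_integrable:
  fixes f :: "real \<Rightarrow> 'a::banach"
  assumes "bochner_on S f" "S \<in> sets lebesgue"
  shows "f integrable_on S"
proof (rule integrable_if_L1_approx)
  fix e :: real assume "e > 0"
  obtain h r g where "simple_approx S f e h r g"
    using bochner_onD[OF assms(1) \<open>e > 0\<close>] by blast
  note hg = simple_approxD[OF this]
  have "h integrable_on S"
    by (rule simple_function_integrable_on[of _ r]) (use hg assms in auto)
  then show "\<exists>h g. h integrable_on S \<and> g integrable_on S \<and>
      integral S g < e \<and> (\<forall>x\<in>S. norm (f x - h x) \<le> g x)"
    by (intro exI[of _ h] exI[of _ g] conjI ballI hg)
qed

text \<open>
  The norm of \<open>f\<close> is approximated in mean by the norms of the simple functions approximating \<open>f\<close>.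
\<close>

lemma bochner_on_norm_integrable:
  fixes f :: "real \<Rightarrow> 'a::real_normed_vector"
  assumes "bochner_on S f" "S \<in> sets lebesgue"
  shows "(\<lambda>\<tau>. norm (f \<tau>)) integrable_on S"
proof (rule integrable_if_L1_approx)
  fix e :: real assume "e > 0"
  obtain h r g where "simple_approx S f e h r g"
    using bochner_onD[OF assms(1) \<open>e > 0\<close>] by blast
  note hg = simple_approxD[OF this]
  have "(\<lambda>\<tau>. norm (h \<tau>)) integrable_on S"
    by (rule simple_function_integrable_on[of _ r]) (use hg assms in \<open>auto intro: simple_function_compose1\<close>)
  moreover have "norm (norm (f x) - norm (h x)) \<le> g x" if "x \<in> S" for x
    using hg(5)[OF that] norm_triangle_ineq3[of "f x" "h x"] by simp
  ultimately show "\<exists>h g. h integrable_on S \<and> g integrable_on S \<and>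
      integral S g < e \<and> (\<forall>x\<in>S. norm (norm (f x) - h x) \<le> g x)"
    using hg(3,4) by (intro exI[of _ "\<lambda>\<tau>. norm (h \<tau>)"] exI[of _ g]) auto
qed

lemma bochner_on_if_approx:
  assumes "\<And>e. e > 0 \<Longrightarrow> \<exists>h g. bochner_on S h \<and> g integrable_on S \<and> integral S g < e \<and>
      (\<forall>\<tau>\<in>S. norm (f \<tau> - h \<tau>) \<le> g \<tau>)"
  shows "bochner_on S f"
  unfolding bochner_on_def simple_approx_def
proof (intro allI impI)
  fix e :: real assume "e > 0"
  then have e2: "e / 2 > 0" by simp
  obtain h g where h: "bochner_on S h" and "g integrable_on S \<and> integral S g < e / 2 \<and>
    (\<forall>\<tau>\<in>S. norm (f \<tau> - h \<tau>) \<le> g \<tau>)" using assms[OF e2] by (elim exE conjE) simp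
  then have g: "g integrable_on S" "integral S g < e / 2"
    "\<And>\<tau>. \<tau> \<in> S \<Longrightarrow> norm (f \<tau> - h \<tau>) \<le> g \<tau>" by auto
  obtain k r l where "simple_approx S h (e / 2) k r l"
    using bochner_onD[OF h e2] by blast
  note k = simple_approxD[OF this]
  have "norm (f \<tau> - k \<tau>) \<le> g \<tau> + l \<tau>" if "\<tau> \<in> S" for \<tau>
    using g(3)[OF that] k(5)[OF that] norm_triangle_ineq[of "f \<tau> - h \<tau>" "h \<tau> - k \<tau>"] by simp
  moreover have "integral S (\<lambda>\<tau>. g \<tau> + l \<tau>) < e"
    using g k by (simp add: integral_add)
  ultimately show "\<exists>h r g. simple_function lebesgue h \<and> (\<forall>\<tau>. r < \<bar>\<tau>\<bar> \<longrightarrow> h \<tau> = 0) \<and>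
     g integrable_on S \<and> integral S g < e \<and> (\<forall>\<tau>\<in>S. norm (f \<tau> - h \<tau>) \<le> g \<tau>)"
    using k(1,2) integrable_add[OF g(1) k(3)]
    by (intro exI[of _ k] exI[of _ r] exI[of _ "\<lambda>\<tau>. g \<tau> + l \<tau>"]) auto
qed

lemma bochner_on_simple:
  assumes "simple_function lebesgue h" "\<And>\<tau>. r < \<bar>\<tau>\<bar> \<Longrightarrow> h \<tau> = 0"
  shows "bochner_on S h"
  unfolding bochner_on_def simple_approx_def using assms
  by (intro allI impI exI[of _ h] exI[of _ r] exI[of _ "\<lambda>_. 0"]) (auto simp: integrable_0)

lemma bochner_on_add:
  assumes "bochner_on S f" "bochner_on S f'"
  shows "bochner_on S (\<lambda>\<tau>. f \<tau> + f' \<tau>)"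
  unfolding bochner_on_def simple_approx_def
proof (intro allI impI)
  fix e :: real assume "e > 0"
  then have e2: "e / 2 > 0" by simp
  obtain h r g where "simple_approx S f (e / 2) h r g"
    using bochner_onD[OF assms(1) e2] by blast
  note h = simple_approxD[OF this]
  obtain h' r' g' where "simple_approx S f' (e / 2) h' r' g'"
    using bochner_onD[OF assms(2) e2] by blast
  note h' = simple_approxD[OF this]
  have "norm (f \<tau> + f' \<tau> - (h \<tau> + h' \<tau>)) \<le> g \<tau> + g' \<tau>" if "\<tau> \<in> S" for \<tau>
    using h(5)[OF that] h'(5)[OF that] norm_triangle_ineq[of "f \<tau> - h \<tau>" "f' \<tau> - h' \<tau>"]
    by (simp add: algebra_simps)
  moreover have "integral S (\<lambda>\<tau>. g \<tau> + g' \<tau>) < e"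
    using h h' by (simp add: integral_add)
  ultimately show "\<exists>h r g. simple_function lebesgue h \<and> (\<forall>\<tau>. r < \<bar>\<tau>\<bar> \<longrightarrow> h \<tau> = 0) \<and>
     g integrable_on S \<and> integral S g < e \<and> (\<forall>\<tau>\<in>S. norm (f \<tau> + f' \<tau> - h \<tau>) \<le> g \<tau>)"
    using h(1,2) h'(1,2) integrable_add[OF h(3) h'(3)]
    by (intro exI[of _ "\<lambda>\<tau>. h \<tau> + h' \<tau>"] exI[of _ "max r r'"] exI[of _ "\<lambda>\<tau>. g \<tau> + g' \<tau>"]) auto
qed

lemma bochner_on_uminus:
  assumes "bochner_on S f"
  shows "bochner_on S (\<lambda>\<tau>. - f \<tau>)"
  unfolding bochner_on_def simple_approx_def
proof (intro allI impI)
  fix e :: real assume "e > 0"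
  obtain h r g where "simple_approx S f e h r g"
    using bochner_onD[OF assms \<open>e > 0\<close>] by blast
  note h = simple_approxD[OF this]
  have "norm (- f \<tau> - - h \<tau>) \<le> g \<tau>" if "\<tau> \<in> S" for \<tau>
    using h(5)[OF that] by (simp add: norm_minus_commute)
  then show "\<exists>h r g. simple_function lebesgue h \<and> (\<forall>\<tau>. r < \<bar>\<tau>\<bar> \<longrightarrow> h \<tau> = 0) \<and>
     g integrable_on S \<and> integral S g < e \<and> (\<forall>\<tau>\<in>S. norm (- f \<tau> - h \<tau>) \<le> g \<tau>)"
    using h by (intro exI[of _ "\<lambda>\<tau>. - h \<tau>"] exI[of _ r] exI[of _ g])
      (auto intro: simple_function_compose1)
qed

lemma bochner_on_diff:
  assumes "bochner_on S f" "bochner_on S f'"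
  shows "bochner_on S (\<lambda>\<tau>. f \<tau> - f' \<tau>)"
  using bochner_on_add[OF assms(1) bochner_on_uminus[OF assms(2)]] by simp

lemma bochner_on_sum:
  assumes "finite I" "\<And>i. i \<in> I \<Longrightarrow> bochner_on S (f i)"
  shows "bochner_on S (\<lambda>\<tau>. \<Sum>i\<in>I. f i \<tau>)"
  using assms
proof (induction I rule: finite_induct)
  case empty
  then show ?case by (simp add: bochner_on_simple[of _ 0])
next
  case (insert i I)
  then show ?case by (simp add: bochner_on_add)
qed

lemma bochner_on_restrict:
  assumes f: "bochner_on S f" and E: "E \<in> sets lebesgue"
  shows "bochner_on S (\<lambda>\<tau>. if \<tau> \<in> E then f \<tau> else 0)"
  unfolding bochner_on_def simple_approx_def
proof (intro allI impI)
  fix e :: real assume "e > 0"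
  obtain h r g where "simple_approx S f e h r g"
    using bochner_onD[OF f \<open>e > 0\<close>] by blast
  note h = simple_approxD[OF this]
  have "norm ((if \<tau> \<in> E then f \<tau> else 0) - (if \<tau> \<in> E then h \<tau> else 0)) \<le> g \<tau>" if "\<tau> \<in> S" for \<tau>
    using h(5)[OF that] norm_ge_zero[of "f \<tau> - h \<tau>"] by (auto simp del: norm_ge_zero)
  then show "\<exists>h r g. simple_function lebesgue h \<and> (\<forall>\<tau>. r < \<bar>\<tau>\<bar> \<longrightarrow> h \<tau> = 0) \<and>
     g integrable_on S \<and> integral S g < e \<and>
     (\<forall>\<tau>\<in>S. norm ((if \<tau> \<in> E then f \<tau> else 0) - h \<tau>) \<le> g \<tau>)"
    using h E by (intro exI[of _ "\<lambda>\<tau>. if \<tau> \<in> E then h \<tau> else 0"] exI[of _ r] exI[of _ g])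
      (auto intro: simple_function_If_set)
qed

lemma bochner_on_If:
  assumes f: "bochner_on S f" and f': "bochner_on S f'" and E: "E \<in> sets lebesgue"
  shows "bochner_on S (\<lambda>\<tau>. if \<tau> \<in> E then f \<tau> else f' \<tau>)"
proof -
  have "bochner_on S (\<lambda>\<tau>. (if \<tau> \<in> E then f \<tau> else 0) + (if \<tau> \<in> - E then f' \<tau> else 0))"
    by (intro bochner_on_add bochner_on_restrict assms)
      (use sets.compl_sets[OF E] in \<open>simp add: Compl_eq_Diff_UNIV\<close>)
  moreover have "(\<lambda>\<tau>. (if \<tau> \<in> E then f \<tau> else 0) + (if \<tau> \<in> - E then f' \<tau> else 0)) =
      (\<lambda>\<tau>. if \<tau> \<in> E then f \<tau> else f' \<tau>)" by auto
  ultimately show ?thesis by simp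
qed

lemma bochner_on_cong:
  assumes "bochner_on S f" "\<And>\<tau>. \<tau> \<in> S \<Longrightarrow> f \<tau> = f' \<tau>"
  shows "bochner_on S f'"
  using assms(1) unfolding bochner_on_def simple_approx_def by (simp add: assms(2) cong: ball_cong)

lemma bochner_on_spike:
  assumes f: "bochner_on S f" and N: "negligible N" and eq: "\<And>\<tau>. \<tau> \<in> S - N \<Longrightarrow> f \<tau> = f' \<tau>"
  shows "bochner_on S f'"
  unfolding bochner_on_def simple_approx_def
proof (intro allI impI)
  fix e :: real assume "e > 0"
  obtain h r g where "simple_approx S f e h r g"
    using bochner_onD[OF f \<open>e > 0\<close>] by blast
  note h = simple_approxD[OF this]
  let ?g = "\<lambda>\<tau>. if \<tau> \<in> N then norm (f' \<tau> - h \<tau>) else g \<tau>"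
  have "?g integrable_on S" by (rule integrable_spike[OF h(3) N]) auto
  moreover have "integral S ?g = integral S g" by (rule integral_spike[OF N]) auto
  moreover have "norm (f' \<tau> - h \<tau>) \<le> ?g \<tau>" if "\<tau> \<in> S" for \<tau>
    using h(5)[OF that] eq that by auto
  ultimately show "\<exists>h r g. simple_function lebesgue h \<and> (\<forall>\<tau>. r < \<bar>\<tau>\<bar> \<longrightarrow> h \<tau> = 0) \<and>
     g integrable_on S \<and> integral S g < e \<and> (\<forall>\<tau>\<in>S. norm (f' \<tau> - h \<tau>) \<le> g \<tau>)"
    using h by (intro exI[of _ h] exI[of _ r] exI[of _ ?g]) auto
qed

text \<open>
  Dominated convergence is only needed for real functions: the norms \<open>norm (f n - f m)\<close> are integrable, and letting
  first \<open>m\<close> and then \<open>n\<close> tend to infinity shows that \<open>norm (f n - F)\<close> is integrable with integrals tending to zero.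
  In particular \<open>F\<close> is again approximable in mean.
\<close>

proposition bochner_dominated_convergence:
  fixes f :: "nat \<Rightarrow> real \<Rightarrow> 'a::banach"
  assumes f: "\<And>n. bochner_on S (f n)" and S: "S \<in> sets lebesgue" and N: "negligible N"
    and lim: "\<And>\<tau>. \<tau> \<in> S - N \<Longrightarrow> (\<lambda>n. f n \<tau>) \<longlonglongrightarrow> F \<tau>"
    and g: "g integrable_on S" and bound: "\<And>n \<tau>. \<tau> \<in> S \<Longrightarrow> norm (f n \<tau>) \<le> g \<tau>"
  shows "bochner_on S F" "(\<lambda>n. integral S (f n)) \<longlonglongrightarrow> integral S F"
proof -
  let ?f = "\<lambda>n \<tau>. if \<tau> \<in> N then 0 else f n \<tau>"
  let ?F = "\<lambda>\<tau>. if \<tau> \<in> N then 0 else F \<tau>"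
  have g0: "0 \<le> g \<tau>" if "\<tau> \<in> S" for \<tau> using order_trans[OF norm_ge_zero bound[OF that]] .
  have fb: "bochner_on S (?f n)" for n by (rule bochner_on_spike[OF f N]) auto
  have flim: "(\<lambda>n. ?f n \<tau>) \<longlonglongrightarrow> ?F \<tau>" if "\<tau> \<in> S" for \<tau> using lim that by auto
  have fbd: "norm (?f n \<tau>) \<le> g \<tau>" if "\<tau> \<in> S" for n \<tau> using bound g0 that by auto
  have Fbd: "norm (?F \<tau>) \<le> g \<tau>" if "\<tau> \<in> S" for \<tau>
    by (rule LIMSEQ_le_const2[OF tendsto_norm[OF flim[OF that]]]) (use fbd that in auto)
  have g2: "(\<lambda>\<tau>. 2 * g \<tau>) integrable_on S" using g by simp
  have "(\<lambda>\<tau>. norm (?f n \<tau> - ?F \<tau>)) integrable_on S" for n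
  proof (rule dominated_convergence(1)[OF _ g2])
    show "(\<lambda>\<tau>. norm (?f n \<tau> - ?f m \<tau>)) integrable_on S" for m
      by (rule bochner_on_norm_integrable[OF bochner_on_diff[OF fb fb] S])
    show "norm (norm (?f n \<tau> - ?f m \<tau>)) \<le> 2 * g \<tau>" if "\<tau> \<in> S" for m \<tau>
      using fbd[OF that, of n] fbd[OF that, of m] norm_triangle_ineq4[of "?f n \<tau>" "?f m \<tau>"] by simp
    show "(\<lambda>m. norm (?f n \<tau> - ?f m \<tau>)) \<longlonglongrightarrow> norm (?f n \<tau> - ?F \<tau>)" if "\<tau> \<in> S" for \<tau>
      by (intro tendsto_intros flim that)
  qed
  then have di: "(\<lambda>\<tau>. norm (?f n \<tau> - ?F \<tau>)) integrable_on S" for n .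
  have dlim: "(\<lambda>n. integral S (\<lambda>\<tau>. norm (?f n \<tau> - ?F \<tau>))) \<longlonglongrightarrow> integral S (\<lambda>\<tau>. 0::real)"
  proof (rule dominated_convergence(2)[OF di g2])
    show "norm (norm (?f n \<tau> - ?F \<tau>)) \<le> 2 * g \<tau>" if "\<tau> \<in> S" for n \<tau>
      using fbd[OF that, of n] Fbd[OF that] norm_triangle_ineq4[of "?f n \<tau>" "?F \<tau>"] by simp
    show "(\<lambda>n. norm (?f n \<tau> - ?F \<tau>)) \<longlonglongrightarrow> 0" if "\<tau> \<in> S" for \<tau>
      using tendsto_norm[OF tendsto_diff[OF flim[OF that] tendsto_const[of "?F \<tau>"]]] by simp
  qed
  then have dlim: "(\<lambda>n. integral S (\<lambda>\<tau>. norm (?f n \<tau> - ?F \<tau>))) \<longlonglongrightarrow> 0" by simp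
  have Fb: "bochner_on S ?F"
  proof (rule bochner_on_if_approx)
    fix e :: real assume "e > 0"
    then obtain n where "integral S (\<lambda>\<tau>. norm (?f n \<tau> - ?F \<tau>)) < e"
      using order_tendstoD(2)[OF dlim] by (auto simp: eventually_sequentially)
    then show "\<exists>h g. bochner_on S h \<and> g integrable_on S \<and> integral S g < e \<and> (\<forall>\<tau>\<in>S. norm (?F \<tau> - h \<tau>) \<le> g \<tau>)"
      using di fb by (intro exI[of _ "?f n"] exI[of _ "\<lambda>\<tau>. norm (?f n \<tau> - ?F \<tau>)"]) (auto simp: norm_minus_commute)
  qed
  show "bochner_on S F" by (rule bochner_on_spike[OF Fb N]) auto
  have fi: "integral S (f n) = integral S (?f n)" for n by (rule integral_spike[OF N]) auto
  have Fi: "integral S F = integral S ?F" by (rule integral_spike[OF N]) auto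
  have "norm (integral S (?f n) - integral S ?F) \<le> integral S (\<lambda>\<tau>. norm (?f n \<tau> - ?F \<tau>))" for n
  proof -
    note i = bochner_on_integrable[OF fb S, of n] bochner_on_integrable[OF Fb S]
    have "norm (integral S (\<lambda>\<tau>. ?f n \<tau> - ?F \<tau>)) \<le> integral S (\<lambda>\<tau>. norm (?f n \<tau> - ?F \<tau>))"
      by (rule integral_norm_bound_integral[OF integrable_diff[OF i] di]) simp
    then show ?thesis using integral_diff[OF i] by simp
  qed
  then have "(\<lambda>n. integral S (?f n) - integral S ?F) \<longlonglongrightarrow> 0"
    by (intro Lim_null_comparison[OF _ dlim] always_eventually) auto
  then show "(\<lambda>n. integral S (f n)) \<longlonglongrightarrow> integral S F"
    unfolding fi Fi by (simp add: LIM_zero_iff)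
qed

lemma bochner_on_empty: "bochner_on {} f"
  unfolding bochner_on_def simple_approx_def
  by (intro allI impI exI[of _ "\<lambda>_. 0"] exI[of _ 0]) auto

lemma bochner_on_extend:
  assumes f: "bochner_on T f" and T: "T \<in> sets lebesgue" "T \<subseteq> S"
  shows "bochner_on S (\<lambda>\<tau>. if \<tau> \<in> T then f \<tau> else 0)"
  unfolding bochner_on_def simple_approx_def
proof (intro allI impI)
  fix e :: real assume "e > 0"
  obtain h r g where "simple_approx T f e h r g"
    using bochner_onD[OF f \<open>e > 0\<close>] by blast
  note h = simple_approxD[OF this]
  have i: "(\<lambda>\<tau>. if \<tau> \<in> T then g \<tau> else 0) integrable_on S"
    using h(3) integrable_restrict_Int[of T g S] T(2) by (simp add: Int_absorb2)
  have "integral S (\<lambda>\<tau>. if \<tau> \<in> T then g \<tau> else 0) = integral (T \<inter> S) g"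
    by (rule integral_restrict_Int)
  then have "integral S (\<lambda>\<tau>. if \<tau> \<in> T then g \<tau> else 0) = integral T g"
    using T(2) by (simp add: Int_absorb2)
  then show "\<exists>h r g. simple_function lebesgue h \<and> (\<forall>\<tau>. r < \<bar>\<tau>\<bar> \<longrightarrow> h \<tau> = 0) \<and>
     g integrable_on S \<and> integral S g < e \<and>
     (\<forall>\<tau>\<in>S. norm ((if \<tau> \<in> T then f \<tau> else 0) - h \<tau>) \<le> g \<tau>)"
    using h T i
    by (intro exI[of _ "\<lambda>\<tau>. if \<tau> \<in> T then h \<tau> else 0"] exI[of _ r]
        exI[of _ "\<lambda>\<tau>. if \<tau> \<in> T then g \<tau> else 0"]) (auto intro: simple_function_If_set)
qed

text \<open>
  The simple functions converging to \<open>f\<close> are cut off where they exceed twice the majorant; this makes them dominated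
  and does not disturb the convergence.
\<close>

lemma bochner_on_strongly_measurable:
  fixes f :: "real \<Rightarrow> 'a::banach"
  assumes f: "strongly_measurable f" and g: "g integrable_on {a..b}" "g \<in> borel_measurable lebesgue"
    and bound: "\<And>\<tau>. norm (f \<tau>) \<le> g \<tau>"
  shows "bochner_on {a..b} f"
proof -
  obtain s N where s: "\<And>n. simple_function lebesgue (s n)"
    and N: "N \<in> null_sets lebesgue" "{t. \<not> (\<lambda>n. s n t) \<longlonglongrightarrow> f t} \<subseteq> N"
    using f unfolding strongly_measurable_def eventually_ae_filter by auto
  let ?s = "\<lambda>n \<tau>. if \<tau> \<in> {a..b} \<and> norm (s n \<tau>) \<le> 2 * g \<tau> then s n \<tau> else 0"
  have g0: "0 \<le> g \<tau>" for \<tau> using order_trans[OF norm_ge_zero bound] .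
  have "simple_function lebesgue (?s n)" for n
  proof (rule simple_function_If[OF s])
    have "(\<lambda>\<tau>. norm (s n \<tau>)) \<in> borel_measurable lebesgue"
      by (rule borel_measurable_simple_function) (rule simple_function_compose1[OF s])
    then have "{\<tau> \<in> space lebesgue. norm (s n \<tau>) \<le> 2 * g \<tau>} \<in> sets lebesgue"
      using g(2) by measurable
    moreover have "{a..b} \<in> sets lebesgue" by simp
    ultimately have "{a..b} \<inter> {\<tau> \<in> space lebesgue. norm (s n \<tau>) \<le> 2 * g \<tau>} \<in> sets lebesgue"
      by (rule sets.Int[rotated])
    also have "{a..b} \<inter> {\<tau> \<in> space lebesgue. norm (s n \<tau>) \<le> 2 * g \<tau>} =
       {\<tau> \<in> space lebesgue. \<tau> \<in> {a..b} \<and> norm (s n \<tau>) \<le> 2 * g \<tau>}" by auto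
    finally show "{\<tau> \<in> space lebesgue. \<tau> \<in> {a..b} \<and> norm (s n \<tau>) \<le> 2 * g \<tau>} \<in> sets lebesgue" .
  qed simp
  then have b: "bochner_on {a..b} (?s n)" for n
    by (rule bochner_on_simple[where r="max \<bar>a\<bar> \<bar>b\<bar>"]) auto
  show ?thesis
  proof (rule bochner_dominated_convergence(1)[OF b])
    show "negligible N" using N(1) by (simp add: negligible_iff_null_sets)
    show "(\<lambda>\<tau>. 2 * g \<tau>) integrable_on {a..b}" using g(1) by simp
    show "norm (?s n \<tau>) \<le> 2 * g \<tau>" for n \<tau> using g0[of \<tau>] by auto
    show "(\<lambda>n. ?s n \<tau>) \<longlonglongrightarrow> f \<tau>" if "\<tau> \<in> {a..b} - N" for \<tau>
    \<comment> \<open>Where \<open>g\<close> vanishes, the strict inequality used for the cut-off below is not available, but both sides are zero.\<close>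
    proof (cases "g \<tau> = 0")
      case True
      then have "f \<tau> = 0" using bound[of \<tau>] by simp
      then show ?thesis using True by (auto intro!: tendsto_eventually always_eventually)
    next
      case False
      have lim: "(\<lambda>n. s n \<tau>) \<longlonglongrightarrow> f \<tau>" using N(2) that by auto
      have "norm (f \<tau>) < 2 * g \<tau>" using False g0[of \<tau>] bound[of \<tau>] by linarith
      then have "\<forall>\<^sub>F n in sequentially. norm (s n \<tau>) < 2 * g \<tau>"
        by (rule order_tendstoD(2)[OF tendsto_norm[OF lim]])
      then have "\<forall>\<^sub>F n in sequentially. s n \<tau> = ?s n \<tau>"
        by eventually_elim (use that in auto)
      with lim show ?thesis by (rule Lim_transform_eventually)
    qed
  qed simp
qed

text \<open>
  Rounding the time down to a grid turns a continuous function into a uniformly close simple one.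
  The statement provides the rounding \<open>d\<close> itself and not just \<open>u \<circ> d\<close>, since an operator-valued function can
  then be applied to \<open>u (d \<tau>)\<close>, which takes finitely many values.
\<close>

lemma continuous_on_simple_time_change:
  fixes u :: "real \<Rightarrow> 'a::real_normed_vector"
  assumes u: "continuous_on {a..b} u" and "a \<le> b" "e > 0"
  obtains d :: "real \<Rightarrow> real" where "simple_function lebesgue d" "\<And>\<tau>. d \<tau> \<in> {a..b}"
    "\<And>\<tau>. \<tau> \<in> {a..b} \<Longrightarrow> norm (u \<tau> - u (d \<tau>)) \<le> e"
proof -
  have "uniformly_continuous_on {a..b} u" using u compact_uniformly_continuous by blast
  then obtain \<delta> where \<delta>: "\<delta> > 0" "\<And>x y. x \<in> {a..b} \<Longrightarrow> y \<in> {a..b} \<Longrightarrow> dist x y < \<delta> \<Longrightarrow> dist (u x) (u y) < e"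
    using \<open>e > 0\<close> unfolding uniformly_continuous_on_def by metis
  define c where "c = \<delta> / 2"
  have c: "0 < c" "c < \<delta>" using \<delta>(1) by (auto simp: c_def)
  define d where "d = (\<lambda>\<tau>. if \<tau> \<in> {a..b} then max a (c * of_int \<lfloor>\<tau> / c\<rfloor>) else a)"
  have fl: "c * of_int \<lfloor>\<tau> / c\<rfloor> \<le> \<tau>" "\<tau> < c * of_int \<lfloor>\<tau> / c\<rfloor> + c" for \<tau>
    using floor_divide_lower[OF c(1), of \<tau>] floor_divide_upper[OF c(1), of \<tau>]
    by (simp_all add: algebra_simps)
  have d_in: "d \<tau> \<in> {a..b}" for \<tau>
    using fl(1)[of \<tau>] \<open>a \<le> b\<close> by (auto simp: d_def max_def)
  have "range d \<subseteq> insert a ((\<lambda>k. max a (c * of_int k)) ` {\<lfloor>a / c\<rfloor>..\<lfloor>b / c\<rfloor>})"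
    using c(1) by (auto simp: d_def intro!: imageI floor_mono divide_right_mono)
  then have "finite (range d)" by (rule finite_subset) simp
  moreover have "d \<in> borel_measurable lebesgue"
  proof -
    have "d \<in> borel_measurable borel" unfolding d_def by measurable
    then show ?thesis by (simp add: measurable_completion)
  qed
  ultimately have "simple_function lebesgue d"
    by (simp add: simple_function_borel_measurable)
  moreover have "norm (u \<tau> - u (d \<tau>)) \<le> e" if "\<tau> \<in> {a..b}" for \<tau>
  proof -
    have "dist \<tau> (d \<tau>) < \<delta>" using fl[of \<tau>] that c by (auto simp: d_def dist_real_def max_def)
    from \<delta>(2)[OF that d_in this] show ?thesis by (simp add: dist_norm)
  qed
  ultimately show thesis using d_in that by blast
qed

lemma bochner_on_continuous:
  fixes u :: "real \<Rightarrow> 'a::banach"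
  assumes u: "continuous_on {a..b} u"
  shows "bochner_on {a..b} u"
proof (cases "a \<le> b")
  case False
  then show ?thesis by (simp add: bochner_on_empty)
next
  case True
  show ?thesis
  proof (rule bochner_on_if_approx)
    fix e :: real assume "e > 0"
    define c where "c = e / (b - a + 1)"
    have c: "c > 0" "c * (b - a) < e" using \<open>e > 0\<close> True by (auto simp: c_def field_simps)
    obtain d where d: "simple_function lebesgue d" "\<And>\<tau>. d \<tau> \<in> {a..b}"
      "\<And>\<tau>. \<tau> \<in> {a..b} \<Longrightarrow> norm (u \<tau> - u (d \<tau>)) \<le> c"
      using continuous_on_simple_time_change[OF u True c(1)] by metis
    let ?h = "\<lambda>\<tau>. if \<tau> \<in> {a..b} then u (d \<tau>) else 0"
    have "bochner_on {a..b} ?h"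
      by (rule bochner_on_simple[where r="max \<bar>a\<bar> \<bar>b\<bar>"])
        (rule simple_function_If_set[OF simple_function_compose1[OF d(1)] simple_function_const], auto)
    moreover have "integral {a..b} (\<lambda>_. c) < e" using c(2) True by (simp add: mult.commute)
    ultimately show "\<exists>h g. bochner_on {a..b} h \<and> g integrable_on {a..b} \<and> integral {a..b} g < e \<and>
        (\<forall>\<tau>\<in>{a..b}. norm (u \<tau> - h \<tau>) \<le> g \<tau>)"
      using d(3) by (intro exI[of _ ?h] exI[of _ "\<lambda>_. c"]) auto
  qed
qed

text \<open>
  Applied to one vector \<open>k\<close> gives a continuous function, so \<open>k \<tau> (h \<tau>)\<close> is, for simple \<open>h\<close>, a finite sum of continuous
  functions restricted to measurable sets.
\<close>

lemma bochner_on_apply_strongly_continuous: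
  fixes k :: "real \<Rightarrow> 'a::banach \<Rightarrow>\<^sub>L 'b::banach"
  assumes k: "\<And>w. continuous_on {a..b} (\<lambda>\<tau>. k \<tau> w)" "\<And>\<tau>. \<tau> \<in> {a..b} \<Longrightarrow> norm (k \<tau>) \<le> C"
    and f: "bochner_on {a..b} f"
  shows "bochner_on {a..b} (\<lambda>\<tau>. k \<tau> (f \<tau>))"
proof (rule bochner_on_if_approx)
  fix e :: real assume "e > 0"
  define c where "c = e / (\<bar>C\<bar> + 1)"
  have c: "c > 0" "\<bar>C\<bar> * c < e" using \<open>e > 0\<close> by (auto simp: c_def field_simps)
  obtain h r g where "simple_approx {a..b} f c h r g"
    using bochner_onD[OF f c(1)] by blast
  note h = simple_approxD[OF this]
  have fin: "finite (range h)" using h(1) by (simp add: simple_function_def)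
  have "bochner_on {a..b} (\<lambda>\<tau>. \<Sum>y\<in>range h. if \<tau> \<in> h -` {y} then k \<tau> y else 0)"
  proof (intro bochner_on_sum fin bochner_on_restrict bochner_on_continuous k)
    show "h -` {y} \<in> sets lebesgue" if "y \<in> range h" for y
      using h(1) that by (auto simp: simple_function_def)
  qed
  moreover have "(\<Sum>y\<in>range h. if \<tau> \<in> h -` {y} then k \<tau> y else 0) = k \<tau> (h \<tau>)" for \<tau>
    using fin by (simp add: sum.delta' eq_commute[of "h \<tau>"])
  ultimately have hb: "bochner_on {a..b} (\<lambda>\<tau>. k \<tau> (h \<tau>))" by simp
  have "norm (k \<tau> (f \<tau>) - k \<tau> (h \<tau>)) \<le> \<bar>C\<bar> * g \<tau>" if "\<tau> \<in> {a..b}" for \<tau>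
  proof -
    have "norm (k \<tau> (f \<tau> - h \<tau>)) \<le> norm (k \<tau>) * norm (f \<tau> - h \<tau>)" by (rule norm_blinfun)
    also have "\<dots> \<le> \<bar>C\<bar> * g \<tau>"
      by (rule mult_mono) (use k(2)[OF that] h(5)[OF that] in auto)
    finally show ?thesis by (simp add: blinfun.diff_right)
  qed
  moreover have "integral {a..b} (\<lambda>\<tau>. \<bar>C\<bar> * g \<tau>) < e"
  proof -
    have "\<bar>C\<bar> * integral {a..b} g \<le> \<bar>C\<bar> * c" using h(4) by (intro mult_left_mono) auto
    then show ?thesis using c(2) by simp
  qed
  ultimately show "\<exists>h g. bochner_on {a..b} h \<and> g integrable_on {a..b} \<and> integral {a..b} g < e \<and>
      (\<forall>\<tau>\<in>{a..b}. norm (k \<tau> (f \<tau>) - h \<tau>) \<le> g \<tau>)"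
    using hb integrable_cmul[OF h(3), of "\<bar>C\<bar>"]
    by (intro exI[of _ "\<lambda>\<tau>. k \<tau> (h \<tau>)"] exI[of _ "\<lambda>\<tau>. \<bar>C\<bar> * g \<tau>"]) auto
qed

lemma bochner_on_apply_to_continuous:
  fixes B :: "real \<Rightarrow> 'a::banach \<Rightarrow>\<^sub>L 'b::banach"
  assumes B: "\<And>x. bochner_on {a..b} (\<lambda>\<tau>. B \<tau> x)" "(\<lambda>\<tau>. norm (B \<tau>)) integrable_on {a..b}"
    and u: "continuous_on {a..b} u"
  shows "bochner_on {a..b} (\<lambda>\<tau>. B \<tau> (u \<tau>))"
proof (cases "a \<le> b")
  case False
  then show ?thesis by (simp add: bochner_on_empty)
next
  case True
  let ?I = "integral {a..b} (\<lambda>\<tau>. norm (B \<tau>))"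
  have I0: "?I \<ge> 0" by (rule integral_nonneg[OF B(2)]) simp
  show ?thesis
  proof (rule bochner_on_if_approx)
    fix e :: real assume "e > 0"
    define c where "c = e / (?I + 1)"
    have c: "c > 0" "?I * c < e" using \<open>e > 0\<close> I0 by (auto simp: c_def field_simps)
    obtain d where d: "simple_function lebesgue d" "\<And>\<tau>. d \<tau> \<in> {a..b}"
      "\<And>\<tau>. \<tau> \<in> {a..b} \<Longrightarrow> norm (u \<tau> - u (d \<tau>)) \<le> c"
      using continuous_on_simple_time_change[OF u True c(1)] by metis
    have fin: "finite (range d)" using d(1) by (simp add: simple_function_def)
    have "bochner_on {a..b} (\<lambda>\<tau>. \<Sum>y\<in>range d. if \<tau> \<in> d -` {y} then B \<tau> (u y) else 0)"
    proof (intro bochner_on_sum fin bochner_on_restrict B)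
      show "d -` {y} \<in> sets lebesgue" if "y \<in> range d" for y
        using d(1) that by (auto simp: simple_function_def)
    qed
    moreover have "(\<Sum>y\<in>range d. if \<tau> \<in> d -` {y} then B \<tau> (u y) else 0) = B \<tau> (u (d \<tau>))" for \<tau>
      using fin by (simp add: sum.delta' eq_commute[of "d \<tau>"])
    ultimately have hb: "bochner_on {a..b} (\<lambda>\<tau>. B \<tau> (u (d \<tau>)))" by simp
    have "norm (B \<tau> (u \<tau>) - B \<tau> (u (d \<tau>))) \<le> norm (B \<tau>) * c" if "\<tau> \<in> {a..b}" for \<tau>
      using order_trans[OF norm_blinfun[of "B \<tau>" "u \<tau> - u (d \<tau>)"] mult_left_mono[OF d(3)[OF that] norm_ge_zero]]
      by (simp add: blinfun.diff_right)
    then show "\<exists>h g. bochner_on {a..b} h \<and> g integrable_on {a..b} \<and> integral {a..b} g < e \<and>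
        (\<forall>\<tau>\<in>{a..b}. norm (B \<tau> (u \<tau>) - h \<tau>) \<le> g \<tau>)"
      using hb c(2) integrable_on_cmult_right[OF B(2), of c]
      by (intro exI[of _ "\<lambda>\<tau>. B \<tau> (u (d \<tau>))"] exI[of _ "\<lambda>\<tau>. norm (B \<tau>) * c"]) auto
  qed
qed

lemma bochner_on_halfline:
  fixes f :: "real \<Rightarrow> 'a::banach"
  assumes f: "\<And>n::nat. bochner_on {0..real n} f"
    and m: "m integrable_on {0..}" and bound: "\<And>\<tau>. 0 \<le> \<tau> \<Longrightarrow> norm (f \<tau>) \<le> m \<tau>"
  shows "bochner_on {0..} f"
proof (rule bochner_dominated_convergence(1)[OF _ _ negligible_empty _ m])
  let ?f = "\<lambda>n \<tau>. if \<tau> \<in> {0..real n} then f \<tau> else 0"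
  show "bochner_on {0..} (?f n)" for n by (rule bochner_on_extend[OF f]) auto
  have m0: "0 \<le> m \<tau>" if "0 \<le> \<tau>" for \<tau> using order_trans[OF norm_ge_zero bound[OF that]] .
  show "norm (?f n \<tau>) \<le> m \<tau>" if "\<tau> \<in> {0..}" for n \<tau>
    using bound[of \<tau>] m0[of \<tau>] that by auto
  show "(\<lambda>n. ?f n \<tau>) \<longlonglongrightarrow> f \<tau>" if "\<tau> \<in> {0..} - {}" for \<tau>
  proof (rule tendsto_eventually)
    obtain n0 :: nat where "\<tau> \<le> real n0" using real_arch_simple by blast
    then have "?f n \<tau> = f \<tau>" if "n \<ge> n0" for n
      using that \<open>\<tau> \<in> {0..} - {}\<close> by auto
    then show "\<forall>\<^sub>F n in sequentially. ?f n \<tau> = f \<tau>"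
      using eventually_sequentially by blast
  qed
qed simp

section \<open>Linear integral equations in weighted supremum norms\<close>

text \<open>
  The equation \<open>u(t) = f(t) + (integral over J of \<Phi>(t,\<tau>) u(\<tau>))\<close> in the space of functions bounded by a multiple of
  \<open>\<omega>\<close>: the assumptions on \<open>m\<close> say that the integral operator has norm at most \<open>q < 1\<close> there.
\<close>

locale fredholm =
  fixes J :: "real set" and \<Phi> :: "real \<Rightarrow> real \<Rightarrow> 'a::banach \<Rightarrow>\<^sub>L 'a"
    and \<omega> :: "real \<Rightarrow> real" and m :: "real \<Rightarrow> real \<Rightarrow> real" and q :: real
  assumes J: "J \<in> sets lebesgue"
    and q: "0 \<le> q" "q < 1"
    and weight_nonneg: "\<And>t. t \<in> J \<Longrightarrow> 0 \<le> \<omega> t"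
    and majorant: "\<And>t \<tau>. t \<in> J \<Longrightarrow> \<tau> \<in> J \<Longrightarrow> norm (\<Phi> t \<tau>) * \<omega> \<tau> \<le> m t \<tau>"
    and majorant_integrable: "\<And>t. t \<in> J \<Longrightarrow> m t integrable_on J"
    and majorant_le: "\<And>t. t \<in> J \<Longrightarrow> integral J (m t) \<le> q * \<omega> t"
begin

lemma integrand_bound:
  assumes "\<And>t. t \<in> J \<Longrightarrow> norm (u t) \<le> C * \<omega> t" "t \<in> J" "\<tau> \<in> J" "0 \<le> C"
  shows "norm (\<Phi> t \<tau> (u \<tau>)) \<le> C * m t \<tau>"
proof -
  have "norm (\<Phi> t \<tau> (u \<tau>)) \<le> norm (\<Phi> t \<tau>) * norm (u \<tau>)" by (rule norm_blinfun)
  also have "\<dots> \<le> norm (\<Phi> t \<tau>) * (C * \<omega> \<tau>)" by (rule mult_left_mono) (use assms in auto)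
  also have "\<dots> = C * (norm (\<Phi> t \<tau>) * \<omega> \<tau>)" by simp
  also have "\<dots> \<le> C * m t \<tau>" by (rule mult_left_mono) (use assms majorant in auto)
  finally show ?thesis .
qed

lemma integral_bound:
  assumes u: "\<And>t. t \<in> J \<Longrightarrow> norm (u t) \<le> C * \<omega> t" "0 \<le> C" and t: "t \<in> J"
    and i: "((\<lambda>\<tau>. \<Phi> t \<tau> (u \<tau>)) has_integral y) J"
  shows "norm y \<le> q * C * \<omega> t"
proof -
  have "norm (integral J (\<lambda>\<tau>. \<Phi> t \<tau> (u \<tau>))) \<le> integral J (\<lambda>\<tau>. C * m t \<tau>)"
    by (rule integral_norm_bound_integral[OF has_integral_integrable[OF i] _ integrand_bound[OF u(1) t _ u(2)]])
      (use integrable_cmul[OF majorant_integrable[OF t], of C] in auto)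
  also have "\<dots> \<le> C * (q * \<omega> t)" using majorant_le[OF t] u(2) by (simp add: mult_left_mono)
  finally show ?thesis using integral_unique[OF i] by (simp add: mult_ac)
qed

text \<open>
  Applying the contraction estimate \<open>n\<close> times multiplies the bound by \<open>q ^ n\<close>.
\<close>

lemma homogeneous_solution_zero:
  assumes d: "\<And>t. t \<in> J \<Longrightarrow> ((\<lambda>\<tau>. \<Phi> t \<tau> (d \<tau>)) has_integral d t) J"
    and bound: "\<And>t. t \<in> J \<Longrightarrow> norm (d t) \<le> C * \<omega> t" and t: "t \<in> J"
  shows "d t = 0"
proof -
  have *: "norm (d t) \<le> q ^ n * \<bar>C\<bar> * \<omega> t" if "t \<in> J" for n t
    using that
  proof (induction n arbitrary: t)
    case 0
    have "C * \<omega> t \<le> \<bar>C\<bar> * \<omega> t" by (rule mult_right_mono) (use weight_nonneg 0 in auto)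
    then show ?case using bound[OF 0] by simp
  next
    case (Suc n)
    from integral_bound[OF Suc.IH _ Suc.prems d[OF Suc.prems]] show ?case
      using q by (simp add: mult.assoc)
  qed
  have "(\<lambda>n. q ^ n * \<bar>C\<bar> * \<omega> t) \<longlonglongrightarrow> 0 * \<bar>C\<bar> * \<omega> t"
    by (intro tendsto_intros LIMSEQ_power_zero) (use q in auto)
  then have "norm (d t) \<le> 0"
    using *[OF t] by (intro LIMSEQ_le_const) auto
  then show ?thesis by simp
qed

end

text \<open>
  The last assumptions make the integral operator map into continuous functions and make integrands with a continuous
  function Bochner integrable, so that the iteration can be carried on. The kernel may jump on the diagonal,
  which is a null set for fixed \<open>t\<close>.
\<close>

locale continuous_fredholm = fredholm +
  assumes local_majorant: "\<And>t. t \<in> J \<Longrightarrow>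
      \<exists>\<delta>>0. \<exists>D. D integrable_on J \<and> (\<forall>t'\<in>J. \<bar>t' - t\<bar> < \<delta> \<longrightarrow> (\<forall>\<tau>\<in>J. m t' \<tau> \<le> D \<tau>))"
    and kernel_continuous: "\<And>t \<tau> w. t \<in> J \<Longrightarrow> \<tau> \<in> J \<Longrightarrow> \<tau> \<noteq> t \<Longrightarrow>
      ((\<lambda>t'. \<Phi> t' \<tau> w) \<longlongrightarrow> \<Phi> t \<tau> w) (at t within J)"
    and bochner_continuous: "\<And>u C t. continuous_on J u \<Longrightarrow> (\<And>t. t \<in> J \<Longrightarrow> norm (u t) \<le> C * \<omega> t) \<Longrightarrow>
      t \<in> J \<Longrightarrow> bochner_on J (\<lambda>\<tau>. \<Phi> t \<tau> (u \<tau>))"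
begin

lemma continuous_on_integral:
  assumes u: "\<And>t. t \<in> J \<Longrightarrow> norm (u t) \<le> C * \<omega> t" "0 \<le> C"
    and b: "\<And>t. t \<in> J \<Longrightarrow> bochner_on J (\<lambda>\<tau>. \<Phi> t \<tau> (u \<tau>))"
  shows "continuous_on J (\<lambda>t. integral J (\<lambda>\<tau>. \<Phi> t \<tau> (u \<tau>)))"
  unfolding continuous_on_sequentially
proof (intro allI impI ballI, elim conjE)
  fix x :: "nat \<Rightarrow> real" and t assume t: "t \<in> J" and x: "\<forall>n. x n \<in> J" and lim: "x \<longlonglongrightarrow> t"
  obtain \<delta> D where \<delta>: "\<delta> > 0" and D: "D integrable_on J"
    "\<And>t' \<tau>. t' \<in> J \<Longrightarrow> \<bar>t' - t\<bar> < \<delta> \<Longrightarrow> \<tau> \<in> J \<Longrightarrow> m t' \<tau> \<le> D \<tau>"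
    using local_majorant[OF t] by blast
  obtain n0 where n0: "\<And>n. n \<ge> n0 \<Longrightarrow> \<bar>x n - t\<bar> < \<delta>"
    using LIMSEQ_D[OF lim \<delta>] by auto
  have lim0: "(\<lambda>n. x (n + n0)) \<longlonglongrightarrow> t" using lim by (rule LIMSEQ_ignore_initial_segment)
  have "(\<lambda>n. integral J (\<lambda>\<tau>. \<Phi> (x (n + n0)) \<tau> (u \<tau>))) \<longlonglongrightarrow> integral J (\<lambda>\<tau>. \<Phi> t \<tau> (u \<tau>))"
  proof (rule bochner_dominated_convergence(2)[OF b J negligible_sing[of t]])
    show "(\<lambda>\<tau>. C * D \<tau>) integrable_on J" using integrable_cmul[OF D(1), of C] by simp
    fix n show "x (n + n0) \<in> J" using x by simp
    show "norm (\<Phi> (x (n + n0)) \<tau> (u \<tau>)) \<le> C * D \<tau>" if "\<tau> \<in> J" for \<tau>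
    proof -
      have "norm (\<Phi> (x (n + n0)) \<tau> (u \<tau>)) \<le> C * m (x (n + n0)) \<tau>"
        by (rule integrand_bound[OF u(1)]) (use x that u(2) in auto)
      also have "\<dots> \<le> C * D \<tau>"
        by (rule mult_left_mono[OF D(2) u(2)]) (use x that n0 in auto)
      finally show ?thesis .
    qed
  next
    fix \<tau> assume "\<tau> \<in> J - {t}"
    then have "((\<lambda>t'. \<Phi> t' \<tau> (u \<tau>)) \<longlongrightarrow> \<Phi> t \<tau> (u \<tau>)) (at t within J)"
      using kernel_continuous[OF t] by auto
    then have "continuous (at t within J) (\<lambda>t'. \<Phi> t' \<tau> (u \<tau>))" by (simp add: continuous_within)
    then show "(\<lambda>n. \<Phi> (x (n + n0)) \<tau> (u \<tau>)) \<longlonglongrightarrow> \<Phi> t \<tau> (u \<tau>)"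
      by (rule continuous_within_tendsto_compose'[OF _ _ lim0]) (use x in simp)
  qed
  then have "(\<lambda>n. integral J (\<lambda>\<tau>. \<Phi> (x n) \<tau> (u \<tau>))) \<longlonglongrightarrow> integral J (\<lambda>\<tau>. \<Phi> t \<tau> (u \<tau>))"
    by (rule LIMSEQ_offset)
  then show "((\<lambda>t. integral J (\<lambda>\<tau>. \<Phi> t \<tau> (u \<tau>))) \<circ> x) \<longlonglongrightarrow> integral J (\<lambda>\<tau>. \<Phi> t \<tau> (u \<tau>))"
    by (simp add: o_def)
qed

text \<open>
  Neumann series. The inhomogeneity \<open>f\<close> may be discontinuous (a Green kernel jumps on the diagonal); all later terms
  of the series are continuous.
\<close>

theorem solution_exists:
  assumes f: "\<And>t. t \<in> J \<Longrightarrow> norm (f t) \<le> M * \<omega> t" "0 \<le> M"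
    and fb: "\<And>t. t \<in> J \<Longrightarrow> bochner_on J (\<lambda>\<tau>. \<Phi> t \<tau> (f \<tau>))"
  obtains u where "\<And>t. t \<in> J \<Longrightarrow> ((\<lambda>\<tau>. \<Phi> t \<tau> (u \<tau>)) has_integral (u t - f t)) J"
    "\<And>t. t \<in> J \<Longrightarrow> norm (u t) \<le> M / (1 - q) * \<omega> t"
    "continuous_on J (\<lambda>t. u t - f t)"
proof -
  let ?T = "\<lambda>u t. integral J (\<lambda>\<tau>. \<Phi> t \<tau> (u \<tau>))"
  define N where "N = (\<lambda>n. (?T ^^ n) f)"
  have N0: "N 0 = f" and NS: "N (Suc n) = ?T (N n)" for n by (simp_all add: N_def)
  have qn: "0 \<le> q ^ n * M" for n using q f(2) by simp
  have N: "(\<forall>t\<in>J. norm (N n t) \<le> q ^ n * M * \<omega> t) \<and> (\<forall>t\<in>J. bochner_on J (\<lambda>\<tau>. \<Phi> t \<tau> (N n \<tau>)))" for n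
  proof (induction n)
    case 0
    show ?case using f fb by (simp add: N0)
  next
    case (Suc n)
    have c: "continuous_on J (N (Suc n))"
      unfolding NS by (rule continuous_on_integral[of _ "q ^ n * M"]) (use Suc qn in auto)
    have bd: "norm (N (Suc n) t) \<le> q ^ Suc n * M * \<omega> t" if "t \<in> J" for t
      using integral_bound[of "N n" "q ^ n * M" t "N (Suc n) t"] Suc qn that
        integrable_integral[OF bochner_on_integrable[OF _ J]]
      by (auto simp: NS mult_ac)
    then show ?case using bochner_continuous[OF c bd] by blast
  qed
  have summ: "summable (\<lambda>n. N n t)" if "t \<in> J" for t
  proof (rule summable_comparison_test)
    show "\<exists>k. \<forall>n\<ge>k. norm (N n t) \<le> q ^ n * (M * \<omega> t)" using N that by (auto simp: mult_ac)
    show "summable (\<lambda>n. q ^ n * (M * \<omega> t))"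
      by (intro summable_mult2 summable_geometric) (use q in auto)
  qed
  define S where "S = (\<lambda>n t. \<Sum>i<n. N i t)"
  define u where "u = (\<lambda>t. \<Sum>n. N n t)"
  have S_lim: "(\<lambda>n. S n t) \<longlonglongrightarrow> u t" if "t \<in> J" for t
    using summable_LIMSEQ[OF summ[OF that]] by (simp add: S_def u_def)
  have S_bd: "norm (S n t) \<le> M / (1 - q) * \<omega> t" if "t \<in> J" for n t
  proof -
    have "norm (S n t) \<le> (\<Sum>i<n. q ^ i * (M * \<omega> t))"
      unfolding S_def by (rule sum_norm_le) (use N that in \<open>auto simp: mult_ac\<close>)
    also have "\<dots> = (\<Sum>i<n. q ^ i) * (M * \<omega> t)" by (simp add: sum_distrib_right)
    also have "\<dots> \<le> (1 / (1 - q)) * (M * \<omega> t)"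
    proof (rule mult_right_mono)
      have "(\<Sum>i<n. q ^ i) \<le> (\<Sum>i. q ^ i)"
        by (rule sum_le_suminf) (use q in \<open>auto intro: summable_geometric\<close>)
      then show "(\<Sum>i<n. q ^ i) \<le> 1 / (1 - q)" using q by (simp add: suminf_geometric)
    qed (use f(2) weight_nonneg that in auto)
    finally show ?thesis by simp
  qed
  have u_bd: "norm (u t) \<le> M / (1 - q) * \<omega> t" if "t \<in> J" for t
    by (rule LIMSEQ_le_const2[OF tendsto_norm[OF S_lim[OF that]]]) (use S_bd[OF that] in auto)
  have Mq: "0 \<le> M / (1 - q)" using f(2) q by simp
  have Sb: "bochner_on J (\<lambda>\<tau>. \<Phi> t \<tau> (S n \<tau>))" if "t \<in> J" for t n
    unfolding S_def blinfun.sum_right by (rule bochner_on_sum) (use N that in auto)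
  have conv: "bochner_on J (\<lambda>\<tau>. \<Phi> t \<tau> (u \<tau>))" "(\<lambda>n. ?T (S n) t) \<longlonglongrightarrow> ?T u t" if t: "t \<in> J" for t
  proof -
    have 1: "(\<lambda>n. \<Phi> t \<tau> (S n \<tau>)) \<longlonglongrightarrow> \<Phi> t \<tau> (u \<tau>)" if "\<tau> \<in> J - {}" for \<tau>
      by (intro tendsto_intros S_lim) (use that in auto)
    have 2: "(\<lambda>\<tau>. M / (1 - q) * m t \<tau>) integrable_on J"
      using integrable_cmul[OF majorant_integrable[OF t], of "M / (1 - q)"] by simp
    have 3: "norm (\<Phi> t \<tau> (S n \<tau>)) \<le> M / (1 - q) * m t \<tau>" if "\<tau> \<in> J" for n \<tau>
      by (rule integrand_bound[OF S_bd t that Mq])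
    show "bochner_on J (\<lambda>\<tau>. \<Phi> t \<tau> (u \<tau>))"
      by (rule bochner_dominated_convergence(1)[OF Sb[OF t] J negligible_empty 1 2 3])
    show "(\<lambda>n. ?T (S n) t) \<longlonglongrightarrow> ?T u t"
      by (rule bochner_dominated_convergence(2)[OF Sb[OF t] J negligible_empty 1 2 3])
  qed
  have eq: "?T u t = u t - f t" if t: "t \<in> J" for t
  proof -
    have "?T (S n) t = S (Suc n) t - f t" for n
    proof -
      have "?T (S n) t = (\<Sum>i<n. ?T (N i) t)"
        unfolding S_def blinfun.sum_right
        by (rule integral_sum) (use N t in \<open>auto intro: bochner_on_integrable[OF _ J]\<close>)
      also have "\<dots> = (\<Sum>i<n. N (Suc i) t)" by (simp add: NS)
      also have "\<dots> = S (Suc n) t - f t" by (simp add: S_def sum.lessThan_Suc_shift N0 del: sum.lessThan_Suc)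
      finally show ?thesis .
    qed
    then have "(\<lambda>n. ?T (S n) t) \<longlonglongrightarrow> u t - f t"
      using LIMSEQ_Suc[OF S_lim[OF t]] by (auto intro: tendsto_diff)
    with conv(2)[OF t] show ?thesis by (rule LIMSEQ_unique)
  qed
  show thesis
  proof (rule that)
    show "((\<lambda>\<tau>. \<Phi> t \<tau> (u \<tau>)) has_integral (u t - f t)) J" if "t \<in> J" for t
      using integrable_integral[OF bochner_on_integrable[OF conv(1)[OF that] J]] eq[OF that] by simp
    show "continuous_on J (\<lambda>t. u t - f t)"
      by (rule continuous_on_eq[OF continuous_on_integral[OF u_bd Mq conv(1)]]) (simp_all add: eq)
  qed (rule u_bd)
qed

end

section \<open>Uniform boundedness, a weight for Volterra kernels, joint continuity\<close>

text \<open>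
  By Baire's theorem one of the closed sets \<open>E n\<close> contains a ball; differences of points of that ball cover a
  neighbourhood of zero.
\<close>

lemma uniform_boundedness:
  fixes T :: "'i \<Rightarrow> 'a::banach \<Rightarrow>\<^sub>L 'b::real_normed_vector"
  assumes ptw: "\<And>x. bounded ((\<lambda>i. T i x) ` I)"
  shows "\<exists>C>0. \<forall>i\<in>I. norm (T i) \<le> C"
proof -
  define E where "E = (\<lambda>n::nat. {x. \<forall>i\<in>I. norm (T i x) \<le> real n})"
  have cl: "closed (E n)" for n
  proof -
    have "E n = (\<Inter>i\<in>I. {x. norm (T i x) \<le> real n})" by (auto simp: E_def)
    then show ?thesis
      by (auto intro!: closed_INT closed_Collect_le continuous_intros)
  qed
  have "\<Union>(range E) = UNIV"
  proof -
    have "\<exists>n. x \<in> E n" for x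
    proof -
      obtain c where c: "\<And>i. i \<in> I \<Longrightarrow> norm (T i x) \<le> c"
        using ptw[of x] unfolding bounded_iff by auto
      obtain n :: nat where "c \<le> real n" using real_arch_simple by blast
      then have "x \<in> E n" using c by (force simp: E_def)
      then show ?thesis ..
    qed
    then show ?thesis by blast
  qed
  moreover have "interior (\<Union>(range E)) = {}" if none: "\<And>n. interior (E n) = {}"
  proof -
    have "euclidean interior_of \<Union>(range E) = {}"
    proof (rule Baire_category_alt)
      fix S assume "S \<in> range E"
      then obtain n where "S = E n" ..
      then show "closedin euclidean S \<and> euclidean interior_of S = {}"
        using cl none by simp
    qed (simp_all add: completely_metrizable_space_euclidean)
    then show ?thesis by simp
  qed
  ultimately obtain n where "interior (E n) \<noteq> {}" by (metis UNIV_not_empty interior_UNIV)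
  then obtain x0 where "x0 \<in> interior (E n)" by blast
  then obtain r where r: "r > 0" "cball x0 r \<subseteq> E n" unfolding mem_interior_cball by blast
  have "norm (T i) \<le> 2 * real n / r" if i: "i \<in> I" for i
  proof (rule norm_blinfun_bound)
    show "0 \<le> 2 * real n / r" using r(1) by simp
    fix x
    show "norm (T i x) \<le> 2 * real n / r * norm x"
    proof (cases "x = 0")
      case False
      define y where "y = (r / norm x) *\<^sub>R x"
      have "norm y = r" using False r(1) by (simp add: y_def)
      then have mem: "x0 + y \<in> E n" "x0 \<in> E n" using r by (auto simp: dist_norm)
      have "norm (T i y) = norm (T i (x0 + y) - T i x0)" by (simp add: blinfun.add_right)
      also have "\<dots> \<le> norm (T i (x0 + y)) + norm (T i x0)" by (rule norm_triangle_ineq4)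
      also have "\<dots> \<le> 2 * real n" using mem i by (fastforce simp: E_def)
      finally have "r / norm x * norm (T i x) \<le> 2 * real n"
        using r(1) by (simp add: y_def blinfun.scaleR_right)
      then show ?thesis using r(1) False by (simp add: field_simps)
    qed simp
  qed
  then have "\<forall>i\<in>I. norm (T i) \<le> 2 * real n / r + 1" by force
  moreover have "0 < 2 * real n / r + 1" using r(1) by (simp add: add_nonneg_pos)
  ultimately show ?thesis by blast
qed

lemma integrable_mult_continuous:
  fixes g \<phi> :: "real \<Rightarrow> real"
  assumes g: "g integrable_on {a..b}" "\<And>\<tau>. 0 \<le> g \<tau>" and \<phi>: "continuous_on {a..b} \<phi>"
  shows "(\<lambda>\<tau>. g \<tau> * \<phi> \<tau>) integrable_on {a..b}"
proof -
  have "(\<lambda>\<tau>. \<phi> \<tau> * g \<tau>) absolutely_integrable_on {a..b}"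
  proof (rule absolutely_integrable_bounded_measurable_product_real)
    show "\<phi> \<in> borel_measurable (lebesgue_on {a..b})"
      by (rule continuous_imp_measurable_on_sets_lebesgue[OF \<phi>]) simp
    show "bounded (\<phi> ` {a..b})"
      by (rule compact_imp_bounded[OF compact_continuous_image[OF \<phi>]]) simp
    show "g absolutely_integrable_on {a..b}"
      by (rule nonnegative_absolutely_integrable_1[OF g(1)]) (rule g(2))
  qed simp
  then show ?thesis by (simp add: mult.commute absolutely_integrable_on_def)
qed

text \<open>
  If \<open>g\<close> were continuous, \<open>\<phi>\<close> would have the derivative \<open>4 * g * \<phi>\<close>, and the estimate would hold even with the factor 4
  in place of 2. For integrable \<open>g\<close> no derivative is used: over a short interval the increment of \<open>\<phi>\<close> is at least
  \<open>4 * h * \<phi> p\<close>, where \<open>h\<close> is the integral of \<open>g\<close>, while \<open>\<phi>\<close> at most doubles there; the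
  local inequality with factor 2 is then summed up by bisection.
\<close>

lemma volterra_weight:
  fixes g :: "real \<Rightarrow> real"
  assumes g: "g integrable_on {a..b}" "\<And>\<tau>. 0 \<le> g \<tau>"
  defines "\<phi> \<equiv> \<lambda>t. exp (4 * integral {a..t} g)"
  assumes t: "t \<in> {a..b}"
  shows "(\<lambda>\<tau>. g \<tau> * \<phi> \<tau>) integrable_on {a..b}" "2 * integral {a..t} (\<lambda>\<tau>. g \<tau> * \<phi> \<tau>) \<le> \<phi> t"
proof -
  let ?H = "\<lambda>t. integral {a..t} g"
  have H: "continuous_on {a..b} ?H" by (rule indefinite_integral_continuous_1[OF g(1)])
  then have \<phi>: "continuous_on {a..b} \<phi>" unfolding \<phi>_def by (intro continuous_intros)
  show i: "(\<lambda>\<tau>. g \<tau> * \<phi> \<tau>) integrable_on {a..b}" by (rule integrable_mult_continuous[OF g \<phi>])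
  have sub: "g integrable_on {p..s}" "(\<lambda>\<tau>. g \<tau> * \<phi> \<tau>) integrable_on {p..s}" if "a \<le> p" "s \<le> b" for p s
    using that by (auto intro: integrable_subinterval_real[OF g(1)] integrable_subinterval_real[OF i])
  have Hdiff: "integral {p..s} g = ?H s - ?H p" if "a \<le> p" "p \<le> s" "s \<le> b" for p s
    using Henstock_Kurzweil_Integration.integral_combine[where a=a and c=p and b=s and f=g] sub(1)[of a s] that by simp
  have Hmono: "?H p \<le> ?H s" if "a \<le> p" "p \<le> s" "s \<le> b" for p s
    using Hdiff[OF that] integral_nonneg[OF sub(1)[OF that(1,3)]] g(2) by simp
  define P where "P = (\<lambda>p s. a \<le> p \<and> p \<le> s \<and> s \<le> b \<longrightarrow>
      2 * integral {p..s} (\<lambda>\<tau>. g \<tau> * \<phi> \<tau>) \<le> \<phi> s - \<phi> p)"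
  have "P a t"
  proof (rule Bolzano)
    show "a \<le> t" using t by simp
  next
    fix p s r assume "P p s" "P s r" "p \<le> s" "s \<le> r"
    then show "P p r"
      using Henstock_Kurzweil_Integration.integral_combine[where a=p and c=s and b=r and f="\<lambda>\<tau>. g \<tau> * \<phi> \<tau>"] sub(2)[of p r] by (auto simp: P_def)
  next
    fix x assume x: "a \<le> x" "x \<le> t"
    then have "x \<in> {a..b}" using t by auto
    \<comment> \<open>Two oscillations of \<open>?H\<close> below \<open>ln 2 / 8\<close> make \<open>\<phi>\<close> grow by a factor of at most \<open>exp (4 * (ln 2 / 4)) = 2\<close>.\<close>
    moreover have "ln 2 / 8 > (0::real)" by simp
    ultimately obtain d where d: "d > 0"
      "\<And>y. y \<in> {a..b} \<Longrightarrow> dist y x < d \<Longrightarrow> dist (?H y) (?H x) < ln 2 / 8"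
      using H unfolding continuous_on_iff by meson
    have "P p s" if ps: "p \<le> x" "x \<le> s" "s - p < d" for p s
      unfolding P_def
    proof
      assume *: "a \<le> p \<and> p \<le> s \<and> s \<le> b"
      define h where "h = ?H s - ?H p"
      have h0: "0 \<le> h" using Hmono[of p s] * by (simp add: h_def)
      have "dist (?H p) (?H x) < ln 2 / 8" "dist (?H s) (?H x) < ln 2 / 8"
        using * ps d(2)[of p] d(2)[of s] by (auto simp: dist_real_def)
      then have h1: "4 * h < ln 2" unfolding h_def dist_real_def abs_less_iff by argo
      have \<phi>s: "\<phi> s = exp (4 * h) * \<phi> p" by (simp add: \<phi>_def h_def algebra_simps exp_add[symmetric])
      have "exp (4 * h) < exp (ln 2)" using h1 by (subst exp_less_cancel_iff)
      then have e2: "exp (4 * h) \<le> 2" by simp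
      have \<phi>p: "\<phi> p > 0" by (simp add: \<phi>_def)
      have "integral {p..s} (\<lambda>\<tau>. g \<tau> * \<phi> \<tau>) \<le> integral {p..s} (\<lambda>\<tau>. g \<tau> * \<phi> s)"
      proof (rule integral_le)
        fix \<tau> assume \<tau>: "\<tau> \<in> {p..s}"
        have "\<phi> \<tau> \<le> \<phi> s" unfolding \<phi>_def using Hmono[of \<tau> s] \<tau> * by simp
        then show "g \<tau> * \<phi> \<tau> \<le> g \<tau> * \<phi> s" using g(2) by (rule mult_left_mono)
      qed (use * sub in \<open>auto intro: integrable_on_mult_left\<close>)
      also have "\<dots> = h * \<phi> s" using Hdiff[of p s] * by (simp add: h_def)
      also have "\<dots> \<le> h * (2 * \<phi> p)"
        unfolding \<phi>s by (intro mult_left_mono mult_right_mono) (use e2 h0 \<phi>p in auto)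
      finally have "2 * integral {p..s} (\<lambda>\<tau>. g \<tau> * \<phi> \<tau>) \<le> 4 * h * \<phi> p" by simp
      also have "\<dots> \<le> (exp (4 * h) - 1) * \<phi> p"
      proof (rule mult_right_mono)
        have "1 + 4 * h \<le> exp (4 * h)" by (rule exp_ge_add_one_self)
        then show "4 * h \<le> exp (4 * h) - 1" by linarith
      qed (use \<phi>p in simp)
      also have "\<dots> = \<phi> s - \<phi> p" by (simp add: \<phi>s algebra_simps)
      finally show "2 * integral {p..s} (\<lambda>\<tau>. g \<tau> * \<phi> \<tau>) \<le> \<phi> s - \<phi> p" .
    qed
    then show "\<exists>d>0. \<forall>p s. p \<le> x \<and> x \<le> s \<and> s - p < d \<longrightarrow> P p s"
      using d(1) by (intro exI[of _ d]) simp
  qed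
  moreover have "\<phi> a > 0" by (simp add: \<phi>_def)
  ultimately show "2 * integral {a..t} (\<lambda>\<tau>. g \<tau> * \<phi> \<tau>) \<le> \<phi> t"
    using t by (simp add: P_def)
qed

text \<open>
  Two orbits started from the same vector at neighbouring times differ by the image, under one bounded operator,
  of the displacement over the short interval between the two initial times. So joint continuity follows from
  continuity of the orbits and from \<open>V(t,s) x \<rightarrow> x\<close> as both times approach the same value.
\<close>

lemma evolution_family_continuous_on:
  fixes V :: "real \<Rightarrow> real \<Rightarrow> 'a::banach \<Rightarrow>\<^sub>L 'a"
  assumes id: "\<And>t. 0 \<le> t \<Longrightarrow> V t t = id_blinfun"
    and comp: "\<And>t r s x. 0 \<le> s \<Longrightarrow> s \<le> r \<Longrightarrow> r \<le> t \<Longrightarrow> V t r (V r s x) = V t s x"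
    and bounded: "\<And>T. \<exists>M. \<forall>s t. 0 \<le> s \<and> s \<le> t \<and> t \<le> T \<longrightarrow> norm (V t s) \<le> M"
    and orbit: "\<And>s T x. 0 \<le> s \<Longrightarrow> continuous_on {s..T} (\<lambda>t. V t s x)"
    and diagonal: "\<And>r x e. 0 \<le> r \<Longrightarrow> 0 < e \<Longrightarrow>
      \<exists>\<delta>>0. \<forall>s t. 0 \<le> s \<and> s \<le> t \<and> \<bar>s - r\<bar> < \<delta> \<and> \<bar>t - r\<bar> < \<delta> \<longrightarrow> norm (V t s x - x) < e"
  shows "continuous_on {(t, s). t \<in> {0..} \<and> s \<in> {0..} \<and> s \<le> t} (\<lambda>(t, s). V t s x)"
  unfolding continuous_on_iff
proof (intro ballI allI impI)
  fix p :: "real \<times> real" and e :: real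
  assume p: "p \<in> {(t, s). t \<in> {0..} \<and> s \<in> {0..} \<and> s \<le> t}" and e: "e > 0"
  obtain t0 s0 where p_eq: "p = (t0, s0)" by (cases p)
  with p have t0: "t0 \<in> {0..}" and s0: "s0 \<in> {0..}" "s0 \<le> t0" by auto
  have "\<exists>d>0. \<forall>t s. 0 \<le> s \<and> s \<le> t \<and> \<bar>t - t0\<bar> < d \<and> \<bar>s - s0\<bar> < d \<longrightarrow> norm (V t s x - V t0 s0 x) < e"
  proof (cases "s0 = t0")
    case True
    then have "V t0 s0 x = x" using t0 id by simp
    then show ?thesis using diagonal[of s0 e x] True s0 e by auto
  next
    case False
    then have lt: "s0 < t0" using s0 by simp
    obtain M where M: "\<And>s t. 0 \<le> s \<Longrightarrow> s \<le> t \<Longrightarrow> t \<le> t0 + 1 \<Longrightarrow> norm (V t s) \<le> M"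
      using bounded[of "t0 + 1"] by blast
    have M0: "0 \<le> M" using M[of s0 t0] s0 order_trans[OF norm_ge_zero] by force
    define \<eta> where "\<eta> = e / (2 * (M + 1))"
    have \<eta>: "\<eta> > 0" "M * \<eta> < e / 2"
      using e M0 by (auto simp: \<eta>_def field_simps)
    obtain \<delta>1 where \<delta>1: "\<delta>1 > 0" "\<And>s t. 0 \<le> s \<Longrightarrow> s \<le> t \<Longrightarrow> \<bar>s - s0\<bar> < \<delta>1 \<Longrightarrow> \<bar>t - s0\<bar> < \<delta>1 \<Longrightarrow>
        norm (V t s x - x) < \<eta>"
      using diagonal[of s0 \<eta> x] s0 \<eta> by auto
    have "t0 \<in> {s0..t0 + 1}" "e / 2 > 0" using s0 e by auto
    then obtain \<delta>2 where \<delta>2: "\<delta>2 > 0" "\<And>t. t \<in> {s0..t0 + 1} \<Longrightarrow> dist t t0 < \<delta>2 \<Longrightarrow>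
        dist (V t s0 x) (V t0 s0 x) < e / 2"
      using orbit[of s0 "t0 + 1" x] s0 unfolding continuous_on_iff by (meson atLeast_iff)
    define d where "d = min (min \<delta>1 \<delta>2) (min 1 ((t0 - s0) / 2))"
    have d: "d > 0" "d \<le> \<delta>1" "d \<le> \<delta>2" "d \<le> 1" "d \<le> (t0 - s0) / 2"
      using \<delta>1(1) \<delta>2(1) lt by (auto simp: d_def min_def)
    have "norm (V t s x - V t0 s0 x) < e"
      if ts: "0 \<le> s" "s \<le> t" "\<bar>t - t0\<bar> < d" "\<bar>s - s0\<bar> < d" for t s
    proof -
      have t: "s0 \<le> t" "t \<le> t0 + 1" using ts d lt by (auto simp: abs_less_iff field_simps)
      have "norm (V t s x - V t s0 x) \<le> M * \<eta>"
      proof (cases "s \<le> s0")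
        case True
        have "V t s x - V t s0 x = V t s0 (V s0 s x - x)"
          using comp[of s s0 t x] ts True t by (simp add: blinfun.diff_right)
        moreover have "norm (V t s0 (V s0 s x - x)) \<le> norm (V t s0) * norm (V s0 s x - x)"
          by (rule norm_blinfun)
        moreover have "\<dots> \<le> M * \<eta>"
          by (rule mult_mono) (use M[of s0 t] \<delta>1(2)[of s s0] M0 s0 t True ts d \<delta>1(1) in auto)
        ultimately show ?thesis by simp
      next
        case False
        have "V t s x - V t s0 x = V t s (x - V s s0 x)"
          using comp[of s0 s t x] ts False s0 by (simp add: blinfun.diff_right)
        moreover have "norm (V t s (x - V s s0 x)) \<le> norm (V t s) * norm (x - V s s0 x)"
          by (rule norm_blinfun)
        moreover have "\<dots> \<le> M * \<eta>"
          by (rule mult_mono)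
            (use M[of s t] \<delta>1(2)[of s0 s] M0 s0 t False ts d \<delta>1(1) in \<open>auto simp: norm_minus_commute\<close>)
        ultimately show ?thesis by simp
      qed
      moreover have "norm (V t s0 x - V t0 s0 x) < e / 2"
        using \<delta>2(2)[of t] t ts d by (simp add: dist_norm)
      ultimately show ?thesis
        using norm_triangle_ineq[of "V t s x - V t s0 x" "V t s0 x - V t0 s0 x"] \<eta>(2) by simp
    qed
    then show ?thesis using d(1) by blast
  qed
  then obtain d where d: "d > 0" "\<And>t s. 0 \<le> s \<Longrightarrow> s \<le> t \<Longrightarrow> \<bar>t - t0\<bar> < d \<Longrightarrow> \<bar>s - s0\<bar> < d \<Longrightarrow>
      norm (V t s x - V t0 s0 x) < e" by blast
  have "dist (V t s x) (V t0 s0 x) < e"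
    if "0 \<le> s" "s \<le> t" "dist (t, s) (t0, s0) < d" for t s
    using d(2)[of s t] that dist_fst_le[of "(t, s)" "(t0, s0)"] dist_snd_le[of "(t, s)" "(t0, s0)"]
    by (simp add: dist_norm dist_real_def)
  then show "\<exists>d>0. \<forall>x'\<in>{(t, s). t \<in> {0..} \<and> s \<in> {0..} \<and> s \<le> t}. dist x' p < d \<longrightarrow>
      dist (case x' of (t, s) \<Rightarrow> V t s x) (case p of (t, s) \<Rightarrow> V t s x) < e"
    using d(1) by (intro exI[of _ d]) (auto simp: p_eq)
qed

lemma evolution_family_continuous_compose:
  fixes V :: "real \<Rightarrow> real \<Rightarrow> 'a::banach \<Rightarrow>\<^sub>L 'a"
  assumes V: "evolution_family {0..} V"
    and "continuous_on S f" "continuous_on S g" "\<And>x. x \<in> S \<Longrightarrow> 0 \<le> g x \<and> g x \<le> f x"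
  shows "continuous_on S (\<lambda>x. V (f x) (g x) w)"
proof -
  have "continuous_on {(t, s). t \<in> {0..} \<and> s \<in> {0..} \<and> s \<le> t} (\<lambda>(t, s). V t s w)"
    using V by (simp add: evolution_family_def)
  moreover have "continuous_on S (\<lambda>x. (f x, g x))"
    using assms(2,3) by (rule continuous_on_Pair)
  moreover have "(\<lambda>x. (f x, g x)) ` S \<subseteq> {(t, s). t \<in> {0..} \<and> s \<in> {0..} \<and> s \<le> t}"
    using assms(4) by force
  ultimately have "continuous_on S (\<lambda>x. (\<lambda>(t, s). V t s w) (f x, g x))"
    by (rule continuous_on_compose2)
  then show ?thesis by simp
qed

section \<open>The perturbed evolution family\<close>

locale perturbation =
  fixes U :: "real \<Rightarrow> real \<Rightarrow> 'a::banach \<Rightarrow>\<^sub>L 'a" and B :: "real \<Rightarrow> 'a \<Rightarrow>\<^sub>L 'a"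
  assumes evolution: "evolution_family {0..} U"
    and B_measurable: "\<And>x. strongly_measurable (\<lambda>t. B t x)"
    and norm_B_measurable: "(\<lambda>t. norm (B t)) \<in> borel_measurable lebesgue"
    and norm_B_integrable: "\<And>T. (\<lambda>t. norm (B t)) integrable_on {0..T}"
begin

lemma U_id: "0 \<le> t \<Longrightarrow> U t t = id_blinfun"
  using evolution by (simp add: evolution_family_def)

lemma U_comp:
  assumes "0 \<le> s" "s \<le> r" "r \<le> t"
  shows "U t r (U r s x) = U t s x"
proof -
  have *: "\<forall>t\<in>{0..}. \<forall>r\<in>{0..}. \<forall>s\<in>{0..}. s \<le> r \<and> r \<le> t \<longrightarrow> U t s = U t r o\<^sub>L U r s"
    using evolution unfolding evolution_family_def by (elim conjE)
  have "U t s = U t r o\<^sub>L U r s" by (rule *[rule_format]) (use assms in auto)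
  then show ?thesis by simp
qed

lemmas U_continuous = evolution_family_continuous_compose[OF evolution]

lemma U_locally_bounded:
  "\<exists>C>0. \<forall>s t. 0 \<le> s \<and> s \<le> t \<and> t \<le> T \<longrightarrow> norm (U t s) \<le> C"
proof -
  let ?D = "{(t, s). 0 \<le> s \<and> s \<le> t \<and> t \<le> T}"
  have "compact ?D"
  proof -
    have "bounded ?D"
      by (rule bounded_subset[of "{0..T} \<times> {0..T}"]) (auto intro: bounded_Times)
    moreover have "closed ?D"
    proof -
      have "?D = {p. 0 \<le> snd p} \<inter> {p. snd p \<le> fst p} \<inter> {p. fst p \<le> T}" by auto
      then show ?thesis
        by (auto intro!: closed_Int closed_Collect_le continuous_intros)
    qed
    ultimately show ?thesis by (simp add: compact_eq_bounded_closed)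
  qed
  moreover have "continuous_on ?D (\<lambda>p. U (fst p) (snd p) x)" for x
    by (rule U_continuous) (auto intro!: continuous_intros)
  ultimately have "bounded ((\<lambda>p. U (fst p) (snd p) x) ` ?D)" for x
    by (intro compact_imp_bounded compact_continuous_image)
  from uniform_boundedness[OF this] obtain C
    where "0 < C" and C: "\<forall>p\<in>?D. norm (U (fst p) (snd p)) \<le> C" by blast
  have "norm (U t s) \<le> C" if "0 \<le> s \<and> s \<le> t \<and> t \<le> T" for s t
    using bspec[OF C, of "(t, s)"] that by simp
  then show ?thesis using \<open>0 < C\<close> by blast
qed

lemma norm_B_integrable_on: "0 \<le> a \<Longrightarrow> (\<lambda>t. norm (B t)) integrable_on {a..b}"
  by (rule integrable_subinterval_real[OF norm_B_integrable[of b]]) auto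

text \<open>
  The integrands of all integral equations below are pieced together from integrands of this form.
\<close>

lemma bochner_on_kernel:
  fixes k :: "real \<Rightarrow> 'a \<Rightarrow>\<^sub>L 'a"
  assumes k: "\<And>w. continuous_on {a..b} (\<lambda>\<tau>. k \<tau> w)" "\<And>\<tau>. \<tau> \<in> {a..b} \<Longrightarrow> norm (k \<tau>) \<le> C"
    and u: "continuous_on {a..b} u" and a: "0 \<le> a"
  shows "bochner_on {a..b} (\<lambda>\<tau>. k \<tau> (B \<tau> (u \<tau>)))"
proof (rule bochner_on_apply_strongly_continuous[OF k])
  show "bochner_on {a..b} (\<lambda>\<tau>. B \<tau> (u \<tau>))"
  proof (rule bochner_on_apply_to_continuous[OF _ norm_B_integrable_on[OF a] u])
    fix x
    show "bochner_on {a..b} (\<lambda>\<tau>. B \<tau> x)"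
    proof (rule bochner_on_strongly_measurable[OF B_measurable])
      show "(\<lambda>\<tau>. norm (B \<tau>) * norm x) integrable_on {a..b}"
        by (rule integrable_on_mult_left[OF norm_B_integrable_on[OF a]])
      show "(\<lambda>\<tau>. norm (B \<tau>) * norm x) \<in> borel_measurable lebesgue"
        using norm_B_measurable by measurable
    qed (rule norm_blinfun)
  qed
qed

text \<open>
  Mild solutions of the perturbed equation on \<open>[s,T]\<close> with value \<open>x\<close> at \<open>s\<close>.
\<close>

definition mild :: "real \<Rightarrow> real \<Rightarrow> 'a \<Rightarrow> (real \<Rightarrow> 'a) \<Rightarrow> bool" where
  "mild s T x u \<longleftrightarrow> continuous_on {s..T} u \<and>
     (\<forall>t\<in>{s..T}. ((\<lambda>\<tau>. U t \<tau> (B \<tau> (u \<tau>))) has_integral (u t - U t s x)) {s..t})"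

text \<open>
  Extension by zero turns the integrals over \<open>[s,t]\<close> with varying endpoint into integrals over the fixed interval \<open>[s,T]\<close>.
\<close>

definition volterra_kernel :: "real \<Rightarrow> real \<Rightarrow> 'a \<Rightarrow>\<^sub>L 'a" where
  "volterra_kernel t \<tau> = (if \<tau> \<in> {..t} then U t \<tau> o\<^sub>L B \<tau> else 0)"

lemma has_integral_volterra_kernel:
  assumes "t \<in> {s..T}"
  shows "((\<lambda>\<tau>. volterra_kernel t \<tau> (u \<tau>)) has_integral y) {s..T} \<longleftrightarrow>
    ((\<lambda>\<tau>. U t \<tau> (B \<tau> (u \<tau>))) has_integral y) {s..t}"
proof -
  have "(\<lambda>\<tau>. volterra_kernel t \<tau> (u \<tau>)) = (\<lambda>\<tau>. if \<tau> \<in> {..t} then U t \<tau> (B \<tau> (u \<tau>)) else 0)"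
    by (auto simp: volterra_kernel_def)
  moreover have "{..t} \<inter> {s..T} = {s..t}" using assms by auto
  ultimately show ?thesis by (simp only: has_integral_restrict_Int)
qed

lemma volterra_fredholm:
  assumes s: "0 \<le> s" and C: "0 < C" "\<And>s t. 0 \<le> s \<Longrightarrow> s \<le> t \<Longrightarrow> t \<le> T \<Longrightarrow> norm (U t s) \<le> C"
  defines "\<omega> \<equiv> \<lambda>t. exp (4 * integral {s..t} (\<lambda>\<tau>. C * norm (B \<tau>)))"
  shows "continuous_fredholm {s..T} volterra_kernel \<omega>
    (\<lambda>t \<tau>. if \<tau> \<in> {..t} then C * norm (B \<tau>) * \<omega> \<tau> else 0) (1 / 2)"
proof -
  have g: "(\<lambda>\<tau>. C * norm (B \<tau>)) integrable_on {s..T}"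
    using integrable_cmul[OF norm_B_integrable_on[OF s], of C] by simp
  have g0: "0 \<le> C * norm (B \<tau>)" for \<tau> using C by simp
  have gw: "(\<lambda>\<tau>. C * norm (B \<tau>) * \<omega> \<tau>) integrable_on {s..T}"
    "2 * integral {s..t} (\<lambda>\<tau>. C * norm (B \<tau>) * \<omega> \<tau>) \<le> \<omega> t" if "t \<in> {s..T}" for t
    unfolding \<omega>_def using volterra_weight[OF g g0 that] by blast+
  have int_eq: "{..t} \<inter> {s..T} = {s..t}" if "t \<in> {s..T}" for t using that by auto
  have k_cont: "continuous_on {s..T} (\<lambda>\<tau>. U t (min t \<tau>) w)" if "t \<in> {s..T}" for t w
    by (rule U_continuous) (use that s in \<open>auto intro!: continuous_intros\<close>)
  show ?thesis
  proof unfold_locales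
    fix t \<tau> assume t: "t \<in> {s..T}" and \<tau>: "\<tau> \<in> {s..T}"
    show "norm (volterra_kernel t \<tau>) * \<omega> \<tau> \<le> (if \<tau> \<in> {..t} then C * norm (B \<tau>) * \<omega> \<tau> else 0)"
    proof (cases "\<tau> \<le> t")
      case True
      have "norm (U t \<tau> o\<^sub>L B \<tau>) \<le> norm (U t \<tau>) * norm (B \<tau>)" by (rule norm_blinfun_compose)
      also have "\<dots> \<le> C * norm (B \<tau>)" by (rule mult_right_mono) (use C(2)[of \<tau> t] s t \<tau> True in auto)
      finally show ?thesis using True by (simp add: volterra_kernel_def \<omega>_def)
    qed (simp add: volterra_kernel_def)
  next
    fix t assume t: "t \<in> {s..T}"
    have "(\<lambda>\<tau>. C * norm (B \<tau>) * \<omega> \<tau>) integrable_on {s..t}"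
      by (rule integrable_subinterval_real[OF gw(1)[OF t]]) (use t in auto)
    then show "(\<lambda>\<tau>. if \<tau> \<in> {..t} then C * norm (B \<tau>) * \<omega> \<tau> else 0) integrable_on {s..T}"
      by (simp only: integrable_restrict_Int int_eq[OF t])
    show "integral {s..T} (\<lambda>\<tau>. if \<tau> \<in> {..t} then C * norm (B \<tau>) * \<omega> \<tau> else 0) \<le> 1 / 2 * \<omega> t"
      unfolding integral_restrict_Int int_eq[OF t] using gw(2)[OF t] by simp
    show "\<exists>\<delta>>0. \<exists>D. D integrable_on {s..T} \<and> (\<forall>t'\<in>{s..T}. \<bar>t' - t\<bar> < \<delta> \<longrightarrow>
        (\<forall>\<tau>\<in>{s..T}. (if \<tau> \<in> {..t'} then C * norm (B \<tau>) * \<omega> \<tau> else 0) \<le> D \<tau>))"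
      using gw(1)[OF t] C(1)
      by (intro exI[of _ 1] conjI exI[of _ "\<lambda>\<tau>. C * norm (B \<tau>) * \<omega> \<tau>"]) (auto simp: \<omega>_def)
  next
    fix t \<tau> w assume t: "t \<in> {s..T}" and \<tau>: "\<tau> \<in> {s..T}" "\<tau> \<noteq> t"
    show "((\<lambda>t'. volterra_kernel t' \<tau> w) \<longlongrightarrow> volterra_kernel t \<tau> w) (at t within {s..T})"
    proof (cases "\<tau> < t")
      case True
      have "continuous_on {s..T} (\<lambda>t'. U (max \<tau> t') \<tau> (B \<tau> w))"
        by (rule U_continuous) (use s \<tau> in \<open>auto intro!: continuous_intros\<close>)
      then have "((\<lambda>t'. U (max \<tau> t') \<tau> (B \<tau> w)) \<longlongrightarrow> U (max \<tau> t) \<tau> (B \<tau> w)) (at t within {s..T})"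
        using t by (simp add: continuous_on_def)
      moreover have "\<forall>\<^sub>F t' in at t within {s..T}. U (max \<tau> t') \<tau> (B \<tau> w) = volterra_kernel t' \<tau> w"
        using order_tendstoD(1)[OF tendsto_ident_at True]
        by eventually_elim (simp add: volterra_kernel_def)
      ultimately show ?thesis
        using True by (auto simp: volterra_kernel_def intro: Lim_transform_eventually)
    next
      case False
      then have "t < \<tau>" using \<tau> by simp
      have "\<forall>\<^sub>F t' in at t within {s..T}. volterra_kernel t' \<tau> w = volterra_kernel t \<tau> w"
        using order_tendstoD(2)[OF tendsto_ident_at \<open>t < \<tau>\<close>]
        by eventually_elim (use \<open>t < \<tau>\<close> in \<open>simp add: volterra_kernel_def\<close>)
      then show ?thesis by (rule tendsto_eventually)
    qed
  next
    fix u :: "real \<Rightarrow> 'a" and M t assume u: "continuous_on {s..T} u" and t: "t \<in> {s..T}"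
    \<comment> \<open>\<open>U t \<tau>\<close> is meaningful for \<open>\<tau> \<le> t\<close> only; replacing \<open>\<tau>\<close> by \<open>min t \<tau>\<close> gives a function continuous on the whole interval.\<close>
    have "bochner_on {s..T} (\<lambda>\<tau>. U t (min t \<tau>) (B \<tau> (u \<tau>)))"
      by (rule bochner_on_kernel[where C=C, OF k_cont[OF t] _ u s]) (use C(2) s t in auto)
    then have "bochner_on {s..T} (\<lambda>\<tau>. if \<tau> \<in> {..t} then U t (min t \<tau>) (B \<tau> (u \<tau>)) else 0)"
      by (rule bochner_on_restrict) simp
    then show "bochner_on {s..T} (\<lambda>\<tau>. volterra_kernel t \<tau> (u \<tau>))"
      by (rule bochner_on_cong) (auto simp: volterra_kernel_def min_def)
  qed (auto simp: \<omega>_def)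
qed

lemma mild_exists:
  assumes s: "0 \<le> s" and C: "0 < C" "\<And>s t. 0 \<le> s \<Longrightarrow> s \<le> t \<Longrightarrow> t \<le> T \<Longrightarrow> norm (U t s) \<le> C"
  shows "\<exists>u. mild s T x u \<and> (\<forall>t\<in>{s..T}.
    norm (u t) \<le> 2 * C * exp (4 * C * integral {s..T} (\<lambda>\<tau>. norm (B \<tau>))) * norm x)"
proof -
  let ?\<omega> = "\<lambda>t. exp (4 * integral {s..t} (\<lambda>\<tau>. C * norm (B \<tau>)))"
  interpret continuous_fredholm "{s..T}" volterra_kernel ?\<omega>
    "\<lambda>t \<tau>. if \<tau> \<in> {..t} then C * norm (B \<tau>) * ?\<omega> \<tau> else 0" "1 / 2"
    by (rule volterra_fredholm[OF s C])
  have nn: "0 \<le> integral {a..b} (\<lambda>\<tau>. norm (B \<tau>))" if "0 \<le> a" for a b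
    by (rule integral_nonneg[OF norm_B_integrable_on[OF that]]) simp
  have f_bd: "norm (U t s x) \<le> C * norm x * ?\<omega> t" if "t \<in> {s..T}" for t
  proof -
    have "norm (U t s x) \<le> norm (U t s) * norm x" by (rule norm_blinfun)
    also have "\<dots> \<le> C * norm x" by (rule mult_right_mono) (use C(2)[of s t] s that in auto)
    also have "\<dots> \<le> C * norm x * ?\<omega> t"
    proof -
      have "1 \<le> ?\<omega> t" using C(1) nn[OF s, of t] by simp
      from mult_left_mono[OF this, of "C * norm x"] show ?thesis using C(1) by simp
    qed
    finally show ?thesis .
  qed
  have f_cont: "continuous_on {s..T} (\<lambda>t. U t s x)"
    by (rule U_continuous) (use s in \<open>auto intro!: continuous_intros\<close>)
  obtain u where u: "\<And>t. t \<in> {s..T} \<Longrightarrow>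
      ((\<lambda>\<tau>. volterra_kernel t \<tau> (u \<tau>)) has_integral (u t - U t s x)) {s..T}"
    "\<And>t. t \<in> {s..T} \<Longrightarrow> norm (u t) \<le> C * norm x / (1 - 1 / 2) * ?\<omega> t"
    "continuous_on {s..T} (\<lambda>t. u t - U t s x)"
    using solution_exists[of "\<lambda>t. U t s x" "C * norm x", OF f_bd _ bochner_continuous[OF f_cont f_bd]] C(1)
    by auto
  have "continuous_on {s..T} (\<lambda>t. (u t - U t s x) + U t s x)"
    by (intro continuous_on_add u(3) f_cont)
  then have "mild s T x u"
    using u(1) unfolding mild_def by (auto simp: has_integral_volterra_kernel)
  moreover have "norm (u t) \<le> 2 * C * exp (4 * C * integral {s..T} (\<lambda>\<tau>. norm (B \<tau>))) * norm x"
    if t: "t \<in> {s..T}" for t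
  proof -
    have "integral {s..t} (\<lambda>\<tau>. norm (B \<tau>)) \<le> integral {s..T} (\<lambda>\<tau>. norm (B \<tau>))"
      by (rule integral_subset_le) (use t norm_B_integrable_on[OF s] in auto)
    then have "?\<omega> t \<le> exp (4 * C * integral {s..T} (\<lambda>\<tau>. norm (B \<tau>)))"
      using C(1) by simp
    then have "2 * C * norm x * ?\<omega> t \<le> 2 * C * norm x * exp (4 * C * integral {s..T} (\<lambda>\<tau>. norm (B \<tau>)))"
      using C(1) by (intro mult_left_mono) auto
    then show ?thesis using u(2)[OF t] by (simp add: mult_ac)
  qed
  ultimately show ?thesis by blast
qed

lemma mild_unique:
  assumes s: "0 \<le> s" and u: "mild s T x u" and v: "mild s T x v" and t: "t \<in> {s..T}"
  shows "u t = v t"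
proof -
  obtain C where C: "0 < C" "\<And>s t. 0 \<le> s \<Longrightarrow> s \<le> t \<Longrightarrow> t \<le> T \<Longrightarrow> norm (U t s) \<le> C"
    using U_locally_bounded[of T] by blast
  let ?\<omega> = "\<lambda>t. exp (4 * integral {s..t} (\<lambda>\<tau>. C * norm (B \<tau>)))"
  interpret continuous_fredholm "{s..T}" volterra_kernel ?\<omega>
    "\<lambda>t \<tau>. if \<tau> \<in> {..t} then C * norm (B \<tau>) * ?\<omega> \<tau> else 0" "1 / 2"
    by (rule volterra_fredholm[OF s C])
  have "continuous_on {s..T} (\<lambda>t. u t - v t)"
    using u v by (auto simp: mild_def intro: continuous_on_diff)
  then have "bounded ((\<lambda>t. u t - v t) ` {s..T})"
    by (intro compact_imp_bounded compact_continuous_image) auto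
  then obtain c where "\<forall>y\<in>(\<lambda>t. u t - v t) ` {s..T}. norm y \<le> c"
    unfolding bounded_iff by blast
  then have c: "norm (u t - v t) \<le> c" if "t \<in> {s..T}" for t using that by blast
  have "u t - v t = 0"
  proof (rule homogeneous_solution_zero[of "\<lambda>t. u t - v t" c])
    fix t assume t: "t \<in> {s..T}"
    have "((\<lambda>\<tau>. U t \<tau> (B \<tau> (u \<tau>)) - U t \<tau> (B \<tau> (v \<tau>))) has_integral (u t - U t s x) - (v t - U t s x)) {s..t}"
      using u v t by (intro has_integral_diff) (auto simp: mild_def)
    then show "((\<lambda>\<tau>. volterra_kernel t \<tau> (u \<tau> - v \<tau>)) has_integral (u t - v t)) {s..T}"
      by (subst has_integral_volterra_kernel[OF t]) (simp add: blinfun.diff_right)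
    have "0 \<le> integral {s..t} (\<lambda>\<tau>. C * norm (B \<tau>))"
      using integrable_cmul[OF norm_B_integrable_on[OF s], of C t] C(1) by (intro integral_nonneg) auto
    then have "1 \<le> ?\<omega> t" by simp
    moreover have "0 \<le> c" using order_trans[OF norm_ge_zero c[OF t]] .
    ultimately have "c \<le> c * ?\<omega> t" using mult_left_mono[of 1 "?\<omega> t" c] by simp
    then show "norm (u t - v t) \<le> c * ?\<omega> t" using c[OF t] by simp
  qed (rule t)
  then show ?thesis by simp
qed

lemma mild_restrict: "mild s T x u \<Longrightarrow> T' \<le> T \<Longrightarrow> mild s T' x u"
  unfolding mild_def by (auto intro: continuous_on_subset)

lemma mild_cong: "mild s T x u \<Longrightarrow> (\<And>t. t \<in> {s..T} \<Longrightarrow> u t = v t) \<Longrightarrow> mild s T x v"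
  unfolding mild_def
proof (elim conjE, intro conjI ballI)
  fix t assume *: "\<And>t. t \<in> {s..T} \<Longrightarrow> u t = v t"
    and "\<forall>t\<in>{s..T}. ((\<lambda>\<tau>. U t \<tau> (B \<tau> (u \<tau>))) has_integral (u t - U t s x)) {s..t}" "t \<in> {s..T}"
  then have i: "((\<lambda>\<tau>. U t \<tau> (B \<tau> (u \<tau>))) has_integral (v t - U t s x)) {s..t}" by auto
  show "((\<lambda>\<tau>. U t \<tau> (B \<tau> (v \<tau>))) has_integral (v t - U t s x)) {s..t}"
    by (rule has_integral_eq[OF _ i]) (use * \<open>t \<in> {s..T}\<close> in auto)
qed (erule continuous_on_eq, simp)

lemma mild_add:
  assumes "mild s T x u" "mild s T y v"
  shows "mild s T (x + y) (\<lambda>t. u t + v t)"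
  unfolding mild_def
proof (intro conjI ballI)
  fix t assume t: "t \<in> {s..T}"
  have "((\<lambda>\<tau>. U t \<tau> (B \<tau> (u \<tau>)) + U t \<tau> (B \<tau> (v \<tau>))) has_integral (u t - U t s x) + (v t - U t s y)) {s..t}"
    using assms t by (intro has_integral_add) (auto simp: mild_def)
  then show "((\<lambda>\<tau>. U t \<tau> (B \<tau> (u \<tau> + v \<tau>))) has_integral (u t + v t - U t s (x + y))) {s..t}"
    by (simp add: blinfun.add_right algebra_simps)
qed (use assms in \<open>auto simp: mild_def intro: continuous_on_add\<close>)

lemma mild_scaleR:
  assumes "mild s T x u"
  shows "mild s T (c *\<^sub>R x) (\<lambda>t. c *\<^sub>R u t)"
  unfolding mild_def
proof (intro conjI ballI)
  fix t assume t: "t \<in> {s..T}"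
  have "((\<lambda>\<tau>. c *\<^sub>R U t \<tau> (B \<tau> (u \<tau>))) has_integral c *\<^sub>R (u t - U t s x)) {s..t}"
    using assms t by (intro has_integral_cmul) (auto simp: mild_def)
  then show "((\<lambda>\<tau>. U t \<tau> (B \<tau> (c *\<^sub>R u \<tau>))) has_integral (c *\<^sub>R u t - U t s (c *\<^sub>R x))) {s..t}"
    by (simp add: blinfun.scaleR_right scaleR_diff_right)
qed (use assms in \<open>auto simp: mild_def intro: continuous_on_scaleR\<close>)

text \<open>
  By uniqueness the mild solutions on different intervals agree where both are defined; choosing the interval \<open>[s,t]\<close>
  for the value at \<open>t\<close> yields a single function for all times.
\<close>

definition solution :: "real \<Rightarrow> 'a \<Rightarrow> real \<Rightarrow> 'a" where
  "solution s x t = (SOME u. mild s t x u) t"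

lemma solution_eq:
  assumes "0 \<le> s" "mild s T x u" "t \<in> {s..T}"
  shows "solution s x t = u t"
proof -
  have m: "mild s t x u" using assms mild_restrict by auto
  then have "mild s t x (SOME u. mild s t x u)" by (rule someI[of "mild s t x"])
  from mild_unique[OF assms(1) this m] show ?thesis using assms by (simp add: solution_def)
qed

lemma mild_solution:
  assumes "0 \<le> s"
  shows "mild s T x (solution s x)"
proof -
  obtain C where C: "0 < C" "\<And>s t. 0 \<le> s \<Longrightarrow> s \<le> t \<Longrightarrow> t \<le> T \<Longrightarrow> norm (U t s) \<le> C"
    using U_locally_bounded[of T] by blast
  obtain u where "mild s T x u" using mild_exists[OF assms C] by blast
  then show ?thesis by (rule mild_cong) (simp add: solution_eq[OF assms \<open>mild s T x u\<close>])
qed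

definition V :: "real \<Rightarrow> real \<Rightarrow> 'a \<Rightarrow>\<^sub>L 'a" where
  "V t s = Blinfun (\<lambda>x. solution s x t)"

lemma solution_bound:
  "\<exists>M. \<forall>s t x. 0 \<le> s \<and> s \<le> t \<and> t \<le> T \<longrightarrow> norm (solution s x t) \<le> M * norm x"
proof -
  obtain C where C: "0 < C" "\<And>s t. 0 \<le> s \<Longrightarrow> s \<le> t \<Longrightarrow> t \<le> T \<Longrightarrow> norm (U t s) \<le> C"
    using U_locally_bounded[of T] by blast
  have "norm (solution s x t) \<le> 2 * C * exp (4 * C * integral {0..T} (\<lambda>\<tau>. norm (B \<tau>))) * norm x"
    if st: "0 \<le> s" "s \<le> t" "t \<le> T" for s t x
  proof -
    obtain u where u: "mild s T x u" and ub:
      "\<forall>t\<in>{s..T}. norm (u t) \<le> 2 * C * exp (4 * C * integral {s..T} (\<lambda>\<tau>. norm (B \<tau>))) * norm x"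
      using mild_exists[OF st(1) C] by blast
    have "integral {s..T} (\<lambda>\<tau>. norm (B \<tau>)) \<le> integral {0..T} (\<lambda>\<tau>. norm (B \<tau>))"
      by (rule integral_subset_le) (use st norm_B_integrable_on in auto)
    then have "2 * C * exp (4 * C * integral {s..T} (\<lambda>\<tau>. norm (B \<tau>))) * norm x
      \<le> 2 * C * exp (4 * C * integral {0..T} (\<lambda>\<tau>. norm (B \<tau>))) * norm x"
      using C(1) by (intro mult_right_mono mult_left_mono) auto
    then show ?thesis using bspec[OF ub, of t] solution_eq[OF st(1) u, of t] st by simp
  qed
  then show ?thesis by blast
qed

lemma V_apply:
  assumes st: "0 \<le> s" "s \<le> t"
  shows "V t s x = solution s x t"
proof -
  obtain M where M: "\<And>x. norm (solution s x t) \<le> M * norm x"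
    using solution_bound[of t] st by blast
  have "bounded_linear (\<lambda>x. solution s x t)"
  proof (rule bounded_linear_intro)
    show "solution s (x + y) t = solution s x t + solution s y t" for x y
      by (rule solution_eq[OF st(1) mild_add[OF mild_solution mild_solution, of _ t]]) (use st in auto)
    show "solution s (c *\<^sub>R x) t = c *\<^sub>R solution s x t" for c x
      by (rule solution_eq[OF st(1) mild_scaleR[OF mild_solution, of _ t]]) (use st in auto)
    show "norm (solution s x t) \<le> norm x * M" for x using M[of x] by (simp add: mult.commute)
  qed
  then show ?thesis by (simp add: V_def bounded_linear_Blinfun_apply)
qed

lemma mild_V: "0 \<le> s \<Longrightarrow> mild s T x (\<lambda>t. V t s x)"
  by (rule mild_cong[OF mild_solution]) (auto simp: V_apply)

lemma V_eq:
  assumes "0 \<le> s" "mild s T x u" "t \<in> {s..T}"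
  shows "V t s x = u t"
  using assms solution_eq[OF assms] by (simp add: V_apply)

lemma V_has_integral:
  assumes "0 \<le> s" "s \<le> t"
  shows "((\<lambda>\<tau>. U t \<tau> (B \<tau> (V \<tau> s x))) has_integral (V t s x - U t s x)) {s..t}"
  using mild_V[OF assms(1), of t x] assms by (auto simp: mild_def)

lemma V_orbit_continuous: "0 \<le> s \<Longrightarrow> continuous_on {s..T} (\<lambda>t. V t s x)"
  using mild_V by (auto simp: mild_def)

lemma V_bounded: "\<exists>M. \<forall>s t. 0 \<le> s \<and> s \<le> t \<and> t \<le> T \<longrightarrow> norm (V t s) \<le> M"
proof -
  obtain M where M: "\<And>s t x. 0 \<le> s \<and> s \<le> t \<and> t \<le> T \<Longrightarrow> norm (solution s x t) \<le> M * norm x"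
    using solution_bound[of T] by blast
  have "norm (V t s) \<le> \<bar>M\<bar>" if "0 \<le> s \<and> s \<le> t \<and> t \<le> T" for s t
  proof (rule norm_blinfun_bound)
    fix x
    have "norm (V t s x) \<le> M * norm x" using M[OF that] that by (simp add: V_apply)
    also have "\<dots> \<le> \<bar>M\<bar> * norm x" by (rule mult_right_mono) auto
    finally show "norm (V t s x) \<le> \<bar>M\<bar> * norm x" .
  qed simp
  then show ?thesis by blast
qed

lemma V_id:
  assumes "0 \<le> t"
  shows "V t t = id_blinfun"
proof (rule blinfun_eqI)
  fix x
  have "((\<lambda>\<tau>. U t \<tau> (B \<tau> (V \<tau> t x))) has_integral 0) {t..t}" by (simp add: has_integral_refl)
  from has_integral_unique[OF V_has_integral[OF assms order_refl] this]
  show "V t t x = id_blinfun x" using U_id[OF assms] by simp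
qed

text \<open>
  Restarting a mild solution at a later time \<open>a\<close>: the part of the integral before \<open>a\<close>, transported by \<open>U t a\<close>, is absorbed
  into the new initial value.
\<close>

lemma mild_between:
  assumes s: "0 \<le> s" "s \<le> a" and c: "continuous_on {a..T} u"
    and i: "\<And>t. t \<in> {a..T} \<Longrightarrow> ((\<lambda>\<tau>. U t \<tau> (B \<tau> (u \<tau>))) has_integral (u t - U t s x)) {s..t}"
    and a: "a \<le> T"
  shows "mild a T (u a) u"
  unfolding mild_def
proof (intro conjI ballI c)
  fix t assume t: "t \<in> {a..T}"
  let ?F = "\<lambda>t \<tau>. U t \<tau> (B \<tau> (u \<tau>))"
  have "((\<lambda>\<tau>. U t a (?F a \<tau>)) has_integral U t a (u a - U a s x)) {s..a}"
    using has_integral_linear[OF i[of a] blinfun.bounded_linear_right[of "U t a"]] a by (simp add: o_def)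
  then have 1: "(?F t has_integral U t a (u a - U a s x)) {s..a}"
    by (rule has_integral_eq[rotated]) (use s t U_comp in auto)
  have 2: "(?F t) integrable_on {s..t}" using i[OF t] by blast
  then have 3: "(?F t) integrable_on {a..t}"
    by (rule integrable_subinterval_real) (use s in auto)
  have "integral {s..a} (?F t) + integral {a..t} (?F t) = integral {s..t} (?F t)"
    by (rule Henstock_Kurzweil_Integration.integral_combine[OF _ _ 2]) (use s t in auto)
  then have "integral {a..t} (?F t) = u t - U t a (u a)"
    using integral_unique[OF 1] integral_unique[OF i[OF t]] U_comp[of s a t x] s t
    by (simp add: blinfun.diff_right algebra_simps)
  then show "(?F t has_integral u t - U t a (u a)) {a..t}"
    using integrable_integral[OF 3] by simp
qed

lemma V_comp:
  assumes "0 \<le> s" "s \<le> r" "r \<le> t"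
  shows "V t r (V r s x) = V t s x"
proof -
  have "mild r t (V r s x) (\<lambda>t. V t s x)"
  proof (rule mild_between[OF assms(1,2) _ _ assms(3)])
    show "continuous_on {r..t} (\<lambda>t. V t s x)"
      by (rule continuous_on_subset[OF V_orbit_continuous[OF assms(1), of t]]) (use assms in auto)
    show "((\<lambda>\<tau>. U t' \<tau> (B \<tau> (V \<tau> s x))) has_integral (V t' s x - U t' s x)) {s..t'}"
      if "t' \<in> {r..t}" for t'
      by (rule V_has_integral) (use assms that in auto)
  qed
  from V_eq[OF _ this, of t] show ?thesis using assms by simp
qed

text \<open>
  By the integral equation \<open>V t s x - U t s x\<close> is at most a constant times the integral of \<open>norm B\<close> over \<open>[s,t]\<close>.
\<close>

lemma V_near_diagonal:
  assumes r: "0 \<le> r" and e: "0 < e"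
  shows "\<exists>\<delta>>0. \<forall>s t. 0 \<le> s \<and> s \<le> t \<and> \<bar>s - r\<bar> < \<delta> \<and> \<bar>t - r\<bar> < \<delta> \<longrightarrow> norm (V t s x - x) < e"
proof -
  obtain C where C: "0 < C" "\<And>s t. 0 \<le> s \<Longrightarrow> s \<le> t \<Longrightarrow> t \<le> r + 1 \<Longrightarrow> norm (U t s) \<le> C"
    using U_locally_bounded[of "r + 1"] by blast
  obtain M where M: "\<And>s t. 0 \<le> s \<Longrightarrow> s \<le> t \<Longrightarrow> t \<le> r + 1 \<Longrightarrow> norm (V t s) \<le> M"
    using V_bounded[of "r + 1"] by blast
  have M0: "0 \<le> M" using M[of r r] r order_trans[OF norm_ge_zero] by force
  let ?H = "\<lambda>t. integral {0..t} (\<lambda>\<tau>. norm (B \<tau>))"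
  define \<eta> where "\<eta> = e / (4 * (C * M * norm x + 1))"
  have D0: "0 \<le> C * M * norm x" using C(1) M0 by simp
  have \<eta>: "0 < \<eta>" "C * M * norm x * (2 * \<eta>) < e / 2"
    using e D0 by (auto simp: \<eta>_def field_simps intro: add_nonneg_pos)
  have Hc: "continuous_on {0..r + 1} ?H" by (rule indefinite_integral_continuous_1[OF norm_B_integrable])
  have "r \<in> {0..r + 1}" using r by simp
  then obtain \<delta>1 where \<delta>1: "\<delta>1 > 0"
    "\<And>t. t \<in> {0..r + 1} \<Longrightarrow> dist t r < \<delta>1 \<Longrightarrow> dist (?H t) (?H r) < \<eta>"
    using Hc[unfolded continuous_on_iff, rule_format, OF _ \<eta>(1)] by blast
  have Ud: "continuous_on {p. 0 \<le> snd p \<and> snd p \<le> fst p} (\<lambda>p. U (fst p) (snd p) x)"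
    by (rule U_continuous) (auto intro!: continuous_intros)
  have "(r, r) \<in> {p. 0 \<le> snd p \<and> snd p \<le> fst p}" "e / 2 > 0" using r e by auto
  then obtain \<delta>2 where \<delta>2: "\<delta>2 > 0"
    "\<And>p. p \<in> {p. 0 \<le> snd p \<and> snd p \<le> fst p} \<Longrightarrow> dist p (r, r) < \<delta>2 \<Longrightarrow>
        dist (U (fst p) (snd p) x) (U (fst (r, r)) (snd (r, r)) x) < e / 2"
    using Ud[unfolded continuous_on_iff, rule_format] by blast
  define \<delta> where "\<delta> = min (min \<delta>1 (\<delta>2 / 2)) 1"
  have \<delta>: "\<delta> > 0" "\<delta> \<le> \<delta>1" "\<delta> \<le> \<delta>2 / 2" "\<delta> \<le> 1" using \<delta>1(1) \<delta>2(1) by (auto simp: \<delta>_def min_def)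
  have "norm (V t s x - x) < e" if st: "0 \<le> s" "s \<le> t" "\<bar>s - r\<bar> < \<delta>" "\<bar>t - r\<bar> < \<delta>" for s t
  proof -
    have tr: "t \<le> r + 1" "s \<le> r + 1" using st \<delta> by auto
    have "dist (t, s) (r, r) \<le> dist t r + dist s r"
      unfolding dist_Pair_Pair by (rule sqrt_sum_squares_le_sum) auto
    also have "\<dots> < \<delta>2" using st \<delta> by (simp add: dist_real_def)
    finally have 1: "norm (U t s x - x) < e / 2"
      using \<delta>2(2)[of "(t, s)"] st U_id[OF r] by (simp add: dist_norm)
    have nB: "(\<lambda>\<tau>. norm (B \<tau>)) integrable_on {s..t}" by (rule norm_B_integrable_on[OF st(1)])
    have "norm (integral {s..t} (\<lambda>\<tau>. U t \<tau> (B \<tau> (V \<tau> s x)))) \<le>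
        integral {s..t} (\<lambda>\<tau>. C * M * norm x * norm (B \<tau>))"
    proof (rule integral_norm_bound_integral)
      show "(\<lambda>\<tau>. U t \<tau> (B \<tau> (V \<tau> s x))) integrable_on {s..t}" using V_has_integral[OF st(1,2)] by blast
      show "(\<lambda>\<tau>. C * M * norm x * norm (B \<tau>)) integrable_on {s..t}"
        using integrable_cmul[OF nB, of "C * M * norm x"] by simp
      fix \<tau> assume \<tau>: "\<tau> \<in> {s..t}"
      have "norm (U t \<tau> (B \<tau> (V \<tau> s x))) \<le> norm (U t \<tau>) * norm (B \<tau> (V \<tau> s x))" by (rule norm_blinfun)
      also have "\<dots> \<le> norm (U t \<tau>) * (norm (B \<tau>) * norm (V \<tau> s x))"
        by (rule mult_left_mono[OF norm_blinfun norm_ge_zero])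
      also have "\<dots> \<le> norm (U t \<tau>) * (norm (B \<tau>) * (norm (V \<tau> s) * norm x))"
        by (intro mult_left_mono norm_blinfun norm_ge_zero)
      also have "\<dots> \<le> C * (norm (B \<tau>) * (M * norm x))"
        by (intro mult_mono mult_nonneg_nonneg order_refl C M) (use \<tau> st tr C(1) M0 in auto)
      finally show "norm (U t \<tau> (B \<tau> (V \<tau> s x))) \<le> C * M * norm x * norm (B \<tau>)" by (simp add: mult_ac)
    qed
    also have "\<dots> = C * M * norm x * (?H t - ?H s)"
      using Henstock_Kurzweil_Integration.integral_combine[OF st(1,2) norm_B_integrable] by (simp add: eq_diff_eq)
    also have "\<dots> \<le> C * M * norm x * (2 * \<eta>)"
    proof (rule mult_left_mono[OF _ D0])
      have "\<bar>?H t - ?H r\<bar> < \<eta>" "\<bar>?H s - ?H r\<bar> < \<eta>"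
        using \<delta>1(2)[of t] \<delta>1(2)[of s] st tr \<delta> by (auto simp: dist_real_def)
      then show "?H t - ?H s \<le> 2 * \<eta>" by linarith
    qed
    finally have "norm (V t s x - U t s x) < e / 2"
      using integral_unique[OF V_has_integral[OF st(1,2), of x]] \<eta>(2) by simp
    then show ?thesis
      using 1 norm_triangle_ineq[of "V t s x - U t s x" "U t s x - x"] by simp
  qed
  then show ?thesis using \<delta>(1) by blast
qed

theorem perturbed_evolution_family_V: "perturbed_evolution_family {0..} U B V"
  unfolding perturbed_evolution_family_def evolution_family_def
proof (intro conjI ballI allI impI)
  show "continuous_on {(t, s). t \<in> {0..} \<and> s \<in> {0..} \<and> s \<le> t} (\<lambda>(t, s). V t s x)" for x
    by (rule evolution_family_continuous_on[OF V_id V_comp V_bounded V_orbit_continuous V_near_diagonal])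
  show "V t s = V t r o\<^sub>L V r s" if "t \<in> {0..}" "r \<in> {0..}" "s \<in> {0..}" "s \<le> r \<and> r \<le> t" for t r s
    by (rule blinfun_eqI) (use that V_comp[of s r t] in simp)
  show "V t t = id_blinfun" if "t \<in> {0..}" for t using that by (simp add: V_id)
  show "((\<lambda>\<tau>. U t \<tau> (B \<tau> (V \<tau> s x))) has_integral (V t s x - U t s x)) {s..t}"
    if "s \<in> {0..}" "s \<le> t" for t s x
    using V_has_integral that by simp
qed

theorem perturbed_evolution_family_unique:
  assumes W: "perturbed_evolution_family {0..} U B W" and st: "0 \<le> s" "s \<le> t"
  shows "W t s = V t s"
proof (rule blinfun_eqI)
  fix x
  have "continuous_on {s..t} (\<lambda>r. W r s x)"
    using W st unfolding perturbed_evolution_family_def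
    by (intro evolution_family_continuous_compose) (auto intro!: continuous_intros)
  moreover have "((\<lambda>\<tau>. U r \<tau> (B \<tau> (W \<tau> s x))) has_integral (W r s x - U r s x)) {s..r}"
    if "r \<in> {s..t}" for r
    using W[unfolded perturbed_evolution_family_def, THEN conjunct2, rule_format, of s r x] st that
    by simp
  ultimately have "mild s t x (\<lambda>r. W r s x)"
    by (simp add: mild_def)
  from V_eq[OF st(1) this, of t] show "W t s x = V t s x" using st by simp
qed

end

section \<open>The Green kernel of the dichotomy\<close>

locale dichotomy_perturbation = perturbation U B
  for U :: "real \<Rightarrow> real \<Rightarrow> 'a::banach \<Rightarrow>\<^sub>L 'a" and B +
  fixes P :: "real \<Rightarrow> 'a \<Rightarrow>\<^sub>L 'a" and \<alpha> \<beta> K \<epsilon> \<theta> :: real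
  assumes P_idem: "\<And>t x. 0 \<le> t \<Longrightarrow> P t (P t x) = P t x"
    and P_U: "\<And>s t x. 0 \<le> s \<Longrightarrow> s \<le> t \<Longrightarrow> U t s (P s x) = P t (U t s x)"
    and U_bij: "\<And>s t. 0 \<le> s \<Longrightarrow> s \<le> t \<Longrightarrow>
        bij_betw (blinfun_apply (U t s)) (null_space (P s)) (null_space (P t))"
    and stable: "\<And>s t. 0 \<le> s \<Longrightarrow> s \<le> t \<Longrightarrow>
        norm (U t s o\<^sub>L P s) \<le> K * exp (- \<alpha> * (t - s) + \<epsilon> * s)"
    and unstable: "\<And>s t x. 0 \<le> t \<Longrightarrow> t \<le> s \<Longrightarrow>
        norm (inv_into (null_space (P t)) (blinfun_apply (U s t)) (x - P s x))
          \<le> K * exp (- \<alpha> * (s - t) + \<epsilon> * s) * norm x"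
    and constants: "0 < K" "0 < \<beta>" "0 \<le> \<epsilon>" "\<beta> \<le> \<alpha>" "0 \<le> \<theta>" "K * \<theta> < 1"
    and weighted_integrable: "\<And>t. 0 \<le> t \<Longrightarrow>
        (\<lambda>\<tau>. exp (- (\<alpha> - \<beta>) * \<bar>t - \<tau>\<bar>) * (norm (B \<tau>) * exp (\<epsilon> * \<bar>\<tau>\<bar>))) integrable_on {0..}"
    and weighted_integral_le: "\<And>t. 0 \<le> t \<Longrightarrow>
        integral {0..} (\<lambda>\<tau>. exp (- (\<alpha> - \<beta>) * \<bar>t - \<tau>\<bar>) * (norm (B \<tau>) * exp (\<epsilon> * \<bar>\<tau>\<bar>))) \<le> \<theta>"
begin

text \<open>
  The backward operator \<open>U(t,\<tau>) Q(\<tau>)\<close>, for \<open>t \<le> \<tau>\<close>.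
\<close>

definition R :: "real \<Rightarrow> real \<Rightarrow> 'a \<Rightarrow>\<^sub>L 'a" where
  "R t \<tau> = Blinfun (\<lambda>x. inv_into (null_space (P t)) (blinfun_apply (U \<tau> t)) (x - P \<tau> x))"

lemma P_complement: "0 \<le> t \<Longrightarrow> P t (x - P t x) = 0"
  by (simp add: blinfun.diff_right P_idem)

lemma backward_exists:
  assumes "0 \<le> t" "t \<le> \<tau>"
  shows "P t (inv_into (null_space (P t)) (U \<tau> t) (x - P \<tau> x)) = 0"
    "U \<tau> t (inv_into (null_space (P t)) (U \<tau> t) (x - P \<tau> x)) = x - P \<tau> x"
proof -
  have mem: "x - P \<tau> x \<in> U \<tau> t ` null_space (P t)"
    using bij_betw_imp_surj_on[OF U_bij[OF assms]] P_complement[of \<tau> x] assms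
    by (simp add: null_space_def)
  show "P t (inv_into (null_space (P t)) (U \<tau> t) (x - P \<tau> x)) = 0"
    using inv_into_into[OF mem] by (simp add: null_space_def)
  show "U \<tau> t (inv_into (null_space (P t)) (U \<tau> t) (x - P \<tau> x)) = x - P \<tau> x"
    by (rule f_inv_into_f[OF mem])
qed

lemma backward_unique:
  assumes "0 \<le> t" "t \<le> \<tau>" "P t y = 0" "P t y' = 0" "U \<tau> t y = U \<tau> t y'"
  shows "y = y'"
  using bij_betw_imp_inj_on[OF U_bij[OF assms(1,2)]] assms(3-5)
  by (auto simp: null_space_def dest: inj_onD)

lemma R_apply:
  assumes t: "0 \<le> t" "t \<le> \<tau>"
  shows "R t \<tau> x = inv_into (null_space (P t)) (blinfun_apply (U \<tau> t)) (x - P \<tau> x)" (is "_ = ?r x")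
proof -
  note ex = backward_exists[OF t]
  have "bounded_linear ?r"
  proof (rule bounded_linear_intro)
    show "?r (x + y) = ?r x + ?r y" for x y
    proof (rule backward_unique[OF t ex(1)])
      show "P t (?r x + ?r y) = 0" by (simp add: ex blinfun.add_right)
      show "U \<tau> t (?r (x + y)) = U \<tau> t (?r x + ?r y)"
        unfolding blinfun.add_right[of "U \<tau> t"] ex(2) by (simp add: blinfun.add_right)
    qed
    show "?r (c *\<^sub>R x) = c *\<^sub>R ?r x" for c x
    proof (rule backward_unique[OF t ex(1)])
      show "P t (c *\<^sub>R ?r x) = 0" by (simp add: ex blinfun.scaleR_right)
      show "U \<tau> t (?r (c *\<^sub>R x)) = U \<tau> t (c *\<^sub>R ?r x)"
        unfolding blinfun.scaleR_right[of "U \<tau> t"] ex(2)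
        by (simp add: blinfun.scaleR_right scaleR_diff_right)
    qed
    show "norm (?r x) \<le> norm x * (K * exp (- \<alpha> * (\<tau> - t) + \<epsilon> * \<tau>))" for x
      using unstable[OF t, of x] by (simp add: mult.commute)
  qed
  then show ?thesis by (simp add: R_def bounded_linear_Blinfun_apply)
qed

lemma P_R: "0 \<le> t \<Longrightarrow> t \<le> \<tau> \<Longrightarrow> P t (R t \<tau> x) = 0"
  by (simp add: R_apply backward_exists)

lemma U_R: "0 \<le> t \<Longrightarrow> t \<le> \<tau> \<Longrightarrow> U \<tau> t (R t \<tau> x) = x - P \<tau> x"
  by (simp add: R_apply backward_exists)

lemma R_eqI: "0 \<le> t \<Longrightarrow> t \<le> \<tau> \<Longrightarrow> P t y = 0 \<Longrightarrow> U \<tau> t y = x - P \<tau> x \<Longrightarrow> R t \<tau> x = y"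
  by (rule backward_unique[of t \<tau>]) (simp_all add: P_R U_R)

lemma R_refl: "0 \<le> t \<Longrightarrow> R t t x = x - P t x"
  by (rule R_eqI) (simp_all add: P_complement U_id)

text \<open>
  Backward operators are invariant under the flow: a point of \<open>N(P t)\<close> is determined by its image under \<open>U \<tau> t\<close>.
\<close>

lemma U_R_flow:
  assumes "0 \<le> t" "t \<le> r" "r \<le> \<tau>"
  shows "U r t (R t \<tau> x) = R r \<tau> x"
proof (rule R_eqI[symmetric])
  show "P r (U r t (R t \<tau> x)) = 0" using assms P_U[of t r "R t \<tau> x"] by (simp add: P_R)
  show "U \<tau> r (U r t (R t \<tau> x)) = x - P \<tau> x" using assms by (simp add: U_comp U_R)
qed (use assms in auto)

lemma R_U_flow:
  assumes "0 \<le> t" "t \<le> r" "r \<le> \<tau>"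
  shows "R t \<tau> (U \<tau> r x) = R t r x"
proof (rule R_eqI)
  have "U \<tau> t (R t r x) = U \<tau> r (U r t (R t r x))" using assms by (simp add: U_comp)
  also have "\<dots> = U \<tau> r x - P \<tau> (U \<tau> r x)"
    using assms by (simp add: U_R blinfun.diff_right P_U)
  finally show "U \<tau> t (R t r x) = U \<tau> r x - P \<tau> (U \<tau> r x)" .
qed (use assms in \<open>auto simp: P_R\<close>)

lemma norm_R:
  assumes "0 \<le> t" "t \<le> \<tau>"
  shows "norm (R t \<tau>) \<le> K * exp (- \<alpha> * (\<tau> - t) + \<epsilon> * \<tau>)"
  by (rule norm_blinfun_bound) (use constants(1) unstable[OF assms] R_apply[OF assms] in auto)

definition G :: "real \<Rightarrow> real \<Rightarrow> 'a \<Rightarrow>\<^sub>L 'a" where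
  "G t \<tau> = (if \<tau> \<le> t then U t \<tau> o\<^sub>L P \<tau> else - R t \<tau>)"

lemma G_stable: "\<tau> \<le> t \<Longrightarrow> G t \<tau> x = U t \<tau> (P \<tau> x)"
  by (simp add: G_def)

lemma G_unstable: "t < \<tau> \<Longrightarrow> G t \<tau> x = - R t \<tau> x"
  by (simp add: G_def blinfun.minus_left)

lemma norm_G:
  assumes "0 \<le> t" "0 \<le> \<tau>"
  shows "norm (G t \<tau>) \<le> K * exp (- \<alpha> * \<bar>t - \<tau>\<bar> + \<epsilon> * \<tau>)"
  using stable[of \<tau> t] norm_R[of t \<tau>] assms by (auto simp: G_def)

text \<open>
  Continuity of a backward orbit is continuity of the forward orbit starting at its value at time 0.
\<close>

lemma R_continuous_left: "0 \<le> \<tau> \<Longrightarrow> S \<subseteq> {0..\<tau>} \<Longrightarrow> continuous_on S (\<lambda>t. R t \<tau> x)"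
proof (rule continuous_on_eq)
  assume "0 \<le> \<tau>" "S \<subseteq> {0..\<tau>}"
  then show "continuous_on S (\<lambda>t. U t 0 (R 0 \<tau> x))"
    by (intro U_continuous) (auto intro!: continuous_intros)
  show "U t 0 (R 0 \<tau> x) = R t \<tau> x" if "t \<in> S" for t
    using U_R_flow[of 0 t \<tau> x] that \<open>S \<subseteq> {0..\<tau>}\<close> by auto
qed

text \<open>
  Dependence on the second argument reduces, by \<open>R_U_flow\<close>, to the displacement of \<open>x\<close> under \<open>U\<close> between the two times:
  the later backward operator applied to it, or the earlier one, gives the difference.
\<close>

lemma R_continuous_right:
  assumes t: "0 \<le> t"
  shows "continuous_on {t..b} (\<lambda>\<tau>. R t \<tau> x)"
  unfolding continuous_on_def
proof
  fix \<tau>0 assume \<tau>0: "\<tau>0 \<in> {t..b}"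
  have M: "norm (R t \<tau>) \<le> K * exp (\<epsilon> * b)" if "\<tau> \<in> {t..b}" for \<tau>
  proof -
    have "norm (R t \<tau>) \<le> K * exp (- \<alpha> * (\<tau> - t) + \<epsilon> * \<tau>)" by (rule norm_R) (use t that in auto)
    also have "\<dots> \<le> K * exp (\<epsilon> * b)"
    proof -
      have "\<epsilon> * \<tau> \<le> \<epsilon> * b" using constants that by (simp add: mult_left_mono)
      moreover have "0 \<le> \<alpha> * (\<tau> - t)" using constants that by simp
      ultimately show ?thesis using constants(1) by simp
    qed
    finally show ?thesis .
  qed
  have "norm (R t \<tau> x - R t \<tau>0 x) \<le> K * exp (\<epsilon> * b) * norm (U (max \<tau> \<tau>0) (min \<tau> \<tau>0) x - x)"
    if \<tau>: "\<tau> \<in> {t..b}" for \<tau>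
  proof (cases "\<tau>0 \<le> \<tau>")
    case True
    have "norm (R t \<tau> x - R t \<tau>0 x) = norm (R t \<tau> (x - U \<tau> \<tau>0 x))"
      using True \<tau>0 t by (simp add: blinfun.diff_right R_U_flow)
    also have "\<dots> \<le> norm (R t \<tau>) * norm (x - U \<tau> \<tau>0 x)" by (rule norm_blinfun)
    also have "\<dots> \<le> K * exp (\<epsilon> * b) * norm (x - U \<tau> \<tau>0 x)" by (rule mult_right_mono[OF M[OF \<tau>]]) simp
    finally show ?thesis using True by (simp add: norm_minus_commute max_absorb1 min_absorb2)
  next
    case False
    have "norm (R t \<tau> x - R t \<tau>0 x) = norm (R t \<tau>0 (U \<tau>0 \<tau> x - x))"
      using False \<tau> t by (simp add: blinfun.diff_right R_U_flow)
    also have "\<dots> \<le> norm (R t \<tau>0) * norm (U \<tau>0 \<tau> x - x)" by (rule norm_blinfun)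
    also have "\<dots> \<le> K * exp (\<epsilon> * b) * norm (U \<tau>0 \<tau> x - x)" by (rule mult_right_mono[OF M[OF \<tau>0]]) simp
    finally show ?thesis using False by (simp add: max_def min_def)
  qed
  then have ev: "\<forall>\<^sub>F \<tau> in at \<tau>0 within {t..b}. norm (R t \<tau> x - R t \<tau>0 x) \<le>
      K * exp (\<epsilon> * b) * norm (U (max \<tau> \<tau>0) (min \<tau> \<tau>0) x - x)"
    by (simp add: eventually_at_filter)
  have "continuous_on {t..b} (\<lambda>\<tau>. K * exp (\<epsilon> * b) * norm (U (max \<tau> \<tau>0) (min \<tau> \<tau>0) x - x))"
    by (intro continuous_intros U_continuous) (use t \<tau>0 in auto)
  then have "((\<lambda>\<tau>. K * exp (\<epsilon> * b) * norm (U (max \<tau> \<tau>0) (min \<tau> \<tau>0) x - x)) \<longlongrightarrow>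
      K * exp (\<epsilon> * b) * norm (U (max \<tau>0 \<tau>0) (min \<tau>0 \<tau>0) x - x)) (at \<tau>0 within {t..b})"
    using \<tau>0 unfolding continuous_on_def by blast
  then have "((\<lambda>\<tau>. K * exp (\<epsilon> * b) * norm (U (max \<tau> \<tau>0) (min \<tau> \<tau>0) x - x)) \<longlongrightarrow> 0) (at \<tau>0 within {t..b})"
    using U_id[of \<tau>0] \<tau>0 t by simp
  from Lim_null_comparison[OF ev this]
  show "((\<lambda>\<tau>. R t \<tau> x) \<longlongrightarrow> R t \<tau>0 x) (at \<tau>0 within {t..b})" by (rule LIM_zero_cancel)
qed

text \<open>
  On either side of \<open>t\<close> the kernel extends to a strongly continuous bounded function of \<open>\<tau>\<close> by freezing \<open>\<tau>\<close> at \<open>t\<close>.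
  For \<open>\<tau> \<le> t\<close> the kernel is written as \<open>P t\<close> after \<open>U t \<tau>\<close>, whose boundedness on compact sets is known.
\<close>

lemma bochner_on_G_compact:
  assumes t: "0 \<le> t" and u: "continuous_on {0..b} u"
  shows "bochner_on {0..b} (\<lambda>\<tau>. G t \<tau> (B \<tau> (u \<tau>)))"
proof -
  obtain C where C: "C > 0" "\<forall>s r. 0 \<le> s \<and> s \<le> r \<and> r \<le> t \<longrightarrow> norm (U r s) \<le> C"
    using U_locally_bounded[of t] by blast
  have 1: "bochner_on {0..b} (\<lambda>\<tau>. (P t o\<^sub>L U t (min t \<tau>)) (B \<tau> (u \<tau>)))"
  proof (rule bochner_on_kernel[OF _ _ u])
    show "continuous_on {0..b} (\<lambda>\<tau>. (P t o\<^sub>L U t (min t \<tau>)) w)" for w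
      unfolding blinfun_apply_blinfun_compose
      by (intro continuous_intros U_continuous) (use t in auto)
    show "norm (P t o\<^sub>L U t (min t \<tau>)) \<le> norm (P t) * C" if "\<tau> \<in> {0..b}" for \<tau>
    proof -
      have "norm (U t (min t \<tau>)) \<le> C" using C(2) t that by simp
      then show ?thesis
        using order_trans[OF norm_blinfun_compose[of "P t" "U t (min t \<tau>)"]] by (simp add: mult_left_mono)
    qed
  qed simp
  have 2: "bochner_on {0..b} (\<lambda>\<tau>. (- R t (max t \<tau>)) (B \<tau> (u \<tau>)))"
  proof (rule bochner_on_kernel[OF _ _ u])
    show "continuous_on {0..b} (\<lambda>\<tau>. (- R t (max t \<tau>)) w)" for w
    proof -
      have "continuous_on {0..b} (\<lambda>\<tau>. R t (max t \<tau>) w)"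
        by (rule continuous_on_compose2[OF R_continuous_right[OF t, of "max t b"]])
          (auto intro!: continuous_intros)
      then show ?thesis by (simp add: blinfun.minus_left continuous_on_minus)
    qed
    show "norm (- R t (max t \<tau>)) \<le> K * exp (\<epsilon> * max t b)" if "\<tau> \<in> {0..b}" for \<tau>
    proof -
      have "norm (R t (max t \<tau>)) \<le> K * exp (- \<alpha> * (max t \<tau> - t) + \<epsilon> * max t \<tau>)"
        by (rule norm_R) (use t in auto)
      also have "\<dots> \<le> K * exp (\<epsilon> * max t b)"
      proof -
        have "\<epsilon> * max t \<tau> \<le> \<epsilon> * max t b" using constants that by (intro mult_left_mono) auto
        moreover have "0 \<le> \<alpha> * (max t \<tau> - t)" using constants by simp
        ultimately show ?thesis using constants(1) by simp
      qed
      finally show ?thesis by simp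
    qed
  qed simp
  have "bochner_on {0..b} (\<lambda>\<tau>. if \<tau> \<in> {..t} then (P t o\<^sub>L U t (min t \<tau>)) (B \<tau> (u \<tau>))
      else (- R t (max t \<tau>)) (B \<tau> (u \<tau>)))"
    by (rule bochner_on_If[OF 1 2]) simp
  then show ?thesis
    by (rule bochner_on_cong)
      (use t in \<open>auto simp: G_stable G_unstable blinfun.minus_left P_U min_def max_def\<close>)
qed

text \<open>
  The function that the kernel is applied to may jump, as \<open>G \<tau> s x\<close> does at \<open>\<tau> = s\<close>: it is given by two continuous
  branches.
\<close>

lemma bochner_on_G:
  assumes t: "0 \<le> t" and u: "\<And>b. continuous_on {0..b} u" "\<And>b. continuous_on {0..b} v" and E: "E \<in> sets lebesgue"
    and m: "m integrable_on {0..}"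
    and bound: "\<And>\<tau>. 0 \<le> \<tau> \<Longrightarrow> norm (G t \<tau> (B \<tau> (if \<tau> \<in> E then u \<tau> else v \<tau>))) \<le> m \<tau>"
  shows "bochner_on {0..} (\<lambda>\<tau>. G t \<tau> (B \<tau> (if \<tau> \<in> E then u \<tau> else v \<tau>)))"
proof (rule bochner_on_halfline[OF _ m bound])
  fix n :: nat
  have "bochner_on {0..real n} (\<lambda>\<tau>. if \<tau> \<in> E then G t \<tau> (B \<tau> (u \<tau>)) else G t \<tau> (B \<tau> (v \<tau>)))"
    by (rule bochner_on_If[OF bochner_on_G_compact[OF t u(1)] bochner_on_G_compact[OF t u(2)] E])
  then show "bochner_on {0..real n} (\<lambda>\<tau>. G t \<tau> (B \<tau> (if \<tau> \<in> E then u \<tau> else v \<tau>)))"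
    by (rule bochner_on_cong) simp
qed

lemma G_tendsto:
  assumes t: "0 \<le> t" "0 \<le> \<tau>" "\<tau> \<noteq> t"
  shows "((\<lambda>t'. G t' \<tau> w) \<longlongrightarrow> G t \<tau> w) (at t within {0..})"
proof (cases "\<tau> < t")
  case True
  have "continuous_on {0..} (\<lambda>t'. U (max \<tau> t') \<tau> (P \<tau> w))"
    by (rule U_continuous) (use t in \<open>auto intro!: continuous_intros\<close>)
  then have "((\<lambda>t'. U (max \<tau> t') \<tau> (P \<tau> w)) \<longlongrightarrow> U (max \<tau> t) \<tau> (P \<tau> w)) (at t within {0..})"
    using t by (simp add: continuous_on_def)
  moreover have "\<forall>\<^sub>F t' in at t within {0..}. U (max \<tau> t') \<tau> (P \<tau> w) = G t' \<tau> w"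
    using order_tendstoD(1)[OF tendsto_ident_at True] by eventually_elim (simp add: G_stable)
  ultimately show ?thesis
    using True by (auto simp: G_stable intro: Lim_transform_eventually)
next
  case False
  then have lt: "t < \<tau>" using t by simp
  have "continuous_on {0..} (\<lambda>t'. - R (min t' \<tau>) \<tau> w)"
    by (intro continuous_intros continuous_on_compose2[OF R_continuous_left[of \<tau> "{0..\<tau>}"]])
      (use t in auto)
  then have "((\<lambda>t'. - R (min t' \<tau>) \<tau> w) \<longlongrightarrow> - R (min t \<tau>) \<tau> w) (at t within {0..})"
    using t by (simp add: continuous_on_def)
  moreover have "\<forall>\<^sub>F t' in at t within {0..}. - R (min t' \<tau>) \<tau> w = G t' \<tau> w"
    using order_tendstoD(2)[OF tendsto_ident_at lt] by eventually_elim (simp add: G_unstable)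
  ultimately show ?thesis
    using lt by (auto simp: G_unstable intro: Lim_transform_eventually)
qed

text \<open>
  The function whose integral over \<open>\<tau>\<close> is bounded by \<open>\<theta>\<close>.
\<close>

definition decay_weight :: "real \<Rightarrow> real \<Rightarrow> real" where
  "decay_weight t \<tau> = exp (- (\<alpha> - \<beta>) * \<bar>t - \<tau>\<bar>) * (norm (B \<tau>) * exp (\<epsilon> * \<bar>\<tau>\<bar>))"

lemma decay_weight_nonneg: "0 \<le> decay_weight t \<tau>"
  by (simp add: decay_weight_def)

text \<open>
  The triangle inequality \<open>\<bar>t - s\<bar> \<le> \<bar>t - \<tau>\<bar> + \<bar>\<tau> - s\<bar>\<close> with coefficient \<open>\<beta>\<close>: the part \<open>\<beta>\<close> of the decay rate \<open>\<alpha>\<close>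
  carries the weight from \<open>\<tau>\<close> to \<open>t\<close>, the rest stays in \<open>decay_weight\<close>.
\<close>

lemma norm_G_weight:
  assumes "0 \<le> t" "0 \<le> \<tau>"
  shows "norm (G t \<tau> o\<^sub>L B \<tau>) * exp (- \<beta> * \<bar>\<tau> - s\<bar>) \<le> K * exp (- \<beta> * \<bar>t - s\<bar>) * decay_weight t \<tau>"
proof -
  have "norm (G t \<tau> o\<^sub>L B \<tau>) \<le> norm (G t \<tau>) * norm (B \<tau>)" by (rule norm_blinfun_compose)
  also have "\<dots> \<le> K * exp (- \<alpha> * \<bar>t - \<tau>\<bar> + \<epsilon> * \<tau>) * norm (B \<tau>)"
    by (rule mult_right_mono[OF norm_G[OF assms]]) simp
  finally have "norm (G t \<tau> o\<^sub>L B \<tau>) * exp (- \<beta> * \<bar>\<tau> - s\<bar>) \<le>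
      K * exp (- \<alpha> * \<bar>t - \<tau>\<bar> + \<epsilon> * \<tau>) * norm (B \<tau>) * exp (- \<beta> * \<bar>\<tau> - s\<bar>)"
    by (rule mult_right_mono) simp
  also have "\<dots> = K * norm (B \<tau>) * exp (- \<alpha> * \<bar>t - \<tau>\<bar> + \<epsilon> * \<tau> - \<beta> * \<bar>\<tau> - s\<bar>)"
    by (simp add: exp_add exp_diff exp_minus field_simps)
  also have "\<dots> \<le> K * norm (B \<tau>) * exp (- \<beta> * \<bar>t - s\<bar> - (\<alpha> - \<beta>) * \<bar>t - \<tau>\<bar> + \<epsilon> * \<bar>\<tau>\<bar>)"
  proof -
    have "\<beta> * \<bar>t - s\<bar> \<le> \<beta> * (\<bar>t - \<tau>\<bar> + \<bar>\<tau> - s\<bar>)" using constants(2) by (intro mult_left_mono) auto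
    then have "- \<alpha> * \<bar>t - \<tau>\<bar> + \<epsilon> * \<tau> - \<beta> * \<bar>\<tau> - s\<bar> \<le> - \<beta> * \<bar>t - s\<bar> - (\<alpha> - \<beta>) * \<bar>t - \<tau>\<bar> + \<epsilon> * \<bar>\<tau>\<bar>"
      using assms by (simp add: algebra_simps)
    then show ?thesis using constants(1) by (intro mult_left_mono) auto
  qed
  also have "\<dots> = K * exp (- \<beta> * \<bar>t - s\<bar>) * decay_weight t \<tau>"
    by (simp add: decay_weight_def exp_add exp_diff exp_minus field_simps)
  finally show ?thesis .
qed

lemma decay_weight_local:
  assumes "\<bar>t' - t\<bar> < 1"
  shows "decay_weight t' \<tau> \<le> exp (\<alpha> - \<beta>) * decay_weight t \<tau>"
proof -
  have "(\<alpha> - \<beta>) * \<bar>t - \<tau>\<bar> \<le> (\<alpha> - \<beta>) * (1 + \<bar>t' - \<tau>\<bar>)"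
    using constants(4) assms by (intro mult_left_mono) auto
  then have "- (\<alpha> - \<beta>) * \<bar>t' - \<tau>\<bar> \<le> (\<alpha> - \<beta>) + - (\<alpha> - \<beta>) * \<bar>t - \<tau>\<bar>" by (simp add: algebra_simps)
  then have "exp (- (\<alpha> - \<beta>) * \<bar>t' - \<tau>\<bar>) \<le> exp (\<alpha> - \<beta>) * exp (- (\<alpha> - \<beta>) * \<bar>t - \<tau>\<bar>)"
    unfolding exp_add[symmetric] by (subst exp_le_cancel_iff)
  then show ?thesis
    unfolding decay_weight_def by (subst mult.assoc[symmetric]) (rule mult_right_mono, auto)
qed

text \<open>
  The smallness condition \<open>K * \<theta> < 1\<close> is the contraction condition, for every \<open>s\<close> and with the weight
  centred at \<open>s\<close>.
\<close>

lemma green_fredholm: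
  assumes s: "0 \<le> s"
  shows "continuous_fredholm {0..} (\<lambda>t \<tau>. G t \<tau> o\<^sub>L B \<tau>) (\<lambda>t. exp (- \<beta> * \<bar>t - s\<bar>))
    (\<lambda>t \<tau>. K * exp (- \<beta> * \<bar>t - s\<bar>) * decay_weight t \<tau>) (K * \<theta>)"
proof -
  have w_int: "decay_weight t integrable_on {0..}" if "0 \<le> t" for t
    using weighted_integrable[OF that] by (simp add: decay_weight_def[abs_def])
  have w_le: "integral {0..} (decay_weight t) \<le> \<theta>" if "0 \<le> t" for t
    using weighted_integral_le[OF that] by (simp add: decay_weight_def[abs_def])
  have m_int: "(\<lambda>\<tau>. c * decay_weight t \<tau>) integrable_on {0..}" if "0 \<le> t" for t c
    using integrable_cmul[OF w_int[OF that], of c] by simp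
  show ?thesis
  proof unfold_locales
    fix t \<tau> :: real assume t: "t \<in> {0..}" and \<tau>: "\<tau> \<in> {0..}"
    show "norm (G t \<tau> o\<^sub>L B \<tau>) * exp (- \<beta> * \<bar>\<tau> - s\<bar>) \<le> K * exp (- \<beta> * \<bar>t - s\<bar>) * decay_weight t \<tau>"
      using norm_G_weight t \<tau> by simp
  next
    fix t :: real assume "t \<in> {0..}"
    then have t: "0 \<le> t" by simp
    show "(\<lambda>\<tau>. K * exp (- \<beta> * \<bar>t - s\<bar>) * decay_weight t \<tau>) integrable_on {0..}" by (rule m_int[OF t])
    have "K * exp (- \<beta> * \<bar>t - s\<bar>) * integral {0..} (decay_weight t) \<le> K * exp (- \<beta> * \<bar>t - s\<bar>) * \<theta>"
      using constants(1) by (intro mult_left_mono w_le[OF t]) simp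
    then show "integral {0..} (\<lambda>\<tau>. K * exp (- \<beta> * \<bar>t - s\<bar>) * decay_weight t \<tau>) \<le> K * \<theta> * exp (- \<beta> * \<bar>t - s\<bar>)"
      by (simp add: mult_ac)
    have "K * exp (- \<beta> * \<bar>t' - s\<bar>) * decay_weight t' \<tau> \<le> K * exp (\<alpha> - \<beta>) * decay_weight t \<tau>" if "\<bar>t' - t\<bar> < 1" for t' \<tau>
    proof -
      have "exp (- \<beta> * \<bar>t' - s\<bar>) \<le> 1" using constants(2) by simp
      then have "exp (- \<beta> * \<bar>t' - s\<bar>) * decay_weight t' \<tau> \<le> 1 * (exp (\<alpha> - \<beta>) * decay_weight t \<tau>)"
        by (rule mult_mono) (use decay_weight_local[OF that] decay_weight_nonneg in auto)
      from mult_left_mono[OF this, of K] show ?thesis using constants(1) by (simp add: mult.assoc)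
    qed
    then show "\<exists>\<delta>>0. \<exists>D. D integrable_on {0..} \<and> (\<forall>t'\<in>{0..}. \<bar>t' - t\<bar> < \<delta> \<longrightarrow>
        (\<forall>\<tau>\<in>{0..}. K * exp (- \<beta> * \<bar>t' - s\<bar>) * decay_weight t' \<tau> \<le> D \<tau>))"
      using m_int[OF t, of "K * exp (\<alpha> - \<beta>)"]
      by (intro exI[of _ 1] conjI exI[of _ "\<lambda>\<tau>. K * exp (\<alpha> - \<beta>) * decay_weight t \<tau>"]) auto
  next
    fix t \<tau> :: real and x assume "t \<in> {0..}" "\<tau> \<in> {0..}" "\<tau> \<noteq> t"
    then show "((\<lambda>t'. (G t' \<tau> o\<^sub>L B \<tau>) x) \<longlongrightarrow> (G t \<tau> o\<^sub>L B \<tau>) x) (at t within {0..})"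
      unfolding blinfun_apply_blinfun_compose by (intro G_tendsto) auto
  next
    fix u :: "real \<Rightarrow> 'a" and C t :: real
    assume u: "continuous_on {0..} u" "\<And>t. t \<in> {0..} \<Longrightarrow> norm (u t) \<le> C * exp (- \<beta> * \<bar>t - s\<bar>)"
      and t: "t \<in> {0..}"
    have cu: "continuous_on {0..b} u" for b by (rule continuous_on_subset[OF u(1)]) auto
    have "0 \<le> C * exp (- \<beta> * \<bar>t - s\<bar>)" using order_trans[OF norm_ge_zero u(2)[OF t]] .
    then have C0: "0 \<le> C" by (simp add: zero_le_mult_iff)
    have "norm (G t \<tau> (B \<tau> (u \<tau>))) \<le> C * K * exp (- \<beta> * \<bar>t - s\<bar>) * decay_weight t \<tau>" if \<tau>: "0 \<le> \<tau>" for \<tau>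
    proof -
      have "norm ((G t \<tau> o\<^sub>L B \<tau>) (u \<tau>)) \<le> norm (G t \<tau> o\<^sub>L B \<tau>) * norm (u \<tau>)" by (rule norm_blinfun)
      also have "\<dots> \<le> norm (G t \<tau> o\<^sub>L B \<tau>) * (C * exp (- \<beta> * \<bar>\<tau> - s\<bar>))"
        using u(2)[of \<tau>] \<tau> by (intro mult_left_mono) auto
      also have "\<dots> = C * (norm (G t \<tau> o\<^sub>L B \<tau>) * exp (- \<beta> * \<bar>\<tau> - s\<bar>))" by simp
      also have "\<dots> \<le> C * (K * exp (- \<beta> * \<bar>t - s\<bar>) * decay_weight t \<tau>)"
        by (rule mult_left_mono[OF norm_G_weight C0]) (use t \<tau> in auto)
      finally show ?thesis by (simp add: mult_ac)
    qed
    then have "bochner_on {0..} (\<lambda>\<tau>. G t \<tau> (B \<tau> (if \<tau> \<in> UNIV then u \<tau> else u \<tau>)))"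
      by (intro bochner_on_G[OF _ cu cu _ m_int[of t]]) (use t in auto)
    then show "bochner_on {0..} (\<lambda>\<tau>. (G t \<tau> o\<^sub>L B \<tau>) (u \<tau>))" by simp
  qed (use constants in auto)
qed

end

section \<open>The perturbed Green kernel\<close>

context dichotomy_perturbation
begin

text \<open>
  \<open>u\<close> is the column of index \<open>s\<close> of the perturbed Green kernel, applied to \<open>x\<close>.
\<close>

definition green :: "real \<Rightarrow> 'a \<Rightarrow> (real \<Rightarrow> 'a) \<Rightarrow> bool" where
  "green s x u \<longleftrightarrow> (\<exists>C. \<forall>t\<ge>0. norm (u t) \<le> C * exp (- \<beta> * \<bar>t - s\<bar>)) \<and>
     (\<forall>t\<ge>0. ((\<lambda>\<tau>. G t \<tau> (B \<tau> (u \<tau>))) has_integral (u t - G t s x)) {0..})"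

text \<open>
  The bound of the Neumann series for the Green kernel.
\<close>

definition M where "M = K / (1 - K * \<theta>)"

lemma M_nonneg: "0 \<le> M"
  using constants by (simp add: M_def)

lemma green_exists:
  assumes s: "0 \<le> s"
  shows "\<exists>u. green s x u \<and> (\<forall>t\<ge>0. norm (u t) \<le> M * exp (\<epsilon> * s) * norm x * exp (- \<beta> * \<bar>t - s\<bar>)) \<and>
    continuous_on {0..} (\<lambda>t. u t - G t s x)"
proof -
  interpret continuous_fredholm "{0..}" "\<lambda>t \<tau>. G t \<tau> o\<^sub>L B \<tau>" "\<lambda>t. exp (- \<beta> * \<bar>t - s\<bar>)"
    "\<lambda>t \<tau>. K * exp (- \<beta> * \<bar>t - s\<bar>) * decay_weight t \<tau>" "K * \<theta>"
    by (rule green_fredholm[OF s])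
  have f_bd: "norm (G t s x) \<le> K * exp (\<epsilon> * s) * norm x * exp (- \<beta> * \<bar>t - s\<bar>)" if "t \<in> {0..}" for t
  proof -
    have "norm (G t s x) \<le> norm (G t s) * norm x" by (rule norm_blinfun)
    also have "\<dots> \<le> K * exp (- \<alpha> * \<bar>t - s\<bar> + \<epsilon> * s) * norm x"
      by (rule mult_right_mono[OF norm_G]) (use s that in auto)
    also have "\<dots> \<le> K * exp (- \<beta> * \<bar>t - s\<bar> + \<epsilon> * s) * norm x"
      using constants by (intro mult_right_mono mult_left_mono) (auto intro: mult_right_mono)
    finally show ?thesis unfolding exp_add by (simp add: mult_ac)
  qed
  have fb: "bochner_on {0..} (\<lambda>\<tau>. (G t \<tau> o\<^sub>L B \<tau>) (G \<tau> s x))" if t: "t \<in> {0..}" for t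
  proof -
    let ?u = "\<lambda>\<tau>. - R (min \<tau> s) s x" and ?v = "\<lambda>\<tau>. U (max \<tau> s) s (P s x)"
    have eq: "(if \<tau> \<in> {..<s} then ?u \<tau> else ?v \<tau>) = G \<tau> s x" for \<tau>
      by (auto simp: G_stable G_unstable min_def max_def)
    have "bochner_on {0..} (\<lambda>\<tau>. G t \<tau> (B \<tau> (if \<tau> \<in> {..<s} then ?u \<tau> else ?v \<tau>)))"
    proof (rule bochner_on_G)
      show "continuous_on {0..b} ?u" for b
        by (intro continuous_intros continuous_on_compose2[OF R_continuous_left[of s "{0..s}"]])
          (use s in auto)
      show "continuous_on {0..b} ?v" for b
        by (rule U_continuous) (use s in \<open>auto intro!: continuous_intros\<close>)
      show "(\<lambda>\<tau>. K * exp (\<epsilon> * s) * norm x * (K * exp (- \<beta> * \<bar>t - s\<bar>) * decay_weight t \<tau>)) integrable_on {0..}"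
        using integrable_cmul[OF majorant_integrable[OF t], of "K * exp (\<epsilon> * s) * norm x"] by simp
      show "norm (G t \<tau> (B \<tau> (if \<tau> \<in> {..<s} then ?u \<tau> else ?v \<tau>)))
          \<le> K * exp (\<epsilon> * s) * norm x * (K * exp (- \<beta> * \<bar>t - s\<bar>) * decay_weight t \<tau>)" if "0 \<le> \<tau>" for \<tau>
        unfolding eq using integrand_bound[OF f_bd t, of \<tau>] that constants(1) by simp
    qed (use t in auto)
    then show ?thesis unfolding eq by simp
  qed
  have "0 \<le> K * exp (\<epsilon> * s) * norm x" using constants(1) by simp
  then obtain u where u: "\<And>t. t \<in> {0..} \<Longrightarrow>
      ((\<lambda>\<tau>. (G t \<tau> o\<^sub>L B \<tau>) (u \<tau>)) has_integral (u t - G t s x)) {0..}"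
    "\<And>t. t \<in> {0..} \<Longrightarrow> norm (u t) \<le> K * exp (\<epsilon> * s) * norm x / (1 - K * \<theta>) * exp (- \<beta> * \<bar>t - s\<bar>)"
    "continuous_on {0..} (\<lambda>t. u t - G t s x)"
    using solution_exists[of "\<lambda>t. G t s x" "K * exp (\<epsilon> * s) * norm x", OF f_bd _ fb] by blast
  have bd: "\<forall>t\<ge>0. norm (u t) \<le> M * exp (\<epsilon> * s) * norm x * exp (- \<beta> * \<bar>t - s\<bar>)"
    using u(2) by (simp add: M_def)
  moreover have "green s x u"
    unfolding green_def using bd u(1) by auto
  ultimately show ?thesis using u(3) by blast
qed

lemma green_unique:
  assumes s: "0 \<le> s" and u: "green s x u" and v: "green s x v" and t: "0 \<le> t"
  shows "u t = v t"
proof -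
  interpret continuous_fredholm "{0..}" "\<lambda>t \<tau>. G t \<tau> o\<^sub>L B \<tau>" "\<lambda>t. exp (- \<beta> * \<bar>t - s\<bar>)"
    "\<lambda>t \<tau>. K * exp (- \<beta> * \<bar>t - s\<bar>) * decay_weight t \<tau>" "K * \<theta>"
    by (rule green_fredholm[OF s])
  obtain C C' where C: "\<forall>t\<ge>0. norm (u t) \<le> C * exp (- \<beta> * \<bar>t - s\<bar>)"
    "\<forall>t\<ge>0. norm (v t) \<le> C' * exp (- \<beta> * \<bar>t - s\<bar>)"
    using u v unfolding green_def by blast
  have "u t - v t = 0"
  proof (rule homogeneous_solution_zero[of "\<lambda>t. u t - v t" "C + C'"])
    fix t :: real assume t: "t \<in> {0..}"
    have "((\<lambda>\<tau>. G t \<tau> (B \<tau> (u \<tau>)) - G t \<tau> (B \<tau> (v \<tau>))) has_integral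
        (u t - G t s x) - (v t - G t s x)) {0..}"
      by (rule has_integral_diff) (use u v t in \<open>auto simp: green_def\<close>)
    then show "((\<lambda>\<tau>. (G t \<tau> o\<^sub>L B \<tau>) (u \<tau> - v \<tau>)) has_integral (u t - v t)) {0..}"
      by (simp add: blinfun.diff_right)
    have "norm (u t) \<le> C * exp (- \<beta> * \<bar>t - s\<bar>)" "norm (v t) \<le> C' * exp (- \<beta> * \<bar>t - s\<bar>)"
      using C t by auto
    then show "norm (u t - v t) \<le> (C + C') * exp (- \<beta> * \<bar>t - s\<bar>)"
      using norm_triangle_ineq4[of "u t" "v t"] by (simp add: distrib_right)
  qed (use t in simp)
  then show ?thesis by simp
qed

lemma green_add:
  assumes "green s x u" "green s y v"
  shows "green s (x + y) (\<lambda>t. u t + v t)"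
  unfolding green_def
proof (intro conjI allI impI)
  obtain C C' where C: "\<forall>t\<ge>0. norm (u t) \<le> C * exp (- \<beta> * \<bar>t - s\<bar>)"
    "\<forall>t\<ge>0. norm (v t) \<le> C' * exp (- \<beta> * \<bar>t - s\<bar>)"
    using assms unfolding green_def by blast
  have "norm (u t + v t) \<le> (C + C') * exp (- \<beta> * \<bar>t - s\<bar>)" if "0 \<le> t" for t
    unfolding distrib_right by (rule norm_triangle_mono) (use C that in auto)
  then show "\<exists>C. \<forall>t\<ge>0. norm (u t + v t) \<le> C * exp (- \<beta> * \<bar>t - s\<bar>)" by blast
  fix t :: real assume t: "0 \<le> t"
  have "((\<lambda>\<tau>. G t \<tau> (B \<tau> (u \<tau>)) + G t \<tau> (B \<tau> (v \<tau>))) has_integral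
      (u t - G t s x) + (v t - G t s y)) {0..}"
    by (rule has_integral_add) (use assms t in \<open>auto simp: green_def\<close>)
  then show "((\<lambda>\<tau>. G t \<tau> (B \<tau> (u \<tau> + v \<tau>))) has_integral (u t + v t - G t s (x + y))) {0..}"
    by (simp add: blinfun.add_right algebra_simps)
qed

lemma green_scaleR:
  assumes "green s x u"
  shows "green s (c *\<^sub>R x) (\<lambda>t. c *\<^sub>R u t)"
  unfolding green_def
proof (intro conjI allI impI)
  obtain C where C: "\<forall>t\<ge>0. norm (u t) \<le> C * exp (- \<beta> * \<bar>t - s\<bar>)"
    using assms unfolding green_def by blast
  have "norm (c *\<^sub>R u t) \<le> (\<bar>c\<bar> * C) * exp (- \<beta> * \<bar>t - s\<bar>)" if "0 \<le> t" for t
    using mult_left_mono[OF C[rule_format, OF that], of "\<bar>c\<bar>"] by (simp add: mult.assoc)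
  then show "\<exists>C. \<forall>t\<ge>0. norm (c *\<^sub>R u t) \<le> C * exp (- \<beta> * \<bar>t - s\<bar>)" by blast
  fix t :: real assume t: "0 \<le> t"
  have "((\<lambda>\<tau>. c *\<^sub>R G t \<tau> (B \<tau> (u \<tau>))) has_integral c *\<^sub>R (u t - G t s x)) {0..}"
    by (rule has_integral_cmul) (use assms t in \<open>auto simp: green_def\<close>)
  then show "((\<lambda>\<tau>. G t \<tau> (B \<tau> (c *\<^sub>R u \<tau>))) has_integral (c *\<^sub>R u t - G t s (c *\<^sub>R x))) {0..}"
    by (simp add: blinfun.scaleR_right scaleR_diff_right)
qed

definition green_solution :: "real \<Rightarrow> 'a \<Rightarrow> real \<Rightarrow> 'a" where
  "green_solution s x = (SOME u. green s x u \<and>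
     (\<forall>t\<ge>0. norm (u t) \<le> M * exp (\<epsilon> * s) * norm x * exp (- \<beta> * \<bar>t - s\<bar>)) \<and>
     continuous_on {0..} (\<lambda>t. u t - G t s x))"

lemma green_solution:
  assumes "0 \<le> s"
  shows "green s x (green_solution s x)"
    "\<And>t. 0 \<le> t \<Longrightarrow> norm (green_solution s x t) \<le> M * exp (\<epsilon> * s) * norm x * exp (- \<beta> * \<bar>t - s\<bar>)"
    "continuous_on {0..} (\<lambda>t. green_solution s x t - G t s x)"
  using someI_ex[OF green_exists[OF assms, of x]] unfolding green_solution_def by blast+

text \<open>
  The perturbed Green kernel. On the diagonal it takes, like \<open>G\<close>, the value of the stable branch.
\<close>

definition G_B :: "real \<Rightarrow> real \<Rightarrow> 'a \<Rightarrow>\<^sub>L 'a" where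
  "G_B t s = Blinfun (\<lambda>x. green_solution s x t)"

lemma G_B_apply:
  assumes st: "0 \<le> s" "0 \<le> t"
  shows "G_B t s x = green_solution s x t"
proof -
  have "bounded_linear (\<lambda>x. green_solution s x t)"
  proof (rule bounded_linear_intro)
    show "green_solution s (x + y) t = green_solution s x t + green_solution s y t" for x y
      by (rule green_unique[OF st(1) green_solution(1)[OF st(1)]
            green_add[OF green_solution(1)[OF st(1)] green_solution(1)[OF st(1)]] st(2)])
    show "green_solution s (c *\<^sub>R x) t = c *\<^sub>R green_solution s x t" for c x
      by (rule green_unique[OF st(1) green_solution(1)[OF st(1)]
            green_scaleR[OF green_solution(1)[OF st(1)]] st(2)])
    show "norm (green_solution s x t) \<le> norm x * (M * exp (\<epsilon> * s) * exp (- \<beta> * \<bar>t - s\<bar>))" for x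
      using green_solution(2)[OF st, of x] by (simp add: mult_ac)
  qed
  then show ?thesis by (simp add: G_B_def bounded_linear_Blinfun_apply)
qed

lemma norm_G_B_apply: "0 \<le> s \<Longrightarrow> 0 \<le> t \<Longrightarrow>
    norm (G_B t s x) \<le> M * exp (- \<beta> * \<bar>t - s\<bar> + \<epsilon> * s) * norm x"
  using green_solution(2)[of s t x] unfolding exp_add by (simp add: G_B_apply mult_ac)

lemma G_B_eqI: "0 \<le> s \<Longrightarrow> 0 \<le> t \<Longrightarrow> green s x u \<Longrightarrow> G_B t s x = u t"
  using green_unique[OF _ green_solution(1)] by (simp add: G_B_apply)

lemma G_B_has_integral:
  assumes st: "0 \<le> s" "0 \<le> t"
  shows "((\<lambda>\<tau>. G t \<tau> (B \<tau> (G_B \<tau> s x))) has_integral (G_B t s x - G t s x)) {0..}"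
proof (rule has_integral_eq)
  show "((\<lambda>\<tau>. G t \<tau> (B \<tau> (green_solution s x \<tau>))) has_integral (G_B t s x - G t s x)) {0..}"
    using green_solution(1)[OF st(1), of x] st by (simp add: green_def G_B_apply)
qed (use st in \<open>simp add: G_B_apply\<close>)

lemma G_B_diff_continuous:
  assumes "0 \<le> s"
  shows "continuous_on {0..} (\<lambda>t. G_B t s x - G t s x)"
  by (rule continuous_on_eq[OF green_solution(3)[OF assms]]) (use assms in \<open>simp add: G_B_apply\<close>)

text \<open>
  Transporting the Green kernel by the flow reproduces it except for the sources between \<open>r\<close> and \<open>t\<close>, whose
  stable and unstable parts add up to \<open>U t \<tau>\<close>. The value at \<open>\<tau> = r\<close> is lost to the convention on the diagonal.
\<close>

lemma G_diff_flow:
  assumes "0 \<le> r" "r \<le> t" "0 \<le> \<tau>" "\<tau> \<noteq> r"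
  shows "G t \<tau> x - U t r (G r \<tau> x) = (if \<tau> \<in> {r..t} then U t \<tau> x else 0)"
proof -
  consider "\<tau> < r" | "r < \<tau>" "\<tau> \<le> t" | "t < \<tau>" using assms by linarith
  then show ?thesis
  proof cases
    case 1
    then show ?thesis using assms by (simp add: G_stable U_comp)
  next
    case 2
    have "U t r (R r \<tau> x) = U t \<tau> (U \<tau> r (R r \<tau> x))" using 2 assms by (simp add: U_comp)
    also have "\<dots> = U t \<tau> x - U t \<tau> (P \<tau> x)" using 2 assms by (simp add: U_R blinfun.diff_right)
    finally show ?thesis using 2 by (simp add: G_stable G_unstable blinfun.minus_right)
  next
    case 3
    then show ?thesis using assms by (simp add: G_unstable blinfun.minus_right U_R_flow)
  qed
qed

lemma G_B_duhamel:
  assumes s: "0 \<le> s" and rt: "0 \<le> r" "r \<le> t"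
  shows "((\<lambda>\<tau>. U t \<tau> (B \<tau> (G_B \<tau> s x))) has_integral
    ((G_B t s x - G t s x) - U t r (G_B r s x - G r s x))) {r..t}"
proof -
  let ?b = "\<lambda>\<tau>. B \<tau> (G_B \<tau> s x)"
  have 1: "((\<lambda>\<tau>. U t r (G r \<tau> (?b \<tau>))) has_integral U t r (G_B r s x - G r s x)) {0..}"
    using has_integral_linear[OF G_B_has_integral[OF s rt(1), of x] blinfun.bounded_linear_right[of "U t r"]]
    by (simp add: o_def)
  have "((\<lambda>\<tau>. G t \<tau> (?b \<tau>) - U t r (G r \<tau> (?b \<tau>))) has_integral
      ((G_B t s x - G t s x) - U t r (G_B r s x - G r s x))) {0..}"
    by (rule has_integral_diff[OF G_B_has_integral[OF s] 1]) (use rt in simp)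
  then have "((\<lambda>\<tau>. if \<tau> \<in> {r..t} then U t \<tau> (?b \<tau>) else 0) has_integral
      ((G_B t s x - G t s x) - U t r (G_B r s x - G r s x))) {0..}"
    by (rule has_integral_spike_finite[of "{r}", rotated 2])
      (use G_diff_flow[OF rt] in auto)
  moreover have "{r..t} \<subseteq> {0..}" using rt by auto
  ultimately show ?thesis by (simp only: has_integral_restrict)
qed

text \<open>
  To the right of \<open>s\<close> the inhomogeneity \<open>G t s x\<close> is itself an orbit of \<open>U\<close>, so \<open>G_B_duhamel\<close> becomes the
  equation of mild solutions.
\<close>

lemma G_B_forward:
  assumes "0 \<le> s" "s \<le> r" "r \<le> t"
  shows "V t r (G_B r s x) = G_B t s x"
proof -
  have "mild r t (G_B r s x) (\<lambda>t. G_B t s x)"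
    unfolding mild_def
  proof (intro conjI ballI)
    have "continuous_on {r..t} (\<lambda>t. (G_B t s x - G t s x) + U t s (P s x))"
      by (intro continuous_on_add continuous_on_subset[OF G_B_diff_continuous] U_continuous)
        (use assms in \<open>auto intro!: continuous_intros\<close>)
    then show "continuous_on {r..t} (\<lambda>t. G_B t s x)"
      by (rule continuous_on_eq) (use assms in \<open>simp add: G_stable\<close>)
    fix t' assume t': "t' \<in> {r..t}"
    have eq: "G_B t' s x - G t' s x - U t' r (G_B r s x - G r s x) = G_B t' s x - U t' r (G_B r s x)"
      using assms t' by (simp add: blinfun.diff_right G_stable U_comp)
    then show "((\<lambda>\<tau>. U t' \<tau> (B \<tau> (G_B \<tau> s x))) has_integral G_B t' s x - U t' r (G_B r s x)) {r..t'}"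
      using G_B_duhamel[of s r t' x, unfolded eq] assms t' by simp
  qed
  from V_eq[OF _ this, of t] show ?thesis using assms by simp
qed

text \<open>
  To the left of \<open>s\<close> the column is an orbit of \<open>V\<close> as well, and its left limit at \<open>s\<close> is \<open>G_B s s x - x\<close>:
  the kernel jumps by the identity.
\<close>

lemma G_B_backward:
  fixes x :: 'a
  assumes rts: "0 \<le> r" "r \<le> t" "t \<le> s"
  defines "g \<equiv> \<lambda>t. if t < s then G_B t s x else G_B s s x - x"
  shows "V t r (g r) = g t"
proof -
  have s: "0 \<le> s" using rts by simp
  have g: "g \<tau> = (G_B \<tau> s x - G \<tau> s x) - R \<tau> s x" if "0 \<le> \<tau>" "\<tau> \<le> s" for \<tau>
    using that by (cases "\<tau> < s") (auto simp: g_def G_unstable G_stable R_refl U_id)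
  have "mild r t (g r) g"
    unfolding mild_def
  proof (intro conjI ballI)
    have "continuous_on {r..t} (\<lambda>\<tau>. (G_B \<tau> s x - G \<tau> s x) - R \<tau> s x)"
      by (intro continuous_on_diff[OF continuous_on_subset[OF G_B_diff_continuous[OF s]]] R_continuous_left)
        (use rts in auto)
    then show "continuous_on {r..t} g"
      by (rule continuous_on_eq) (use rts g in simp)
    fix t' assume t': "t' \<in> {r..t}"
    have eq: "G_B t' s x - G t' s x - U t' r (G_B r s x - G r s x) = g t' - U t' r (g r)"
      using rts t' g[of t'] g[of r] U_R_flow[of r t' s x] by (simp add: blinfun.diff_right)
    have "((\<lambda>\<tau>. U t' \<tau> (B \<tau> (G_B \<tau> s x))) has_integral g t' - U t' r (g r)) {r..t'}"
      using G_B_duhamel[of s r t' x, unfolded eq] rts t' by simp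
    \<comment> \<open>\<open>g\<close> differs from the column of the kernel at \<open>s\<close> only.\<close>
    then show "((\<lambda>\<tau>. U t' \<tau> (B \<tau> (g \<tau>))) has_integral g t' - U t' r (g r)) {r..t'}"
      by (rule has_integral_spike_finite[of "{s}", rotated 2]) (use rts t' in \<open>auto simp: g_def\<close>)
  qed
  from V_eq[OF _ this, of t] show ?thesis using rts by simp
qed

lemma V_has_integral_between:
  assumes "0 \<le> a" "a \<le> p" "p \<le> q"
  shows "((\<lambda>\<tau>. U q \<tau> (B \<tau> (V \<tau> a x))) has_integral (V q a x - U q p (V p a x))) {p..q}"
proof (rule has_integral_eq)
  show "((\<lambda>\<tau>. U q \<tau> (B \<tau> (V \<tau> p (V p a x)))) has_integral (V q a x - U q p (V p a x))) {p..q}"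
    using V_has_integral[of p q "V p a x"] V_comp[of a p q x] assms by simp
qed (use assms in \<open>simp add: V_comp\<close>)

text \<open>
  On a piece \<open>[p,q]\<close> of the orbit, \<open>U q \<tau> (B \<tau> (V \<tau> a x))\<close> integrates to \<open>V q a x - U q p (V p a x)\<close>. Applying a bounded operator
  to this produces the Green kernel at \<open>r\<close>: the operator \<open>P r \<circ> U r b\<close> if the orbit lies before \<open>r\<close>, the
  operator \<open>- R r b\<close> if it lies after \<open>r\<close>. If \<open>r\<close> lies within the orbit, the interval is split at \<open>r\<close>, and the stable and unstable
  parts of \<open>V r a x\<close> add up to the extra term.
\<close>

lemma V_variation_of_constants:
  assumes ab: "0 \<le> a" "a \<le> b" and r: "0 \<le> r"
  shows "((\<lambda>\<tau>. if \<tau> \<in> {a..b} then G r \<tau> (B \<tau> (V \<tau> a x)) else 0) has_integral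
    (G r b (V b a x) - G r a x + (if a \<le> r \<and> r < b then V r a x else 0))) {0..}"
proof -
  let ?F = "\<lambda>t \<tau>. U t \<tau> (B \<tau> (V \<tau> a x))" and ?G = "\<lambda>\<tau>. G r \<tau> (B \<tau> (V \<tau> a x))"
  have Va: "V a a x = x" using ab by (simp add: V_id)
  have lin: "((\<lambda>\<tau>. T (?F q \<tau>)) has_integral T (V q a x) - T (U q p (V p a x))) {p..q}"
    if "a \<le> p" "p \<le> q" for T :: "'a \<Rightarrow>\<^sub>L 'a" and p q
    using has_integral_linear[OF V_has_integral_between[OF ab(1) that, of x] blinfun.bounded_linear_right[of T]]
    by (simp add: o_def blinfun.diff_right)
  have unst: "(?G has_integral (- R r b (V b a x) + R r p (V p a x))) {p..b}"
    if p: "a \<le> p" "r \<le> p" "p \<le> b" for p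
  proof (rule has_integral_spike_finite[of "{r}"])
    show "((\<lambda>\<tau>. (- R r b) (?F b \<tau>)) has_integral (- R r b (V b a x) + R r p (V p a x))) {p..b}"
      using lin[OF p(1,3), of "- R r b"] p r by (simp add: blinfun.minus_left R_U_flow)
    show "?G \<tau> = (- R r b) (?F b \<tau>)" if "\<tau> \<in> {p..b} - {r}" for \<tau>
      using that p r by (simp add: blinfun.minus_left R_U_flow G_unstable)
  qed simp
  have "(?G has_integral (G r b (V b a x) - G r a x + (if a \<le> r \<and> r < b then V r a x else 0))) {a..b}"
  proof -
    consider "b \<le> r" | "r < a" | "a \<le> r" "r < b" by linarith
    then show ?thesis
    proof cases
      case 1
      have "((\<lambda>\<tau>. (P r o\<^sub>L U r b) (?F b \<tau>)) has_integral
          (P r o\<^sub>L U r b) (V b a x) - (P r o\<^sub>L U r b) (U b a (V a a x))) {a..b}"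
        by (rule lin) (use ab in auto)
      moreover have "(P r o\<^sub>L U r b) (V b a x) - (P r o\<^sub>L U r b) (U b a (V a a x)) =
          G r b (V b a x) - G r a x + (if a \<le> r \<and> r < b then V r a x else 0)"
        using 1 ab by (simp add: G_stable P_U U_comp Va)
      ultimately have "((\<lambda>\<tau>. (P r o\<^sub>L U r b) (?F b \<tau>)) has_integral
          (G r b (V b a x) - G r a x + (if a \<le> r \<and> r < b then V r a x else 0))) {a..b}" by simp
      then show ?thesis
        by (rule has_integral_eq[rotated]) (use 1 ab in \<open>auto simp: G_stable P_U U_comp\<close>)
    next
      case 2
      then show ?thesis using unst[of a] ab by (simp add: G_unstable Va)
    next
      case 3
      have "((\<lambda>\<tau>. P r (?F r \<tau>)) has_integral P r (V r a x) - P r (U r a (V a a x))) {a..r}"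
        by (rule lin) (use 3 in auto)
      then have 1: "(?G has_integral P r (V r a x) - P r (U r a (V a a x))) {a..r}"
        by (rule has_integral_eq[rotated]) (use 3 ab in \<open>auto simp: G_stable P_U\<close>)
      have 2: "(?G has_integral (- R r b (V b a x) + R r r (V r a x))) {r..b}"
        by (rule unst) (use 3 in auto)
      have "P r (V r a x) - P r (U r a (V a a x)) + (- R r b (V b a x) + R r r (V r a x)) =
          G r b (V b a x) - G r a x + (if a \<le> r \<and> r < b then V r a x else 0)"
        using 3 ab by (simp add: G_stable G_unstable P_U R_refl Va)
      then show ?thesis
        using has_integral_combine[OF _ _ 1 2] 3 by simp
    qed
  qed
  moreover have "{a..b} \<subseteq> {0..}" using ab by auto
  ultimately show ?thesis by (simp only: has_integral_restrict)
qed

lemma V_orbit_bounded: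
  assumes "0 \<le> s"
  obtains c where "0 \<le> c" "\<And>r. r \<in> {s..t} \<Longrightarrow> norm (V r s x) \<le> c"
proof -
  obtain N where N: "\<And>s r. 0 \<le> s \<and> s \<le> r \<and> r \<le> t \<Longrightarrow> norm (V r s) \<le> N"
    using V_bounded[of t] by blast
  have "norm (V r s x) \<le> \<bar>N\<bar> * norm x" if "r \<in> {s..t}" for r
    by (rule order_trans[OF norm_blinfun mult_right_mono]) (use N[of s r] assms that in auto)
  then show thesis by (intro that[of "\<bar>N\<bar> * norm x"]) auto
qed

text \<open>
  Replacing the unit source at \<open>s\<close> by its image under \<open>V\<close> at \<open>t\<close> moves the jump from \<open>s\<close> to \<open>t\<close>; in between, where the old column is
  to the right of its jump and the new one to the left, they differ by the orbit of \<open>x\<close>.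
\<close>

lemma green_cut:
  assumes st: "0 \<le> s" "s \<le> t"
  shows "green t (V t s x) (\<lambda>r. G_B r s x - (if s \<le> r \<and> r < t then V r s x else 0))"
  unfolding green_def
proof (intro conjI allI impI)
  let ?u = "\<lambda>r. G_B r s x - (if s \<le> r \<and> r < t then V r s x else 0)"
  obtain c where c: "0 \<le> c" "\<And>r. r \<in> {s..t} \<Longrightarrow> norm (V r s x) \<le> c"
    using V_orbit_bounded[OF st(1), of t x] by metis
  let ?N = "M * exp (\<epsilon> * s) * norm x"
  have N0: "0 \<le> ?N" using M_nonneg by simp
  have "norm (?u r) \<le> (?N + c) * exp (\<beta> * (t - s)) * exp (- \<beta> * \<bar>r - t\<bar>)" if r: "0 \<le> r" for r
  proof -
    \<comment> \<open>Moving the centre of the weight from \<open>s\<close> to \<open>t\<close> costs the factor \<open>exp (\<beta> * (t - s))\<close>.\<close>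
    have "\<beta> * \<bar>r - t\<bar> \<le> \<beta> * (\<bar>r - s\<bar> + (t - s))" using constants(2) st by (intro mult_left_mono) auto
    then have "exp (- \<beta> * \<bar>r - s\<bar>) \<le> exp (\<beta> * (t - s)) * exp (- \<beta> * \<bar>r - t\<bar>)"
      unfolding exp_add[symmetric] by (subst exp_le_cancel_iff) (simp add: algebra_simps)
    from mult_left_mono[OF this N0]
    have 1: "norm (G_B r s x) \<le> ?N * (exp (\<beta> * (t - s)) * exp (- \<beta> * \<bar>r - t\<bar>))"
      using green_solution(2)[OF st(1) r, of x] st r by (simp add: G_B_apply)
    have 2: "norm (if s \<le> r \<and> r < t then V r s x else 0) \<le> c * (exp (\<beta> * (t - s)) * exp (- \<beta> * \<bar>r - t\<bar>))"
    proof (cases "s \<le> r \<and> r < t")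
      case True
      have "\<beta> * (t - r) \<le> \<beta> * (t - s)" using constants(2) True by (intro mult_left_mono) auto
      then have "1 \<le> exp (\<beta> * (t - s)) * exp (- \<beta> * \<bar>r - t\<bar>)"
        unfolding exp_add[symmetric] using True by (simp add: algebra_simps)
      from mult_left_mono[OF this c(1)] show ?thesis using c(2)[of r] True by simp
    qed (use c(1) in auto)
    show ?thesis
      using norm_triangle_mono[OF 1 order_eq_refl[OF norm_minus_cancel]] order_trans[OF norm_triangle_ineq4 add_mono[OF 1 2]]
      by (simp add: algebra_simps)
  qed
  then show "\<exists>C. \<forall>r\<ge>0. norm (?u r) \<le> C * exp (- \<beta> * \<bar>r - t\<bar>)" by blast
next
  fix r :: real assume r: "0 \<le> r"
  let ?u = "\<lambda>r. G_B r s x - (if s \<le> r \<and> r < t then V r s x else 0)"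
  have "((\<lambda>\<tau>. G r \<tau> (B \<tau> (G_B \<tau> s x)) - (if \<tau> \<in> {s..t} then G r \<tau> (B \<tau> (V \<tau> s x)) else 0)) has_integral
      (G_B r s x - G r s x) - (G r t (V t s x) - G r s x + (if s \<le> r \<and> r < t then V r s x else 0))) {0..}"
    by (rule has_integral_diff[OF G_B_has_integral[OF st(1) r] V_variation_of_constants[OF st r]])
  then have "((\<lambda>\<tau>. G r \<tau> (B \<tau> (?u \<tau>))) has_integral
      (G_B r s x - G r s x) - (G r t (V t s x) - G r s x + (if s \<le> r \<and> r < t then V r s x else 0))) {0..}"
    by (rule has_integral_spike_finite[of "{t}", rotated 2]) (auto simp: blinfun.diff_right)
  then show "((\<lambda>\<tau>. G r \<tau> (B \<tau> (?u \<tau>))) has_integral (?u r - G r t (V t s x))) {0..}"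
    by (simp add: algebra_simps)
qed

text \<open>
  The boundary term \<open>G r 0 z\<close> of the variation of constants identity vanishes exactly because \<open>z\<close> lies in \<open>N(P 0)\<close>.
\<close>

lemma green_unstable:
  assumes s: "0 \<le> s" and z: "P 0 z = 0"
  shows "green s (V s 0 z) (\<lambda>r. - (if r < s then V r 0 z else 0))"
  unfolding green_def
proof (intro conjI allI impI)
  obtain c where c: "0 \<le> c" "\<And>r. r \<in> {0..s} \<Longrightarrow> norm (V r 0 z) \<le> c"
    using V_orbit_bounded[OF order_refl, of s z] by metis
  have "norm (- (if r < s then V r 0 z else 0)) \<le> c * exp (\<beta> * s) * exp (- \<beta> * \<bar>r - s\<bar>)" if r: "0 \<le> r" for r
  proof (cases "r < s")
    case True
    have "\<beta> * (s - r) \<le> \<beta> * s" using constants(2) r by (intro mult_left_mono) auto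
    then have "1 \<le> exp (\<beta> * s) * exp (- \<beta> * \<bar>r - s\<bar>)"
      unfolding exp_add[symmetric] using True by (simp add: algebra_simps)
    from mult_left_mono[OF this c(1)] show ?thesis using c(2)[of r] True r by (simp add: mult.assoc)
  qed (use c(1) in auto)
  then show "\<exists>C. \<forall>r\<ge>0. norm (- (if r < s then V r 0 z else 0)) \<le> C * exp (- \<beta> * \<bar>r - s\<bar>)" by blast
next
  fix r :: real assume r: "0 \<le> r"
  let ?u = "\<lambda>r. - (if r < s then V r 0 z else 0)"
  have G0: "G r 0 z = 0" using r by (simp add: G_stable z)
  have "((\<lambda>\<tau>. - (if \<tau> \<in> {0..s} then G r \<tau> (B \<tau> (V \<tau> 0 z)) else 0)) has_integral
      - (G r s (V s 0 z) - G r 0 z + (if 0 \<le> r \<and> r < s then V r 0 z else 0))) {0..}"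
    by (rule has_integral_neg[OF V_variation_of_constants[OF order_refl s r]])
  then have "((\<lambda>\<tau>. G r \<tau> (B \<tau> (?u \<tau>))) has_integral
      - (G r s (V s 0 z) - G r 0 z + (if 0 \<le> r \<and> r < s then V r 0 z else 0))) {0..}"
    by (rule has_integral_spike_finite[of "{s}", rotated 2]) (auto simp: blinfun.minus_right)
  then show "((\<lambda>\<tau>. G r \<tau> (B \<tau> (?u \<tau>))) has_integral (?u r - G r s (V s 0 z))) {0..}"
    using r by (simp add: G0 algebra_simps)
qed

text \<open>
  At time 0 the integral contains unstable components only, as no source lies before 0.
\<close>

lemma P_0_G_B:
  assumes s: "0 \<le> s"
  shows "P 0 (G_B 0 s x) = P 0 (G 0 s x)"
proof -
  have "((\<lambda>\<tau>. P 0 (G 0 \<tau> (B \<tau> (G_B \<tau> s x)))) has_integral P 0 (G_B 0 s x - G 0 s x)) {0..}"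
    using has_integral_linear[OF G_B_has_integral[OF s order_refl, of x] blinfun.bounded_linear_right[of "P 0"]]
    by (simp add: o_def)
  moreover have "((\<lambda>\<tau>. P 0 (G 0 \<tau> (B \<tau> (G_B \<tau> s x)))) has_integral 0) {0..}"
    by (rule has_integral_spike_finite[of "{0}" _ _ "\<lambda>_. 0"])
      (auto simp: G_unstable blinfun.minus_right P_R)
  ultimately have "P 0 (G_B 0 s x - G 0 s x) = 0" by (rule has_integral_unique)
  then show ?thesis by (simp add: blinfun.diff_right)
qed

section \<open>The dichotomy of the perturbed family\<close>

definition P_B :: "real \<Rightarrow> 'a \<Rightarrow>\<^sub>L 'a" where
  "P_B s = G_B s s"

lemma P_B_unstable: "0 \<le> s \<Longrightarrow> P 0 z = 0 \<Longrightarrow> P_B s (V s 0 z) = 0"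
  using G_B_eqI[OF _ _ green_unstable, of s s z] by (simp add: P_B_def)

lemma G_B_unstable: "0 \<le> r \<Longrightarrow> r < s \<Longrightarrow> P 0 z = 0 \<Longrightarrow> G_B r s (V s 0 z) = - V r 0 z"
  using G_B_eqI[OF _ _ green_unstable, of s r z] by simp

text \<open>
  For \<open>s > 0\<close> the complementary component of \<open>x\<close> is minus the left limit of the column at \<open>s\<close>, hence it is carried by the orbit
  starting at \<open>- G_B 0 s x\<close>, a point of \<open>N(P 0)\<close>. For \<open>s = 0\<close> there is nothing to the left of \<open>s\<close>, and the
  complementary component is itself the starting point.
\<close>

lemma complement_representation:
  assumes s: "0 \<le> s"
  obtains z where "P 0 z = 0" "x - P_B s x = V s 0 z" "\<And>r. 0 \<le> r \<Longrightarrow> r < s \<Longrightarrow> V r 0 z = - G_B r s x"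
proof (cases "s = 0")
  case True
  have "P 0 (x - P_B 0 x) = 0"
    using P_0_G_B[OF order_refl, of x] by (simp add: P_B_def blinfun.diff_right G_stable U_id P_idem)
  then show thesis using that[of "x - P_B 0 x"] True by (simp add: V_id)
next
  case False
  then have s0: "0 < s" using s by simp
  show thesis
  proof (rule that[of "- G_B 0 s x"])
    show "P 0 (- G_B 0 s x) = 0"
      using P_0_G_B[OF s, of x] s0 by (simp add: blinfun.minus_right G_unstable P_R)
    show "x - P_B s x = V s 0 (- G_B 0 s x)"
      using G_B_backward[OF order_refl s order_refl, of x] s0 by (simp add: P_B_def blinfun.minus_right)
    show "V r 0 (- G_B 0 s x) = - G_B r s x" if "0 \<le> r" "r < s" for r
      using G_B_backward[of 0 r s x] s0 that by (simp add: blinfun.minus_right)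
  qed
qed

lemma P_B_idem:
  assumes "0 \<le> s"
  shows "P_B s (P_B s x) = P_B s x"
proof -
  obtain z where "P 0 z = 0" "x - P_B s x = V s 0 z"
    using complement_representation[OF assms] by metis
  then have "P_B s (x - P_B s x) = 0" using P_B_unstable[OF assms] by simp
  then show ?thesis by (simp add: blinfun.diff_right)
qed

lemma V_P_B:
  assumes "0 \<le> s" "s \<le> t"
  shows "V t s (P_B s x) = G_B t s x" "P_B t (V t s x) = G_B t s x"
  using G_B_forward[of s s t x] G_B_eqI[OF _ _ green_cut, of t t s x] assms by (simp_all add: P_B_def)

lemma null_space_P_B:
  assumes s: "0 \<le> s"
  shows "null_space (P_B s) = V s 0 ` {z. P 0 z = 0}"
proof (intro equalityI subsetI)
  fix x assume "x \<in> null_space (P_B s)"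
  then have "P_B s x = 0" by (simp add: null_space_def)
  moreover obtain z where "P 0 z = 0" "x - P_B s x = V s 0 z"
    using complement_representation[OF s] by metis
  ultimately show "x \<in> V s 0 ` {z. P 0 z = 0}" by simp
qed (use P_B_unstable[OF s] in \<open>auto simp: null_space_def\<close>)

text \<open>
  Injectivity is a consequence of \<open>G_B_unstable\<close>: the perturbed Green kernel inverts \<open>V\<close> on the unstable orbits.
\<close>

lemma V_bij_null_space:
  assumes st: "0 \<le> s" "s \<le> t"
  shows "bij_betw (V t s) (null_space (P_B s)) (null_space (P_B t))"
  unfolding bij_betw_def
proof
  have "0 \<le> t" using st by simp
  then show "V t s ` null_space (P_B s) = null_space (P_B t)"
    using st by (simp add: null_space_P_B image_image V_comp)
  show "inj_on (V t s) (null_space (P_B s))"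
  proof (rule inj_onI)
    fix x y assume xy: "x \<in> null_space (P_B s)" "y \<in> null_space (P_B s)" "V t s x = V t s y"
    then have "x - y \<in> null_space (P_B s)" by (simp add: null_space_def blinfun.diff_right)
    then obtain z where z: "P 0 z = 0" "x - y = V s 0 z" using null_space_P_B[OF st(1)] by auto
    have "V t 0 z = V t s (V s 0 z)" using st by (simp add: V_comp)
    also have "\<dots> = 0" unfolding z(2)[symmetric] using xy(3) by (simp add: blinfun.diff_right)
    finally have Vt: "V t 0 z = 0" .
    have "V s 0 z = 0"
    proof (cases "s = t")
      case False
      then show ?thesis using G_B_unstable[OF st(1) _ z(1), of t] st Vt by simp
    qed (use Vt in simp)
    then show "x = y" using z(2) by simp
  qed
qed

lemma V_continuous:
  assumes "continuous_on S f" "continuous_on S g" "\<And>x. x \<in> S \<Longrightarrow> 0 \<le> g x \<and> g x \<le> f x"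
  shows "continuous_on S (\<lambda>x. V (f x) (g x) y)"
  by (rule evolution_family_continuous_compose[OF _ assms])
    (use perturbed_evolution_family_V in \<open>simp_all add: perturbed_evolution_family_def\<close>)

text \<open>
  Since \<open>P_B t (V t s x) = V t s (P_B s x)\<close>, it suffices that \<open>x - V t s x\<close> tends to zero and that \<open>P_B\<close> is locally bounded.
\<close>

lemma P_B_tendsto_right:
  assumes s: "0 \<le> s"
  shows "((\<lambda>t. P_B t x) \<longlongrightarrow> P_B s x) (at s within {s..})"
proof -
  have c1: "continuous_on {s..} (\<lambda>t. M * exp (\<epsilon> * t) * norm (x - V t s x))"
    by (intro continuous_intros V_continuous) (use s in auto)
  have c2: "continuous_on {s..} (\<lambda>t. V t s (P_B s x))"
    by (intro continuous_intros V_continuous) (use s in auto)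
  have "((\<lambda>t. M * exp (\<epsilon> * t) * norm (x - V t s x)) \<longlongrightarrow> M * exp (\<epsilon> * s) * norm (x - V s s x)) (at s within {s..})"
    using c1 unfolding continuous_on_def by (rule bspec) simp
  then have "((\<lambda>t. M * exp (\<epsilon> * t) * norm (x - V t s x)) \<longlongrightarrow> 0) (at s within {s..})"
    using s by (simp add: V_id)
  moreover have "\<forall>\<^sub>F t in at s within {s..}. norm (P_B t (x - V t s x)) \<le> M * exp (\<epsilon> * t) * norm (x - V t s x)"
    unfolding eventually_at_filter
  proof (rule always_eventually, intro allI impI)
    fix t assume "t \<in> {s..}"
    then show "norm (P_B t (x - V t s x)) \<le> M * exp (\<epsilon> * t) * norm (x - V t s x)"
      using norm_G_B_apply[of t t "x - V t s x"] s by (simp add: P_B_def)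
  qed
  ultimately have 1: "((\<lambda>t. P_B t (x - V t s x)) \<longlongrightarrow> 0) (at s within {s..})"
    by (rule Lim_null_comparison[rotated])
  have "((\<lambda>t. V t s (P_B s x)) \<longlongrightarrow> V s s (P_B s x)) (at s within {s..})"
    using c2 unfolding continuous_on_def by (rule bspec) simp
  then have "((\<lambda>t. V t s (P_B s x)) \<longlongrightarrow> P_B s x) (at s within {s..})" using s by (simp add: V_id)
  from tendsto_add[OF 1 this]
  have "((\<lambda>t. P_B t (x - V t s x) + V t s (P_B s x)) \<longlongrightarrow> P_B s x) (at s within {s..})" by simp
  moreover have "\<forall>\<^sub>F t in at s within {s..}. P_B t (x - V t s x) + V t s (P_B s x) = P_B t x"
    unfolding eventually_at_filter
    by (rule always_eventually) (use s V_P_B in \<open>simp add: blinfun.diff_right\<close>)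
  ultimately show ?thesis by (rule Lim_transform_eventually)
qed

text \<open>
  For \<open>t < s\<close> the formula \<open>P_B t x = x + G_B t s (V s t x)\<close> holds; \<open>V s t x\<close> may be replaced by \<open>x\<close> up to an error tending to
  zero, and \<open>G_B t s x\<close> tends to the left limit \<open>P_B s x - x\<close>.
\<close>

lemma P_B_tendsto_left:
  assumes s: "0 < s"
  shows "((\<lambda>t. P_B t x) \<longlongrightarrow> P_B s x) (at s within {0..s})"
proof -
  let ?B = "M * exp (\<epsilon> * s)"
  have c1: "continuous_on {0..s} (\<lambda>t. ?B * norm (V s t x - x))"
    by (intro continuous_intros V_continuous) auto
  have c2: "continuous_on {0..s} (\<lambda>t. x + V t 0 (G_B 0 s x))"
    by (intro continuous_intros V_continuous) auto
  have "((\<lambda>t. ?B * norm (V s t x - x)) \<longlongrightarrow> ?B * norm (V s s x - x)) (at s within {0..s})"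
    using c1 unfolding continuous_on_def by (rule bspec) (use s in simp)
  then have "((\<lambda>t. ?B * norm (V s t x - x)) \<longlongrightarrow> 0) (at s within {0..s})"
    using s by (simp add: V_id)
  moreover have "\<forall>\<^sub>F t in at s within {0..s}. norm (G_B t s (V s t x - x)) \<le> ?B * norm (V s t x - x)"
    unfolding eventually_at_filter
  proof (rule always_eventually, intro allI impI)
    fix t assume t: "t \<in> {0..s}"
    have "norm (G_B t s (V s t x - x)) \<le> M * exp (- \<beta> * \<bar>t - s\<bar> + \<epsilon> * s) * norm (V s t x - x)"
      by (rule norm_G_B_apply) (use t s in auto)
    also have "\<dots> \<le> ?B * norm (V s t x - x)"
      using constants(2) M_nonneg by (intro mult_right_mono mult_left_mono) auto
    finally show "norm (G_B t s (V s t x - x)) \<le> ?B * norm (V s t x - x)" .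
  qed
  ultimately have 1: "((\<lambda>t. G_B t s (V s t x - x)) \<longlongrightarrow> 0) (at s within {0..s})"
    by (rule Lim_null_comparison[rotated])
  have "((\<lambda>t. x + V t 0 (G_B 0 s x)) \<longlongrightarrow> x + V s 0 (G_B 0 s x)) (at s within {0..s})"
    using c2 unfolding continuous_on_def by (rule bspec) (use s in simp)
  moreover have "V s 0 (G_B 0 s x) = P_B s x - x"
    using G_B_backward[of 0 s s x] s by (simp add: P_B_def)
  ultimately have "((\<lambda>t. x + V t 0 (G_B 0 s x)) \<longlongrightarrow> P_B s x) (at s within {0..s})" by simp
  from tendsto_add[OF 1 this]
  have "((\<lambda>t. G_B t s (V s t x - x) + (x + V t 0 (G_B 0 s x))) \<longlongrightarrow> P_B s x) (at s within {0..s})" by simp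
  moreover have "\<forall>\<^sub>F t in at s within {0..s}. G_B t s (V s t x - x) + (x + V t 0 (G_B 0 s x)) = P_B t x"
    unfolding eventually_at_filter
  proof (rule always_eventually, intro allI impI)
    fix t assume "t \<noteq> s" "t \<in> {0..s}"
    then have t: "0 \<le> t" "t < s" by auto
    have "G_B t s (V s t x) = G_B t t x - V t t x"
      using G_B_eqI[OF _ _ green_cut, of s t t x] t by simp
    moreover have "V t 0 (G_B 0 s x) = G_B t s x"
      using G_B_backward[of 0 t s x] t s by simp
    ultimately show "G_B t s (V s t x - x) + (x + V t 0 (G_B 0 s x)) = P_B t x"
      using t by (simp add: blinfun.diff_right V_id P_B_def)
  qed
  ultimately show ?thesis by (rule Lim_transform_eventually)
qed

lemma P_B_continuous: "continuous_on {0..} (\<lambda>t. P_B t x)"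
  unfolding continuous_on_def
proof
  fix s :: real assume "s \<in> {0..}"
  then have s: "0 \<le> s" by simp
  show "((\<lambda>t. P_B t x) \<longlongrightarrow> P_B s x) (at s within {0..})"
  proof (cases "s = 0")
    case True
    then show ?thesis using P_B_tendsto_right[OF s] by simp
  next
    case False
    then have "{0..} = {0..s} \<union> {s..}" using s by auto
    then show ?thesis
      using P_B_tendsto_left[of s x] P_B_tendsto_right[OF s, of x] s False by (simp add: Lim_within_Un)
  qed
qed

text \<open>
  The constant is increased by 1 for the sake of the unstable estimate at \<open>t = s\<close>, where \<open>x - P_B s x\<close> is estimated by the triangle
  inequality.
\<close>

theorem V_dichotomy: "nonuniform_dichotomy {0..} V \<beta> (1 + M) \<epsilon>"
  unfolding nonuniform_dichotomy_def
proof (intro conjI exI[of _ P_B] allI ballI impI)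
  show "0 < \<beta>" "0 \<le> \<epsilon>" "0 < 1 + M" using constants M_nonneg by auto
  show "continuous_on {0..} (\<lambda>t. P_B t x)" for x by (rule P_B_continuous)
  show "P_B t o\<^sub>L P_B t = P_B t" if "t \<in> {0..}" for t
    by (rule blinfun_eqI) (use that P_B_idem in simp)
next
  fix t s :: real assume "t \<in> {0..}" "s \<in> {0..}" "s \<le> t"
  then have st: "0 \<le> s" "s \<le> t" by auto
  show "V t s o\<^sub>L P_B s = P_B t o\<^sub>L V t s"
    by (rule blinfun_eqI) (simp add: V_P_B[OF st])
  show "bij_betw (V t s) (null_space (P_B s)) (null_space (P_B t))" by (rule V_bij_null_space[OF st])
  show "norm (V t s o\<^sub>L P_B s) \<le> (1 + M) * exp (- \<beta> * (t - s) + \<epsilon> * \<bar>s\<bar>)"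
  proof (rule norm_blinfun_bound)
    fix x
    have "norm ((V t s o\<^sub>L P_B s) x) \<le> M * exp (- \<beta> * \<bar>t - s\<bar> + \<epsilon> * s) * norm x"
      using norm_G_B_apply[of s t x] st by (simp add: V_P_B[OF st])
    also have "\<dots> \<le> (1 + M) * exp (- \<beta> * \<bar>t - s\<bar> + \<epsilon> * s) * norm x"
      by (intro mult_right_mono) auto
    finally show "norm ((V t s o\<^sub>L P_B s) x) \<le> (1 + M) * exp (- \<beta> * (t - s) + \<epsilon> * \<bar>s\<bar>) * norm x"
      using st by simp
  qed (use M_nonneg in simp)
next
  fix t s :: real and x assume "t \<in> {0..}" "s \<in> {0..}" "t \<le> s"
  then have ts: "0 \<le> t" "t \<le> s" "0 \<le> s" by auto
  obtain z where z: "P 0 z = 0" "x - P_B s x = V s 0 z"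
    "\<And>r. 0 \<le> r \<Longrightarrow> r < s \<Longrightarrow> V r 0 z = - G_B r s x"
    using complement_representation[OF ts(3), of x] by metis
  have "inv_into (null_space (P_B t)) (V s t) (x - P_B s x) = V t 0 z"
  proof (rule inv_into_f_eq)
    show "inj_on (V s t) (null_space (P_B t))"
      using V_bij_null_space[OF ts(1,2)] by (rule bij_betw_imp_inj_on)
    show "V t 0 z \<in> null_space (P_B t)" using z(1) ts by (simp add: null_space_P_B)
    show "V s t (V t 0 z) = x - P_B s x" using ts z(2) by (simp add: V_comp)
  qed
  moreover have "norm (V t 0 z) \<le> (1 + M) * exp (- \<beta> * (s - t) + \<epsilon> * \<bar>s\<bar>) * norm x"
  proof (cases "t = s")
    case False
    then have "norm (V t 0 z) = norm (G_B t s x)" using z(3)[of t] ts by simp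
    also have "\<dots> \<le> M * exp (- \<beta> * \<bar>t - s\<bar> + \<epsilon> * s) * norm x" by (rule norm_G_B_apply) (use ts in auto)
    also have "\<dots> \<le> (1 + M) * exp (- \<beta> * \<bar>t - s\<bar> + \<epsilon> * s) * norm x"
      by (intro mult_right_mono) auto
    finally show ?thesis using ts by (simp add: abs_if split: if_splits)
  next
    case True
    have "norm (V t 0 z) \<le> norm x + norm (P_B s x)"
      using True z(2) norm_triangle_ineq4[of x "P_B s x"] by simp
    also have "\<dots> \<le> exp (\<epsilon> * s) * norm x + M * exp (\<epsilon> * s) * norm x"
    proof (rule add_mono)
      have "1 \<le> exp (\<epsilon> * s)" using constants(3) ts by simp
      from mult_right_mono[OF this norm_ge_zero[of x]] show "norm x \<le> exp (\<epsilon> * s) * norm x" by simp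
      show "norm (P_B s x) \<le> M * exp (\<epsilon> * s) * norm x"
        using norm_G_B_apply[of s s x] ts by (simp add: P_B_def)
    qed
    finally show ?thesis using True ts by (simp add: algebra_simps)
  qed
  ultimately show "norm (inv_into (null_space (P_B t)) (V s t) (x - P_B s x))
      \<le> (1 + M) * exp (- \<beta> * (s - t) + \<epsilon> * \<bar>s\<bar>) * norm x" by simp
qed

end

section \<open>Robustness of the dichotomy\<close>

lemma integrable_on_if_nn_integral_le:
  fixes f :: "real \<Rightarrow> real"
  assumes f: "f \<in> borel_measurable lebesgue" "\<And>x. 0 \<le> f x"
    and le: "(\<integral>\<^sup>+x. ennreal (f x) \<partial>lebesgue) \<le> ennreal c" and c: "0 \<le> c" and S: "S \<in> sets lebesgue"
  shows "f integrable_on S" "integral S f \<le> c"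
proof -
  define r where "r = enn2real (\<integral>\<^sup>+x. ennreal (f x) \<partial>lebesgue)"
  have "(\<integral>\<^sup>+x. ennreal (f x) \<partial>lebesgue) < top"
    using le by (rule order_le_less_trans) simp
  then have nn: "(\<integral>\<^sup>+x. ennreal (f x) \<partial>lebesgue) = ennreal r"
    by (simp add: r_def)
  have r: "0 \<le> r" "r \<le> c" using le c unfolding nn by (simp_all add: r_def)
  have I: "(f has_integral r) UNIV"
    using has_integral_iff_nn_integral_lebesgue[of f r] f nn r(1) by simp
  have "f absolutely_integrable_on UNIV"
    using I f(2) by (intro nonnegative_absolutely_integrable_1) auto
  then have "f absolutely_integrable_on S" by (rule set_integrable_subset) (use S in auto)
  then show i: "f integrable_on S" by (rule set_lebesgue_integral_eq_integral(1))
  have "integral S f \<le> integral UNIV f"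
    by (rule integral_subset_le) (use i I f(2) in auto)
  then show "integral S f \<le> c" using integral_unique[OF I] r(2) by simp
qed

text \<open>
  The supremum over all \<open>t\<close> is finite, hence equal to a real number \<open>\<theta>\<close>, which bounds the weighted integrals over the half-line.
\<close>

theorem theorem3p2:
  fixes A B :: "real \<Rightarrow> 'a::banach \<Rightarrow>\<^sub>L 'a"
    and U :: "real \<Rightarrow> real \<Rightarrow> 'a \<Rightarrow>\<^sub>L 'a"
    and \<alpha> \<beta> K \<epsilon> :: real
    and Z :: "'a set"
  assumes "evolution_family {0..} U"
    and "generated_by {0..} U A"
    and "\<And>x. strongly_measurable (\<lambda>t. B t x)"
    and "(\<lambda>t. norm (B t)) \<in> borel_measurable lebesgue"
    and "nonuniform_dichotomy {0..} U \<alpha> K \<epsilon>"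
    and "0 < \<alpha>" and "0 < K"
    and "0 < \<beta>" and "0 \<le> \<epsilon>" and "\<epsilon> < \<alpha> - \<beta>"
    and "subspace Z" and "closed Z"
    and "(SUP t::real. \<integral>\<^sup>+\<tau>. ennreal (exp (- (\<alpha> - \<beta>) * \<bar>t - \<tau>\<bar>) * (norm (B \<tau>) * exp (\<epsilon> * \<bar>\<tau>\<bar>))) \<partial>lebesgue)
           < ennreal (1 / K)"
  shows "perturbed_equation_admits_dichotomy {0..} U B"
proof -
  let ?w = "\<lambda>t \<tau>. exp (- (\<alpha> - \<beta>) * \<bar>t - \<tau>\<bar>) * (norm (B \<tau>) * exp (\<epsilon> * \<bar>\<tau>\<bar>))"
  let ?S = "SUP t::real. \<integral>\<^sup>+\<tau>. ennreal (?w t \<tau>) \<partial>lebesgue"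
  define \<theta> where "\<theta> = enn2real ?S"
  have "?S < top" using assms(13) by (rule order_less_trans) simp
  then have S: "?S = ennreal \<theta>" unfolding \<theta>_def by (rule ennreal_enn2real[symmetric])
  have \<theta>: "0 \<le> \<theta>" "K * \<theta> < 1"
  proof -
    show \<theta>0: "0 \<le> \<theta>" by (simp add: \<theta>_def)
    have "\<theta> < 1 / K" using assms(7,13) \<theta>0 unfolding S by (simp add: ennreal_less_iff)
    then show "K * \<theta> < 1" using assms(7) by (simp add: field_simps)
  qed
  have w_meas: "?w t \<in> borel_measurable lebesgue" for t
  proof -
    have "(\<lambda>\<tau>. exp (- (\<alpha> - \<beta>) * \<bar>t - \<tau>\<bar>)) \<in> borel_measurable lebesgue"
      "(\<lambda>\<tau>. exp (\<epsilon> * \<bar>\<tau>\<bar>)) \<in> borel_measurable lebesgue"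
      by (intro measurable_completion; measurable)+
    then show ?thesis using assms(4) by measurable
  qed
  have w_le: "(\<integral>\<^sup>+\<tau>. ennreal (?w t \<tau>) \<partial>lebesgue) \<le> ennreal \<theta>" for t
    unfolding S[symmetric] by (rule SUP_upper) simp
  have w: "?w t integrable_on S" "integral S (?w t) \<le> \<theta>" if "S \<in> sets lebesgue" for t S
    by (rule integrable_on_if_nn_integral_le[OF w_meas _ w_le \<theta>(1) that]; simp)+
  have B_int: "(\<lambda>t. norm (B t)) integrable_on {0..T}" for T
  proof -
    \<comment> \<open>The weight at \<open>t = 0\<close> is bounded below on compact intervals, so \<open>norm B\<close> is locally integrable.\<close>
    have "(\<lambda>\<tau>. ?w 0 \<tau> * exp ((\<alpha> - \<beta> - \<epsilon>) * \<bar>\<tau>\<bar>)) integrable_on {0..T}"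
      by (rule integrable_mult_continuous) (use w(1)[of "{0..T}" 0] in \<open>auto intro!: continuous_intros\<close>)
    moreover have "?w 0 \<tau> * exp ((\<alpha> - \<beta> - \<epsilon>) * \<bar>\<tau>\<bar>) = norm (B \<tau>)" for \<tau>
    proof -
      have "?w 0 \<tau> * exp ((\<alpha> - \<beta> - \<epsilon>) * \<bar>\<tau>\<bar>) =
          norm (B \<tau>) * exp (- (\<alpha> - \<beta>) * \<bar>0 - \<tau>\<bar> + \<epsilon> * \<bar>\<tau>\<bar> + (\<alpha> - \<beta> - \<epsilon>) * \<bar>\<tau>\<bar>)"
        unfolding exp_add by (simp add: mult_ac)
      also have "- (\<alpha> - \<beta>) * \<bar>0 - \<tau>\<bar> + \<epsilon> * \<bar>\<tau>\<bar> + (\<alpha> - \<beta> - \<epsilon>) * \<bar>\<tau>\<bar> = 0" by (simp add: algebra_simps)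
      finally show ?thesis by simp
    qed
    ultimately show ?thesis by (simp only:)
  qed
  obtain P where P:
    "\<forall>t\<in>{0..}. P t o\<^sub>L P t = P t"
    "\<forall>t\<in>{0..}. \<forall>s\<in>{0..}. s \<le> t \<longrightarrow> U t s o\<^sub>L P s = P t o\<^sub>L U t s"
    "\<forall>t\<in>{0..}. \<forall>s\<in>{0..}. s \<le> t \<longrightarrow> bij_betw (blinfun_apply (U t s)) (null_space (P s)) (null_space (P t))"
    "\<forall>t\<in>{0..}. \<forall>s\<in>{0..}. s \<le> t \<longrightarrow> norm (U t s o\<^sub>L P s) \<le> K * exp (- \<alpha> * (t - s) + \<epsilon> * \<bar>s\<bar>)"
    "\<forall>t\<in>{0..}. \<forall>s\<in>{0..}. t \<le> s \<longrightarrow>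
       (\<forall>x. norm (inv_into (null_space (P t)) (blinfun_apply (U s t)) (x - blinfun_apply (P s) x))
              \<le> K * exp (- \<alpha> * (s - t) + \<epsilon> * \<bar>s\<bar>) * norm x)"
    using assms(5) unfolding nonuniform_dichotomy_def by (elim conjE exE) (rule that)
  interpret dichotomy_perturbation U B P \<alpha> \<beta> K \<epsilon> \<theta>
  proof unfold_locales
    show "P t (P t x) = P t x" if "0 \<le> t" for t x
      using fun_cong[OF arg_cong[OF P(1)[rule_format, of t], of blinfun_apply], of x] that by simp
    show "U t s (P s x) = P t (U t s x)" if "0 \<le> s" "s \<le> t" for s t x
      using fun_cong[OF arg_cong[OF P(2)[rule_format, of t s], of blinfun_apply], of x] that by simp
    show "norm (U t s o\<^sub>L P s) \<le> K * exp (- \<alpha> * (t - s) + \<epsilon> * s)" if "0 \<le> s" "s \<le> t" for s t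
      using P(4)[rule_format, of t s] that by simp
    show "norm (inv_into (null_space (P t)) (blinfun_apply (U s t)) (x - P s x))
        \<le> K * exp (- \<alpha> * (s - t) + \<epsilon> * s) * norm x" if "0 \<le> t" "t \<le> s" for s t x
      using P(5)[rule_format, of t s x] that by simp
    show "bij_betw (blinfun_apply (U t s)) (null_space (P s)) (null_space (P t))" if "0 \<le> s" "s \<le> t" for s t
      using P(3)[rule_format, of t s] that by simp
    show "?w t integrable_on {0..}" "integral {0..} (?w t) \<le> \<theta>" for t
      by (rule w; simp)+
    show "\<beta> \<le> \<alpha>" using assms(9,10) by simp
  qed (rule assms(1,3,4,7,8,9) B_int \<theta>)+
  show ?thesis
    unfolding perturbed_equation_admits_dichotomy_def
  proof (intro exI[of _ V] conjI allI impI ballI)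
    show "perturbed_evolution_family {0..} U B V" by (rule perturbed_evolution_family_V)
    show "W t s = V t s"
      if "perturbed_evolution_family {0..} U B W" "t \<in> {0..}" "s \<in> {0..}" "s \<le> t" for W t s
      using perturbed_evolution_family_unique[OF that(1)] that by simp
    show "\<exists>\<alpha> K \<epsilon>. nonuniform_dichotomy {0..} V \<alpha> K \<epsilon>"
      using V_dichotomy by (intro exI)
  qed
qed

end
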